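(* Let $g$ be a Lorentzian metric of class $C^2$ on the smooth manifold $M$ (time-oriented), and let $H\subset M$ be a null hypersurface of class $C^2$. Then locally there exists a $C^1$ normal vector field $L$ with $\nabla_LL=0$ and $L$ future-directed; that is, every $z\in H$ has an open neighbourhood $Z\subset H$ and a nowhere vanishing future-directed $C^1$ section $L$ of $\mathscr NH$ over $Z$ such that $\nabla_LL=0$ on $Z$.
   Context: Lorentzian metrics have signature $(-,+,\dots,+)$. A hypersurface $H\subset M$ is null if $g|_{TH}$ is degenerate. $\mathscr N H=\{v\in TM|_H: g(v,w)=0\ \forall w\in TH\}$ is the normal bundle, which for null $H$ is a line sub-bundle of $TH$; a normal vector field is a section of it. $\nabla$ is the Levi-Civita connection of $g$; $\nabla_XY$ for $X,Y$ tangent to $H$ is computed with any extension of $Y$. *)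

theory Defs
  imports "HOL-Analysis.Analysis"
begin

section \<open>Functions of class \<open>C\<^sup>k\<close> on open subsets of normed spaces\<close>

text \<open>Only used for open \<open>S\<close> in a finite-dimensional space, where continuity of all iterated
  directional derivatives is the usual notion of class \<open>C\<^sup>k\<close>.\<close>

fun Ck_on :: "nat \<Rightarrow> 'a::real_normed_vector set \<Rightarrow> ('a \<Rightarrow> 'b::real_normed_vector) \<Rightarrow> bool" where
  "Ck_on 0 S f \<longleftrightarrow> continuous_on S f"
| "Ck_on (Suc k) S f \<longleftrightarrow>
     (\<forall>x\<in>S. f differentiable (at x)) \<and>
     (\<forall>v. Ck_on k S (\<lambda>x. frechet_derivative f (at x) v))"


section \<open>Smooth manifolds\<close>

text \<open>The underlying set of the manifold is the whole type \<open>'m\<close>; a manifold is given by a smooth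
  atlas on it, modelled on the Euclidean space \<open>'e\<close>. A chart is a pair of its domain and its
  coordinate map; the values of the map outside the domain are irrelevant.\<close>

type_synonym ('m, 'e) chart = "'m set \<times> ('m \<Rightarrow> 'e)"

abbreviation cdom :: "('m, 'e) chart \<Rightarrow> 'm set" where "cdom c \<equiv> fst c"
abbreviation cmap :: "('m, 'e) chart \<Rightarrow> 'm \<Rightarrow> 'e" where "cmap c \<equiv> snd c"

definition cinv :: "('m, 'e) chart \<Rightarrow> 'e \<Rightarrow> 'm" where
  "cinv c = inv_into (cdom c) (cmap c)"

definition is_chart :: "('m::topological_space, 'e::euclidean_space) chart \<Rightarrow> bool" where
  "is_chart c \<longleftrightarrow> open (cdom c) \<and> open (cmap c ` cdom c) \<and>
     homeomorphism (cdom c) (cmap c ` cdom c) (cmap c) (cinv c)"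

definition Ck_compatible ::
  "nat \<Rightarrow> ('m, 'e::euclidean_space) chart \<Rightarrow> ('m, 'e) chart \<Rightarrow> bool" where
  "Ck_compatible k c d \<longleftrightarrow>
     Ck_on k (cmap c ` (cdom c \<inter> cdom d)) (cmap d \<circ> cinv c) \<and>
     Ck_on k (cmap d ` (cdom c \<inter> cdom d)) (cmap c \<circ> cinv d)"

definition smooth_manifold ::
  "('m::{t2_space, second_countable_topology}, 'e::euclidean_space) chart set \<Rightarrow> bool" where
  "smooth_manifold A \<longleftrightarrow>
     (\<forall>c\<in>A. is_chart c) \<and> (\<Union>c\<in>A. cdom c) = UNIV \<and>
     (\<forall>c\<in>A. \<forall>d\<in>A. \<forall>k. Ck_compatible k c d)"


section \<open>Tangent vectors and vector fields\<close>

text \<open>A tangent vector at \<open>p\<close> is the family of its coordinate representations in all charts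
  of the atlas around \<open>p\<close>, which transform into each other by the differentials of the transition
  maps. Entries for other charts are normalised to \<open>0\<close>.\<close>

type_synonym ('m, 'e) tvec = "('m, 'e) chart \<Rightarrow> 'e"

definition tangent_space :: "('m, 'e::euclidean_space) chart set \<Rightarrow> 'm \<Rightarrow> ('m, 'e) tvec set" where
  "tangent_space A p = {v.
     (\<forall>c\<in>A. \<forall>d\<in>A. p \<in> cdom c \<longrightarrow> p \<in> cdom d \<longrightarrow>
        v d = frechet_derivative (cmap d \<circ> cinv c) (at (cmap c p)) (v c)) \<and>
     (\<forall>c. \<not> (c \<in> A \<and> p \<in> cdom c) \<longrightarrow> v c = 0)}"

definition tzero :: "('m, 'e::euclidean_space) tvec" where
  "tzero = (\<lambda>c. 0)"

definition tadd :: "('m, 'e::euclidean_space) tvec \<Rightarrow> ('m, 'e) tvec \<Rightarrow> ('m, 'e) tvec" where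
  "tadd v w = (\<lambda>c. v c + w c)"

definition tscale :: "real \<Rightarrow> ('m, 'e::euclidean_space) tvec \<Rightarrow> ('m, 'e) tvec" where
  "tscale r v = (\<lambda>c. r *\<^sub>R v c)"

text \<open>The tangent vector at \<open>p\<close> whose coordinates in the chart \<open>c\<close> are \<open>u\<close>, i.e.
  \<open>\<Sum>i. u\<^sub>i \<partial>\<^sub>i\<close>.\<close>

definition coord_vec ::
  "('m, 'e::euclidean_space) chart set \<Rightarrow> ('m, 'e) chart \<Rightarrow> 'm \<Rightarrow> 'e \<Rightarrow> ('m, 'e) tvec" where
  "coord_vec A c p u = (\<lambda>d. if d \<in> A \<and> p \<in> cdom d
     then frechet_derivative (cmap d \<circ> cinv c) (at (cmap c p)) u else 0)"

text \<open>The derivative \<open>v f\<close> of a function \<open>f\<close> along a tangent vector \<open>v\<close> at \<open>p\<close>, computed in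
  the chart \<open>c\<close> around \<open>p\<close>.\<close>

definition dir_deriv ::
  "('m, 'e::euclidean_space) chart \<Rightarrow> 'm \<Rightarrow> ('m, 'e) tvec \<Rightarrow> ('m \<Rightarrow> real) \<Rightarrow> real" where
  "dir_deriv c p v f = frechet_derivative (f \<circ> cinv c) (at (cmap c p)) (v c)"

definition Ck_function ::
  "('m, 'e::euclidean_space) chart set \<Rightarrow> nat \<Rightarrow> 'm set \<Rightarrow> ('m \<Rightarrow> real) \<Rightarrow> bool" where
  "Ck_function A k U f \<longleftrightarrow> (\<forall>c\<in>A. Ck_on k (cmap c ` (U \<inter> cdom c)) (f \<circ> cinv c))"

text \<open>Vector fields of class \<open>C\<^sup>k\<close> on an open set \<open>U\<close>.\<close>

definition Ck_field ::
  "('m, 'e::euclidean_space) chart set \<Rightarrow> nat \<Rightarrow> 'm set \<Rightarrow> ('m \<Rightarrow> ('m, 'e) tvec) \<Rightarrow> bool" where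
  "Ck_field A k U X \<longleftrightarrow>
     (\<forall>p\<in>U. X p \<in> tangent_space A p) \<and>
     (\<forall>c\<in>A. Ck_on k (cmap c ` (U \<inter> cdom c)) (\<lambda>x. X (cinv c x) c))"

text \<open>In coordinates, \<open>[X,Y]\<^sup>i = X\<^sup>j \<partial>\<^sub>j Y\<^sup>i - Y\<^sup>j \<partial>\<^sub>j X\<^sup>i\<close>.\<close>

definition lie_bracket ::
  "('m, 'e::euclidean_space) chart set \<Rightarrow> ('m \<Rightarrow> ('m, 'e) tvec) \<Rightarrow> ('m \<Rightarrow> ('m, 'e) tvec) \<Rightarrow>
   'm \<Rightarrow> ('m, 'e) tvec" where
  "lie_bracket A X Y p = (\<lambda>c. if c \<in> A \<and> p \<in> cdom c
     then frechet_derivative (\<lambda>x. Y (cinv c x) c) (at (cmap c p)) (X p c)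
        - frechet_derivative (\<lambda>x. X (cinv c x) c) (at (cmap c p)) (Y p c)
     else 0)"


section \<open>Lorentzian metrics\<close>

type_synonym ('m, 'e) metric_tensor = "'m \<Rightarrow> ('m, 'e) tvec \<Rightarrow> ('m, 'e) tvec \<Rightarrow> real"

text \<open>Signature \<open>(-,+,\<dots>,+)\<close>: every tangent space has a basis \<open>E\<close>, indexed by the standard basis
  of \<open>'e\<close>, that diagonalises \<open>g\<close> to \<open>diag(-1,1,\<dots>,1)\<close>.\<close>

definition lorentzian_metric ::
  "('m, 'e::euclidean_space) chart set \<Rightarrow> nat \<Rightarrow> ('m, 'e) metric_tensor \<Rightarrow> bool" where
  "lorentzian_metric A k g \<longleftrightarrow>
     (\<forall>p. \<forall>u\<in>tangent_space A p. \<forall>v\<in>tangent_space A p. \<forall>w\<in>tangent_space A p. \<forall>r.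
        g p u v = g p v u \<and>
        g p (tadd u v) w = g p u w + g p v w \<and>
        g p (tscale r u) w = r * g p u w) \<and>
     (\<forall>p. \<exists>E :: 'e \<Rightarrow> ('m, 'e) tvec. \<exists>b\<^sub>0\<in>Basis. (\<forall>b\<in>Basis. E b \<in> tangent_space A p) \<and>
        (\<forall>b\<in>Basis. \<forall>b'\<in>Basis.
           g p (E b) (E b') = (if b \<noteq> b' then 0 else if b = b\<^sub>0 then -1 else 1))) \<and>
     (\<forall>c\<in>A. \<forall>u v. Ck_on k (cmap c ` cdom c)
        (\<lambda>x. g (cinv c x) (coord_vec A c (cinv c x) u) (coord_vec A c (cinv c x) v)))"

text \<open>A time orientation is given by a continuous timelike vector field \<open>T\<close> on the manifold.\<close>

definition time_orientation ::
  "('m, 'e::euclidean_space) chart set \<Rightarrow> ('m, 'e) metric_tensor \<Rightarrow>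
   ('m \<Rightarrow> ('m, 'e) tvec) \<Rightarrow> bool" where
  "time_orientation A g T \<longleftrightarrow> Ck_field A 0 UNIV T \<and> (\<forall>p. g p (T p) (T p) < 0)"

definition future_directed ::
  "('m, 'e::euclidean_space) chart set \<Rightarrow> ('m, 'e) metric_tensor \<Rightarrow>
   ('m \<Rightarrow> ('m, 'e) tvec) \<Rightarrow> 'm \<Rightarrow> ('m, 'e) tvec \<Rightarrow> bool" where
  "future_directed A g T p v \<longleftrightarrow>
     v \<in> tangent_space A p \<and> v \<noteq> tzero \<and> g p v v \<le> 0 \<and> g p v (T p) < 0"


section \<open>The Levi-Civita connection\<close>

text \<open>An affine connection acts on vector fields of class \<open>C\<^sup>1\<close> that are defined on arbitrary open
  subsets \<open>U\<close>: \<open>nabla X Y p\<close> is \<open>\<nabla>\<^sub>X Y\<close> at \<open>p\<close>. Since functions are total, \<open>X\<close> and \<open>Y\<close> may have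
  arbitrary values outside \<open>U\<close>.\<close>

type_synonym ('m, 'e) connection =
  "('m \<Rightarrow> ('m, 'e) tvec) \<Rightarrow> ('m \<Rightarrow> ('m, 'e) tvec) \<Rightarrow> 'm \<Rightarrow> ('m, 'e) tvec"

definition affine_connection ::
  "('m::topological_space, 'e::euclidean_space) chart set \<Rightarrow> ('m, 'e) connection \<Rightarrow> bool" where
  "affine_connection A nabla \<longleftrightarrow>
     (\<forall>U X Y Z f p c. open U \<longrightarrow> p \<in> U \<longrightarrow> c \<in> A \<longrightarrow> p \<in> cdom c \<longrightarrow>
        Ck_field A 1 U X \<longrightarrow> Ck_field A 1 U Y \<longrightarrow> Ck_field A 1 U Z \<longrightarrow> Ck_function A 1 U f \<longrightarrow>
        nabla X Y p \<in> tangent_space A p \<and>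
        nabla (\<lambda>q. tadd (X q) (Z q)) Y p = tadd (nabla X Y p) (nabla Z Y p) \<and>
        nabla (\<lambda>q. tscale (f q) (X q)) Y p = tscale (f p) (nabla X Y p) \<and>
        nabla X (\<lambda>q. tadd (Y q) (Z q)) p = tadd (nabla X Y p) (nabla X Z p) \<and>
        nabla X (\<lambda>q. tscale (f q) (Y q)) p =
          tadd (tscale (dir_deriv c p (X p) f) (Y p)) (tscale (f p) (nabla X Y p)))"

text \<open>The Levi-Civita connection is the affine connection that is torsion free,
  \<open>\<nabla>\<^sub>X Y - \<nabla>\<^sub>Y X = [X,Y]\<close>, and metric, \<open>X (g(Y,Z)) = g(\<nabla>\<^sub>X Y, Z) + g(Y, \<nabla>\<^sub>X Z)\<close>. By the Koszul
  formula on \<open>U\<close>, these properties determine \<open>nabla X Y p\<close> for \<open>C\<^sup>1\<close> fields on \<open>U\<close>; in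
  particular its value only depends on \<open>X\<close> and \<open>Y\<close> near \<open>p\<close>.\<close>

definition levi_civita ::
  "('m::topological_space, 'e::euclidean_space) chart set \<Rightarrow> ('m, 'e) metric_tensor \<Rightarrow>
   ('m, 'e) connection \<Rightarrow> bool" where
  "levi_civita A g nabla \<longleftrightarrow> affine_connection A nabla \<and>
     (\<forall>U X Y Z p c. open U \<longrightarrow> p \<in> U \<longrightarrow> c \<in> A \<longrightarrow> p \<in> cdom c \<longrightarrow>
        Ck_field A 1 U X \<longrightarrow> Ck_field A 1 U Y \<longrightarrow> Ck_field A 1 U Z \<longrightarrow>
        nabla X Y p = tadd (nabla Y X p) (lie_bracket A X Y p) \<and>
        dir_deriv c p (X p) (\<lambda>q. g q (Y q) (Z q)) =
          g p (nabla X Y p) (Z p) + g p (Y p) (nabla X Z p))"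


section \<open>Null hypersurfaces\<close>

text \<open>An (embedded) hypersurface of class \<open>C\<^sup>k\<close> is locally a coordinate hyperplane in a chart of the
  underlying \<open>C\<^sup>k\<close> manifold, i.e. a chart that need only be \<open>C\<^sup>k\<close>-compatible with the smooth
  atlas. Its topology is the subspace topology.\<close>

definition Ck_hypersurface ::
  "('m::topological_space, 'e::euclidean_space) chart set \<Rightarrow> nat \<Rightarrow> 'm set \<Rightarrow> bool" where
  "Ck_hypersurface A k H \<longleftrightarrow>
     (\<forall>p\<in>H. \<exists>c. is_chart c \<and> (\<forall>d\<in>A. Ck_compatible k c d) \<and> p \<in> cdom c \<and>
        (\<exists>b\<in>Basis. cmap c ` (cdom c \<inter> H) = cmap c ` cdom c \<inter> {x. x \<bullet> b = 0}))"

text \<open>\<open>T\<^sub>pH\<close> is the set of velocities at \<open>p\<close> of \<open>C\<^sup>1\<close> curves in \<open>H\<close> through \<open>p\<close>; the curves can be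
  chosen so short that they stay in one chart of the atlas.\<close>

definition tangent_space_in ::
  "('m, 'e::euclidean_space) chart set \<Rightarrow> 'm set \<Rightarrow> 'm \<Rightarrow> ('m, 'e) tvec set" where
  "tangent_space_in A H p = {coord_vec A c p (vector_derivative (cmap c \<circ> \<gamma>) (at 0)) | c \<gamma> \<epsilon>.
     c \<in> A \<and> 0 < \<epsilon> \<and> \<gamma> ` {-\<epsilon><..<\<epsilon>} \<subseteq> H \<inter> cdom c \<and> \<gamma> 0 = p \<and>
     (cmap c \<circ> \<gamma>) C1_differentiable_on {-\<epsilon><..<\<epsilon>}}"

definition normal_fibre ::
  "('m, 'e::euclidean_space) chart set \<Rightarrow> ('m, 'e) metric_tensor \<Rightarrow> 'm set \<Rightarrow> 'm \<Rightarrow>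
   ('m, 'e) tvec set" where
  "normal_fibre A g H p =
     {v \<in> tangent_space A p. \<forall>w\<in>tangent_space_in A H p. g p v w = 0}"

definition null_hypersurface ::
  "('m::topological_space, 'e::euclidean_space) chart set \<Rightarrow> ('m, 'e) metric_tensor \<Rightarrow> nat \<Rightarrow>
   'm set \<Rightarrow> bool" where
  "null_hypersurface A g k H \<longleftrightarrow> Ck_hypersurface A k H \<and>
     (\<forall>p\<in>H. \<exists>v\<in>tangent_space_in A H p. v \<noteq> tzero \<and>
        (\<forall>w\<in>tangent_space_in A H p. g p v w = 0))"


section \<open>Vector fields along subsets\<close>

text \<open>\<open>X'\<close> is an extension of class \<open>C\<^sup>k\<close>, to the neighbourhood \<open>U\<close> of \<open>p\<close>, of the field \<open>X\<close> of
  tangent vectors of the ambient manifold along \<open>Z\<close>.\<close>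

definition Ck_extension ::
  "('m::topological_space, 'e::euclidean_space) chart set \<Rightarrow> nat \<Rightarrow> 'm set \<Rightarrow>
   ('m \<Rightarrow> ('m, 'e) tvec) \<Rightarrow> 'm \<Rightarrow> 'm set \<Rightarrow> ('m \<Rightarrow> ('m, 'e) tvec) \<Rightarrow> bool" where
  "Ck_extension A k Z X p U X' \<longleftrightarrow>
     open U \<and> p \<in> U \<and> Ck_field A k U X' \<and> (\<forall>q\<in>U \<inter> Z. X' q = X q)"

text \<open>A field along the not necessarily open set \<open>Z\<close> is of class \<open>C\<^sup>k\<close> if it locally extends to a
  \<open>C\<^sup>k\<close> field on an open set.\<close>

definition Ck_field_along ::
  "('m::topological_space, 'e::euclidean_space) chart set \<Rightarrow> nat \<Rightarrow> 'm set \<Rightarrow>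
   ('m \<Rightarrow> ('m, 'e) tvec) \<Rightarrow> bool" where
  "Ck_field_along A k Z X \<longleftrightarrow> (\<forall>p\<in>Z. \<exists>U X'. Ck_extension A k Z X p U X')"

text \<open>\<open>\<nabla>\<^sub>X Y = w\<close> at \<open>p\<close> for fields \<open>X\<close>, \<open>Y\<close> along \<open>Z\<close>: extensions exist, and all of them give
  the value \<open>w\<close>.\<close>

definition has_covariant_derivative_along ::
  "('m::topological_space, 'e::euclidean_space) chart set \<Rightarrow> ('m, 'e) connection \<Rightarrow> 'm set \<Rightarrow>
   ('m \<Rightarrow> ('m, 'e) tvec) \<Rightarrow> ('m \<Rightarrow> ('m, 'e) tvec) \<Rightarrow> 'm \<Rightarrow> ('m, 'e) tvec \<Rightarrow> bool" where
  "has_covariant_derivative_along A nabla Z X Y p w \<longleftrightarrow>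
     (\<exists>U X' Y'. Ck_extension A 1 Z X p U X' \<and> Ck_extension A 1 Z Y p U Y') \<and>
     (\<forall>U X' Y'. Ck_extension A 1 Z X p U X' \<longrightarrow> Ck_extension A 1 Z Y p U Y' \<longrightarrow>
        nabla X' Y' p = w)"

end

theory Submission
  imports Defs
begin

text \<open>
  Near a point, \<open>H\<close> is the zero set of a \<open>C\<^sup>2\<close> function \<open>\<phi>\<close>, and the gradient \<open>N\<close> of \<open>\<phi>\<close> with respect to \<open>g\<close> is a
  \<open>C\<^sup>1\<close> normal field. It satisfies \<open>\<nabla>\<^sub>N N = \<kappa> N\<close> along \<open>H\<close>, so rescaling it to a geodesic field \<open>f N\<close> amounts to the
  transport equation \<open>N f + \<kappa> f = 0\<close> along the null generators. But \<open>\<kappa>\<close> contains second derivatives of \<open>\<phi>\<close> and is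
  only continuous; this equation does not show that \<open>f\<close> is differentiable across the generators.

  The regularity comes from the ambient geodesic flow instead. Christoffel symbols of a \<open>C\<^sup>2\<close> metric
  are \<open>C\<^sup>1\<close>, so geodesics and their velocities depend in a \<open>C\<^sup>1\<close> way on the initial data
  (\<open>local_flow\<close>). Start geodesics with velocity \<open>N\<close>, up to sign, from a slice of \<open>H\<close> transversal to \<open>N\<close>, where these
  data are \<open>C\<^sup>1\<close>. If the geodesics stay in \<open>H\<close> and remain normal to it, their velocities form the
  desired field: time and initial point are \<open>C\<^sup>1\<close> coordinates on \<open>H\<close> by the inverse function theorem
  (\<open>geodesic_conormal_field\<close>).

  That they do stay in \<open>H\<close> and normal to it is a statement about the flow on pairs \<open>(x, p)\<close> of points and covectors: it
  preserves the set of all \<open>(x, \<sigma> d\<phi>)\<close> with \<open>x\<close> in \<open>H\<close>. The generator of the flow is tangent to this set, which restates that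
  \<open>\<nabla>\<^sub>N N\<close> is a multiple of \<open>N\<close> (\<open>spray_tangent_to_conormals\<close>), and a Lipschitz vector field leaves a closed set
  invariant if it is tangent to it (\<open>tangent_set_invariant\<close>). The latter avoids solving an equation with merely
  continuous coefficients on the set itself.

  Finally, the Koszul formula in coordinates (\<open>koszul\<close>) expresses \<open>\<nabla>\<^sub>X Y\<close> at a point so that the fields
  are differentiated only once, \<open>Y\<close> in the direction of \<open>X\<close>. For extensions of the geodesic field this derivative is taken along a curve in \<open>H\<close>, hence is the same for all
  of them, and the geodesic equation says that the result vanishes. The field can be chosen
  future-directed because a null vector is never orthogonal to a timelike one
  (\<open>lorentz_null_timelike\<close>).
\<close>

section \<open>Continuously differentiable maps\<close>

text \<open>The derivative is recorded as a map into the normed space of bounded linear operators, since its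
  continuity in operator norm is what the inverse function theorem and the variational equation
  below require.\<close>

definition C1_on :: "'a::real_normed_vector set \<Rightarrow> ('a \<Rightarrow> 'b::real_normed_vector) \<Rightarrow> bool" where
  "C1_on S f \<longleftrightarrow> (\<exists>f'. continuous_on S f' \<and> (\<forall>x\<in>S. (f has_derivative blinfun_apply (f' x)) (at x)))"

lemma C1_onI:
  assumes "continuous_on S f'" "\<And>x. x \<in> S \<Longrightarrow> (f has_derivative blinfun_apply (f' x)) (at x)"
  shows "C1_on S f"
  using assms unfolding C1_on_def by blast

lemma C1_onE:
  assumes "C1_on S f"
  obtains f' where "continuous_on S f'" "\<And>x. x \<in> S \<Longrightarrow> (f has_derivative blinfun_apply (f' x)) (at x)"
  using assms unfolding C1_on_def by blast

lemma C1_on_imp_continuous_on: "C1_on S f \<Longrightarrow> continuous_on S f"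
  by (metis C1_onE continuous_at_imp_continuous_on has_derivative_continuous)

lemma C1_on_subset: "C1_on S f \<Longrightarrow> T \<subseteq> S \<Longrightarrow> C1_on T f"
  unfolding C1_on_def by (meson continuous_on_subset subsetD)

lemma C1_on_cong:
  assumes "open S" "\<And>x. x \<in> S \<Longrightarrow> f x = g x" "C1_on S f"
  shows "C1_on S g"
proof -
  obtain f' where f': "continuous_on S f'" "\<And>x. x \<in> S \<Longrightarrow> (f has_derivative blinfun_apply (f' x)) (at x)"
    using C1_onE[OF assms(3)] by blast
  have "(g has_derivative blinfun_apply (f' x)) (at x)" if "x \<in> S" for x
    by (rule has_derivative_transform_within_open[OF f'(2)[OF that] assms(1) that]) (use assms in auto)
  then show ?thesis using f' by (auto intro: C1_onI)
qed

lemma C1_on_linear: "bounded_linear f \<Longrightarrow> C1_on S f"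
  by (rule C1_onI[where f' = "\<lambda>_. Blinfun f"])
     (auto simp: bounded_linear_Blinfun_apply intro!: bounded_linear_imp_has_derivative continuous_intros)

lemma C1_on_const: "C1_on S (\<lambda>_. c)"
  by (rule C1_onI[where f' = "\<lambda>_. 0"]) (auto intro!: derivative_eq_intros continuous_intros)

lemma C1_on_id: "C1_on S (\<lambda>x. x)"
  by (rule C1_on_linear) (rule bounded_linear_ident)

lemma C1_on_compose:
  assumes "C1_on T g" "C1_on S f" "\<And>x. x \<in> S \<Longrightarrow> f x \<in> T"
  shows "C1_on S (\<lambda>x. g (f x))"
proof -
  obtain f' where f': "continuous_on S f'" "\<And>x. x \<in> S \<Longrightarrow> (f has_derivative blinfun_apply (f' x)) (at x)"
    using C1_onE[OF assms(2)] by blast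
  obtain g' where g': "continuous_on T g'" "\<And>x. x \<in> T \<Longrightarrow> (g has_derivative blinfun_apply (g' x)) (at x)"
    using C1_onE[OF assms(1)] by blast
  show ?thesis
  proof (rule C1_onI[where f' = "\<lambda>x. g' (f x) o\<^sub>L f' x"])
    have "continuous_on S (\<lambda>x. g' (f x))"
      by (rule continuous_on_compose2[OF g'(1) C1_on_imp_continuous_on[OF assms(2)]]) (use assms(3) in auto)
    then show "continuous_on S (\<lambda>x. g' (f x) o\<^sub>L f' x)"
      by (intro bounded_bilinear.continuous_on[OF bounded_bilinear_blinfun_compose] f'(1))
    fix x assume "x \<in> S"
    then have "(g \<circ> f has_derivative blinfun_apply (g' (f x)) \<circ> blinfun_apply (f' x)) (at x)"
      by (intro diff_chain_at f' g' assms(3))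
    then show "((\<lambda>x. g (f x)) has_derivative blinfun_apply (g' (f x) o\<^sub>L f' x)) (at x)"
      by (simp add: o_def blinfun_compose.rep_eq)
  qed
qed

lemma C1_on_bounded_linear: "bounded_linear L \<Longrightarrow> C1_on S f \<Longrightarrow> C1_on S (\<lambda>x. L (f x))"
  by (rule C1_on_compose[OF C1_on_linear[of L UNIV]]) auto

lemma C1_on_bilinear:
  fixes op :: "'b::real_normed_vector \<Rightarrow> 'c::real_normed_vector \<Rightarrow> 'd::real_normed_vector"
  assumes "bounded_bilinear op" "C1_on S f" "C1_on S g"
  shows "C1_on S (\<lambda>x. op (f x) (g x))"
proof -
  interpret bounded_bilinear op by fact
  obtain f' where f': "continuous_on S f'" "\<And>x. x \<in> S \<Longrightarrow> (f has_derivative blinfun_apply (f' x)) (at x)"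
    using C1_onE[OF assms(2)] by blast
  obtain g' where g': "continuous_on S g'" "\<And>x. x \<in> S \<Longrightarrow> (g has_derivative blinfun_apply (g' x)) (at x)"
    using C1_onE[OF assms(3)] by blast
  show ?thesis
  proof (rule C1_onI[where f' = "\<lambda>x. (prod_right (f x) o\<^sub>L g' x) + (prod_left (g x) o\<^sub>L f' x)"])
    show "continuous_on S (\<lambda>x. (prod_right (f x) o\<^sub>L g' x) + (prod_left (g x) o\<^sub>L f' x))"
      by (intro continuous_on_add bounded_bilinear.continuous_on[OF bounded_bilinear_blinfun_compose]
          f'(1) g'(1) bounded_linear.continuous_on[OF bounded_linear_prod_right]
          bounded_linear.continuous_on[OF bounded_linear_prod_left] C1_on_imp_continuous_on assms)
    fix x assume x: "x \<in> S"
    show "((\<lambda>x. op (f x) (g x)) has_derivative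
        blinfun_apply ((prod_right (f x) o\<^sub>L g' x) + (prod_left (g x) o\<^sub>L f' x))) (at x)"
      by (rule has_derivative_eq_rhs[OF FDERIV[OF f'(2)[OF x] g'(2)[OF x]]])
         (auto simp: prod_right.rep_eq prod_left.rep_eq blinfun.add_left)
  qed
qed

lemmas C1_on_scaleR = C1_on_bilinear[OF bounded_bilinear_scaleR]
lemmas C1_on_mult = C1_on_bilinear[OF bounded_bilinear_mult]
lemmas C1_on_inner = C1_on_bilinear[OF bounded_bilinear_inner]
lemmas C1_on_blinfun_apply = C1_on_bilinear[OF bounded_bilinear_blinfun_apply]

lemma C1_on_add:
  assumes "C1_on S f" "C1_on S g" shows "C1_on S (\<lambda>x. f x + g x)"
proof -
  obtain f' where f': "continuous_on S f'" "\<And>x. x \<in> S \<Longrightarrow> (f has_derivative blinfun_apply (f' x)) (at x)"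
    using C1_onE[OF assms(1)] by blast
  obtain g' where g': "continuous_on S g'" "\<And>x. x \<in> S \<Longrightarrow> (g has_derivative blinfun_apply (g' x)) (at x)"
    using C1_onE[OF assms(2)] by blast
  show ?thesis
    by (rule C1_onI[where f' = "\<lambda>x. f' x + g' x"])
       (auto intro!: continuous_on_add f' g' has_derivative_eq_rhs[OF has_derivative_add] simp: blinfun.add_left)
qed

lemma C1_on_minus: "C1_on S f \<Longrightarrow> C1_on S (\<lambda>x. - f x)"
  by (rule C1_on_bounded_linear[where L = uminus]) (auto intro: bounded_linear_minus bounded_linear_ident)

lemma C1_on_diff: "C1_on S f \<Longrightarrow> C1_on S g \<Longrightarrow> C1_on S (\<lambda>x. f x - g x)"
  using C1_on_add[OF _ C1_on_minus, of S f g] by simp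

lemma C1_on_sum: "(\<And>i. i \<in> I \<Longrightarrow> C1_on S (f i)) \<Longrightarrow> C1_on S (\<lambda>x. \<Sum>i\<in>I. f i x)"
  by (induction I rule: infinite_finite_induct) (auto intro: C1_on_const C1_on_add)

lemma C1_on_Pair:
  assumes "C1_on S f" "C1_on S g" shows "C1_on S (\<lambda>x. (f x, g x))"
proof -
  have "C1_on S (\<lambda>x. (f x, 0) + (0, g x))"
    by (intro C1_on_add C1_on_bounded_linear[where L = "\<lambda>a. (a, 0)"] C1_on_bounded_linear[where L = "\<lambda>a. (0, a)"]
        assms bounded_linear_Pair bounded_linear_ident bounded_linear_zero)
  then show ?thesis by simp
qed

lemma C1_on_fst: "C1_on S f \<Longrightarrow> C1_on S (\<lambda>x. fst (f x))"
  by (rule C1_on_bounded_linear[OF bounded_linear_fst])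

text \<open>Provides the constants of the Picard iteration and the Lipschitz constant needed for invariance.\<close>

lemma C1_on_compact_bounds:
  fixes V :: "'a::euclidean_space \<Rightarrow> 'b::real_normed_vector"
  assumes "continuous_on C V'" "\<And>x. x \<in> C \<Longrightarrow> (V has_derivative blinfun_apply (V' x)) (at x)"
    and C: "compact C" "convex C"
  obtains K where "K > 0" "\<And>x. x \<in> C \<Longrightarrow> norm (V' x) \<le> K"
    "\<And>x y. x \<in> C \<Longrightarrow> y \<in> C \<Longrightarrow> norm (V x - V y) \<le> K * norm (x - y)"
proof -
  obtain K where K: "K > 0" "\<And>x. x \<in> C \<Longrightarrow> norm (V' x) \<le> K"
    using compact_imp_bounded[OF compact_continuous_image[OF assms(1) C(1)]]
    unfolding bounded_pos by auto
  have "norm (V x - V y) \<le> K * norm (x - y)" if "x \<in> C" "y \<in> C" for x y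
    by (rule differentiable_bound[OF C(2) _ _ that, where f' = "\<lambda>x. blinfun_apply (V' x)"])
       (use assms(2) K in \<open>auto intro: has_derivative_at_withinI simp: norm_blinfun.rep_eq[symmetric]\<close>)
  with K show ?thesis using that by blast
qed

section \<open>The flow of a continuously differentiable vector field\<close>

text \<open>The integral of \<open>f (\<cdot>, x)\<close> from \<open>0\<close> to \<open>\<tau>\<close>, where \<open>\<tau>\<close> is \<open>t\<close> clamped to \<open>[-\<epsilon>, \<epsilon>]\<close>. Substituting
  \<open>s = \<theta>\<tau>\<close> moves the sign of \<open>\<tau>\<close> in front of an integral over \<open>[0, 1]\<close>, which treats past and future
  uniformly; the clamping makes the result a bounded function on all of \<open>\<real> \<times> 'a\<close>.\<close>

definition time_integral :: "real \<Rightarrow> (real \<times> 'a \<Rightarrow> 'b::banach) \<Rightarrow> real \<times> 'a \<Rightarrow> 'b" where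
  "time_integral \<epsilon> f = (\<lambda>(t, x). let \<tau> = max (-\<epsilon>) (min \<epsilon> t) in \<tau> *\<^sub>R integral {0..1} (\<lambda>\<theta>. f (\<theta> * \<tau>, x)))"

lemma time_integral_continuous:
  fixes f :: "real \<times> 'a::topological_space \<Rightarrow> 'b::banach"
  assumes "continuous_on UNIV f"
  shows "continuous_on UNIV (time_integral \<epsilon> f)"
proof -
  have "continuous_on (UNIV \<times> cbox 0 1) (\<lambda>(p::real \<times> 'a, \<theta>::real). f (\<theta> * max (-\<epsilon>) (min \<epsilon> (fst p)), snd p))"
    unfolding split_beta by (rule continuous_on_compose2[OF assms]) (auto intro!: continuous_intros)
  from integral_continuous_on_param[OF this]
  have "continuous_on UNIV (\<lambda>p::real \<times> 'a. integral {0..1} (\<lambda>\<theta>. f (\<theta> * max (-\<epsilon>) (min \<epsilon> (fst p)), snd p)))"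
    by simp
  then show ?thesis
    unfolding time_integral_def split_beta Let_def by (auto intro!: continuous_intros)
qed

lemma time_integrand_regular:
  fixes f :: "real \<times> 'a::topological_space \<Rightarrow> 'b::banach"
  assumes "continuous_on UNIV f"
  shows "continuous_on {0..1} (\<lambda>\<theta>. f (\<theta> * t, x))" "(\<lambda>\<theta>. f (\<theta> * t, x)) integrable_on {0..1}"
proof -
  show "continuous_on {0..1} (\<lambda>\<theta>. f (\<theta> * t, x))"
    by (rule continuous_on_compose2[OF assms]) (auto intro!: continuous_intros)
  then show "(\<lambda>\<theta>. f (\<theta> * t, x)) integrable_on {0..1}"
    by (rule integrable_continuous_real)
qed

lemma time_integral_bound:
  fixes f :: "real \<times> 'a::topological_space \<Rightarrow> 'b::banach"
  assumes "continuous_on UNIV f" "0 \<le> \<epsilon>" "\<And>s. s \<in> {-\<epsilon>..\<epsilon>} \<Longrightarrow> norm (f (s, x)) \<le> B"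
  shows "norm (time_integral \<epsilon> f (t, x)) \<le> \<epsilon> * B"
proof -
  define \<tau> where "\<tau> = max (-\<epsilon>) (min \<epsilon> t)"
  have \<tau>: "\<bar>\<tau>\<bar> \<le> \<epsilon>" using assms(2) by (auto simp: \<tau>_def)
  have "norm (integral {0..1} (\<lambda>\<theta>. f (\<theta> * \<tau>, x))) \<le> B * (1 - 0)"
  proof (rule integral_bound[OF _ time_integrand_regular(1)[OF assms(1)]])
    fix \<theta> :: real assume "\<theta> \<in> {0..1}"
    then have "\<bar>\<theta> * \<tau>\<bar> \<le> \<epsilon>" using \<tau> by (simp add: abs_mult) (metis abs_ge_zero mult_left_le_one_le order.trans)
    then show "norm (f (\<theta> * \<tau>, x)) \<le> B" by (intro assms) auto
  qed auto
  then have "\<bar>\<tau>\<bar> * norm (integral {0..1} (\<lambda>\<theta>. f (\<theta> * \<tau>, x))) \<le> \<epsilon> * B"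
    using \<tau> by (intro mult_mono) auto
  then show ?thesis by (simp add: time_integral_def \<tau>_def Let_def)
qed

lemma time_integral_diff:
  fixes f g :: "real \<times> 'a::topological_space \<Rightarrow> 'b::banach"
  assumes "continuous_on UNIV f" "continuous_on UNIV g"
  shows "time_integral \<epsilon> f p - time_integral \<epsilon> g p = time_integral \<epsilon> (\<lambda>p. f p - g p) p"
  by (cases p) (simp add: time_integral_def Let_def integral_diff time_integrand_regular assms scaleR_diff_right)

lemma time_integral_has_derivative:
  fixes f :: "real \<times> 'a::topological_space \<Rightarrow> 'b::banach"
  assumes f: "continuous_on UNIV f" and t: "\<bar>t\<bar> < \<epsilon>"
  shows "((\<lambda>s. time_integral \<epsilon> f (s, x)) has_vector_derivative f (t, x)) (at t)"
proof -
  define F where "F s = integral {-\<epsilon>..s} (\<lambda>r. f (r, x))" for s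
  have fc: "continuous_on {-\<epsilon>..\<epsilon>} (\<lambda>r. f (r, x))"
    by (rule continuous_on_compose2[OF f]) (auto intro!: continuous_intros)
  have F: "(F has_vector_derivative f (s, x)) (at s within {-\<epsilon>..\<epsilon>})" if "s \<in> {-\<epsilon>..\<epsilon>}" for s
    unfolding F_def by (rule integral_has_vector_derivative[OF fc that])
  have eq: "time_integral \<epsilon> f (s, x) = F s - F 0" if s: "s \<in> {-\<epsilon><..<\<epsilon>}" for s
  proof -
    have "((\<lambda>\<theta>. s *\<^sub>R f (\<theta> * s, x)) has_integral (F \<circ> (\<lambda>\<theta>. \<theta> * s)) 1 - (F \<circ> (\<lambda>\<theta>. \<theta> * s)) 0) {0..1}"
    proof (rule fundamental_theorem_of_calculus)
      fix \<theta> :: real assume \<theta>: "\<theta> \<in> {0..1}"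
      have sub: "(\<lambda>\<theta>. \<theta> * s) ` {0..1} \<subseteq> {-\<epsilon>..\<epsilon>}"
      proof
        fix y assume "y \<in> (\<lambda>\<theta>. \<theta> * s) ` {0..1}"
        then obtain a where a: "0 \<le> a" "a \<le> 1" "y = a * s" by auto
        then have "\<bar>y\<bar> \<le> \<bar>s\<bar>" by (simp add: abs_mult mult_left_le_one_le)
        then show "y \<in> {-\<epsilon>..\<epsilon>}" using s by auto
      qed
      have 1: "((\<lambda>\<theta>. \<theta> * s) has_vector_derivative s) (at \<theta> within {0..1})"
        by (auto intro!: derivative_eq_intros simp: has_real_derivative_iff_has_vector_derivative[symmetric])
      have 2: "(F has_vector_derivative f (\<theta> * s, x)) (at (\<theta> * s) within (\<lambda>\<theta>. \<theta> * s) ` {0..1})"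
        by (rule has_vector_derivative_within_subset[OF F sub]) (use sub \<theta> in blast)
      from vector_diff_chain_within[OF 1 2]
      show "((F \<circ> (\<lambda>\<theta>. \<theta> * s)) has_vector_derivative s *\<^sub>R f (\<theta> * s, x)) (at \<theta> within {0..1})" .
    qed auto
    from integral_unique[OF this]
    have "s *\<^sub>R integral {0..1} (\<lambda>\<theta>. f (\<theta> * s, x)) = F s - F 0"
      by simp
    moreover have "max (-\<epsilon>) (min \<epsilon> s) = s" using s by auto
    ultimately show ?thesis by (simp add: time_integral_def Let_def)
  qed
  have t': "t \<in> {-\<epsilon>..\<epsilon>}" "t \<in> {-\<epsilon><..<\<epsilon>}" using t by auto
  have "(F has_vector_derivative f (t, x)) (at t within {-\<epsilon><..<\<epsilon>})"
    by (rule has_vector_derivative_within_subset[OF F[OF t'(1)]]) auto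
  then have "(F has_vector_derivative f (t, x)) (at t)"
    using at_within_open[OF t'(2)] by simp
  then have "((\<lambda>s. F s - F 0) has_vector_derivative f (t, x)) (at t)"
    by (auto intro!: derivative_eq_intros)
  then show ?thesis
    by (rule has_vector_derivative_transform_within_open[where S = "{-\<epsilon><..<\<epsilon>}"]) (use t' eq in auto)
qed

text \<open>The unknown \<open>w\<close> depends on time and on the initial value together. Solving for it in the complete
  space of bounded continuous functions of both variables gives joint continuity for free, and the
  same statement serves for the flow and for its derivative in the initial value.\<close>

lemma picard_fixed_point:
  fixes F :: "real \<times> 'a::metric_space \<Rightarrow> 'b::banach \<Rightarrow> 'b"
  assumes cont: "continuous_on (UNIV \<times> cball 0 r) (\<lambda>(p, w). F p w)"
    and bound: "\<And>p w. norm w \<le> r \<Longrightarrow> norm (F p w) \<le> M"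
    and lip: "\<And>p w w'. norm w \<le> r \<Longrightarrow> norm w' \<le> r \<Longrightarrow> norm (F p w - F p w') \<le> K * norm (w - w')"
    and \<epsilon>: "0 \<le> \<epsilon>" "\<epsilon> * M \<le> r" "\<epsilon> * K \<le> 1/2" "0 \<le> r" "0 \<le> K"
  obtains w where "continuous_on UNIV w" "\<And>p. norm (w p) \<le> r"
    "\<And>p. w p = time_integral \<epsilon> (\<lambda>p. F p (w p)) p"
proof -
  define P where "P w = Bcontfun (time_integral \<epsilon> (\<lambda>p. F p (apply_bcontfun w p)))"
    for w :: "(real \<times> 'a) \<Rightarrow>\<^sub>C 'b"
  have le: "norm (apply_bcontfun w p) \<le> r" if "w \<in> cball 0 r" for w :: "(real \<times> 'a) \<Rightarrow>\<^sub>C 'b" and p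
    using norm_bounded[of w p] that by simp
  have c: "continuous_on UNIV (\<lambda>p. F p (apply_bcontfun w p))" if "w \<in> cball 0 r" for w
  proof -
    have "continuous_on UNIV (\<lambda>p. (p, apply_bcontfun w p))"
      by (intro continuous_on_Pair continuous_on_id continuous_on_apply_bcontfun)
    from continuous_on_compose2[OF cont this] show ?thesis using le[OF that] by (force simp: split_beta)
  qed
  have b: "norm (time_integral \<epsilon> (\<lambda>p. F p (apply_bcontfun w p)) p) \<le> r" if "w \<in> cball 0 r" for w p
  proof -
    have "norm (time_integral \<epsilon> (\<lambda>p. F p (apply_bcontfun w p)) (fst p, snd p)) \<le> \<epsilon> * M"
      by (rule time_integral_bound[OF c[OF that] \<epsilon>(1)]) (rule bound[OF le[OF that]])
    then show ?thesis using \<epsilon>(2) by simp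
  qed
  have P: "apply_bcontfun (P w) = time_integral \<epsilon> (\<lambda>p. F p (apply_bcontfun w p))" if "w \<in> cball 0 r" for w
    unfolding P_def
    by (intro Bcontfun_inverse bcontfun_normI[of _ r] time_integral_continuous c b that)
  have "\<exists>!w. w \<in> cball 0 r \<and> P w = w"
  proof (rule Banach_fix[where c = "1/2"])
    show "complete (cball (0::(real \<times> 'a) \<Rightarrow>\<^sub>C 'b) r)" by (simp add: complete_eq_closed)
    show "cball (0::(real \<times> 'a) \<Rightarrow>\<^sub>C 'b) r \<noteq> {}" using \<epsilon> by auto
    show "P ` cball 0 r \<subseteq> cball 0 r"
    proof
      fix v assume "v \<in> P ` cball 0 r"
      then obtain w where w: "w \<in> cball 0 r" "v = P w" by auto
      have "norm v \<le> r" by (rule norm_bound) (simp only: w(2) P[OF w(1)] b[OF w(1)])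
      then show "v \<in> cball 0 r" by simp
    qed
    show "dist (P w) (P w') \<le> 1/2 * dist w w'"
      if w: "w \<in> cball 0 r" "w' \<in> cball 0 r" for w w'
      proof (rule dist_bound)
        fix p :: "real \<times> 'a"
        have "norm (F q (w q) - F q (w' q)) \<le> K * dist w w'" for q
        proof -
          have "norm (F q (w q) - F q (w' q)) \<le> K * dist (w q) (w' q)"
            using lip le w by (simp add: dist_norm)
          also have "\<dots> \<le> K * dist w w'" using \<epsilon> by (intro mult_left_mono dist_bounded)
          finally show ?thesis .
        qed
        then have "norm (time_integral \<epsilon> (\<lambda>p. F p (w p) - F p (w' p)) (fst p, snd p)) \<le> \<epsilon> * (K * dist w w')"
          by (intro time_integral_bound continuous_on_diff c w \<epsilon>)
        also have "\<dots> \<le> 1/2 * dist w w'"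
          using mult_right_mono[OF \<epsilon>(3), of "dist w w'"] by (simp add: mult.assoc)
        finally show "dist (P w p) (P w' p) \<le> 1/2 * dist w w'"
          unfolding P[OF w(1)] P[OF w(2)]
          by (subst dist_norm, subst time_integral_diff) (use c w in auto)
      qed
  qed auto
  then obtain w where w: "w \<in> cball 0 r" "P w = w" by blast
  show thesis
  proof (rule that)
    show "apply_bcontfun w p = time_integral \<epsilon> (\<lambda>p. F p (apply_bcontfun w p)) p" for p
      using P[OF w(1)] unfolding w(2) by (rule fun_cong)
  qed (use le[OF w(1)] in auto)
qed

text \<open>The short-time substitute for Gronwall's inequality: an estimate that reproduces half of every upper
  bound, applied to the maximum of \<open>f\<close>, absorbs that half into the left side.\<close>

lemma half_sup_bound:
  fixes f :: "real \<Rightarrow> real"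
  assumes "continuous_on {-\<epsilon>..\<epsilon>} f" "0 \<le> \<epsilon>"
    and "\<And>B. \<forall>s\<in>{-\<epsilon>..\<epsilon>}. f s \<le> B \<Longrightarrow> \<forall>s\<in>{-\<epsilon>..\<epsilon>}. f s \<le> a + B / 2" and "t \<in> {-\<epsilon>..\<epsilon>}"
  shows "f t \<le> 2 * a"
proof -
  obtain s where s: "s \<in> {-\<epsilon>..\<epsilon>}" "\<forall>t\<in>{-\<epsilon>..\<epsilon>}. f t \<le> f s"
    using continuous_attains_sup[of "{-\<epsilon>..\<epsilon>}" f] assms by auto
  then have "f s \<le> a + f s / 2" using assms(3) by blast
  then show ?thesis using s assms(4) by fastforce
qed

text \<open>The displacement \<open>w\<close> of the flow and the derivative \<open>W\<close> of \<open>w\<close> in the initial value are obtained as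
  fixed points, the latter from the variational equation. That \<open>W\<close> really is the derivative
  follows because the error \<open>w (t, x + h) - w (t, x) - W (t, x) h\<close> satisfies the linear integral
  equation of \<open>W\<close> with a source of size \<open>o(h)\<close>. The time derivative is the vector field itself, so
  both partial derivatives are continuous and the flow is \<open>C\<^sup>1\<close> in all variables.\<close>

theorem local_flow:
  fixes V :: "'a::euclidean_space \<Rightarrow> 'a"
  assumes S: "open S" and V: "C1_on S V" and y0: "y0 \<in> S"
  obtains \<epsilon> r \<Phi> where "\<epsilon> > 0" "r > 0" "C1_on ({-\<epsilon><..<\<epsilon>} \<times> ball y0 r) (\<lambda>(t, x). \<Phi> t x)"
    "\<And>x. x \<in> ball y0 r \<Longrightarrow> \<Phi> 0 x = x"
    "\<And>t x. \<bar>t\<bar> < \<epsilon> \<Longrightarrow> x \<in> ball y0 r \<Longrightarrow>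
       \<Phi> t x \<in> S \<and> ((\<lambda>s. \<Phi> s x) has_vector_derivative V (\<Phi> t x)) (at t)"
proof -
  obtain R where R: "R > 0" "cball y0 R \<subseteq> S"
    using S y0 open_contains_cball by blast
  define r where "r = R / 2"
  have r: "r > 0" "cball y0 (2 * r) \<subseteq> S" using R by (auto simp: r_def)
  let ?C = "cball y0 (2 * r)"
  obtain V' where V': "continuous_on S V'" "\<And>x. x \<in> S \<Longrightarrow> (V has_derivative blinfun_apply (V' x)) (at x)"
    using C1_onE[OF V] by blast
  have VC: "continuous_on ?C V'" "\<And>x. x \<in> ?C \<Longrightarrow> (V has_derivative blinfun_apply (V' x)) (at x)"
    using V' r(2) continuous_on_subset by blast+
  have VcC: "continuous_on ?C V" using C1_on_imp_continuous_on[OF V] r(2) continuous_on_subset by blast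
  obtain K where K: "K > 0" "\<And>x. x \<in> ?C \<Longrightarrow> norm (V' x) \<le> K"
    "\<And>x y. x \<in> ?C \<Longrightarrow> y \<in> ?C \<Longrightarrow> norm (V x - V y) \<le> K * norm (x - y)"
    using C1_on_compact_bounds[OF VC] by auto
  obtain M where M: "M > 0" "\<And>x. x \<in> ?C \<Longrightarrow> norm (V x) \<le> M"
    using compact_imp_bounded[OF compact_continuous_image[OF VcC]] unfolding bounded_pos by auto
  \<comment> \<open>The first bound keeps the displacement below \<open>r\<close>, so that solutions starting in the ball of radius
     \<open>r\<close> stay in the one of radius \<open>2r\<close>; the second makes the iteration a contraction by \<open>1/2\<close>.\<close>
  define \<epsilon> where "\<epsilon> = min (r / M) (1 / (2 * K))"
  have \<epsilon>: "\<epsilon> > 0" "\<epsilon> * M \<le> r" "\<epsilon> * K \<le> 1/2"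
    using r K M by (auto simp: \<epsilon>_def field_simps min_def)
  \<comment> \<open>Initial values outside the ball are projected to it, only to have functions on the whole space.\<close>
  define \<kappa> where "\<kappa> = closest_point (cball y0 r)"
  have \<kappa>_cont: "continuous_on UNIV \<kappa>"
    unfolding \<kappa>_def by (rule continuous_on_closest_point) (use r in auto)
  have \<kappa>_in: "\<kappa> x \<in> cball y0 r" for x
    unfolding \<kappa>_def by (rule closest_point_in_set) (use r in auto)
  have \<kappa>_id: "\<kappa> x = x" if "x \<in> cball y0 r" for x
    unfolding \<kappa>_def by (rule closest_point_self[OF that])
  have in_C: "\<kappa> x + w \<in> ?C" if "norm w \<le> r" for x w
  proof -
    have "norm (y0 - (\<kappa> x + w)) \<le> norm (y0 - \<kappa> x) + norm w"
      using norm_triangle_ineq4[of "y0 - \<kappa> x" w] by (simp add: algebra_simps)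
    then show ?thesis using that \<kappa>_in[of x] by (auto simp: dist_norm)
  qed
  obtain w :: "real \<times> 'a \<Rightarrow> 'a" where w: "continuous_on UNIV w" "\<And>p. norm (w p) \<le> r"
    "\<And>p. w p = time_integral \<epsilon> (\<lambda>p. V (\<kappa> (snd p) + w p)) p"
  proof (rule picard_fixed_point[of r "\<lambda>p w. V (\<kappa> (snd p) + w)" M K \<epsilon>])
    have "continuous_on (UNIV \<times> cball 0 r) (\<lambda>x::(real \<times> 'a) \<times> 'a. V (\<kappa> (snd (fst x)) + snd x))"
      by (rule continuous_on_compose2[OF VcC])
         (use in_C in \<open>auto intro!: continuous_intros continuous_on_compose2[OF \<kappa>_cont]\<close>)
    then show "continuous_on (UNIV \<times> cball 0 r) (\<lambda>(p::real \<times> 'a, w). V (\<kappa> (snd p) + w))"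
      by (simp add: split_beta)
    show "norm (V (\<kappa> (snd p) + w) - V (\<kappa> (snd p) + w')) \<le> K * norm (w - w')"
      if "norm w \<le> r" "norm w' \<le> r" for p :: "real \<times> 'a" and w w'
      using K(3)[OF in_C[OF that(1)] in_C[OF that(2)], of "snd p" "snd p"] by simp
    show "norm (V (\<kappa> (snd p) + w)) \<le> M" if "norm w \<le> r" for p :: "real \<times> 'a" and w
      by (rule M(2)[OF in_C[OF that]])
    show "0 \<le> \<epsilon>" "0 \<le> r" "0 \<le> K" using K(1) \<epsilon>(1) r(1) by linarith+
  qed (rule \<epsilon> that; assumption)+
  define u where "u p = \<kappa> (snd p) + w p" for p
  have uC: "u p \<in> ?C" for p unfolding u_def by (rule in_C[OF w(2)])
  have uc: "continuous_on UNIV u"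
    unfolding u_def by (auto intro!: continuous_intros w continuous_on_compose2[OF \<kappa>_cont])
  have Vu: "continuous_on UNIV (\<lambda>p. V (u p))"
    by (rule continuous_on_compose2[OF VcC uc]) (use uC in auto)
  have V'u: "continuous_on UNIV (\<lambda>p. V' (u p))"
    by (rule continuous_on_compose2[OF VC(1) uc]) (use uC in auto)
  have wu: "w p = time_integral \<epsilon> (\<lambda>p. V (u p)) p" for p using w(3) unfolding u_def .
  \<comment> \<open>The right side of the variational equation is bounded by \<open>2K\<close> for \<open>W\<close> in the unit ball.\<close>
  obtain W :: "real \<times> 'a \<Rightarrow> 'a \<Rightarrow>\<^sub>L 'a" where W: "continuous_on UNIV W" "\<And>p. norm (W p) \<le> 1"
    "\<And>p. W p = time_integral \<epsilon> (\<lambda>p. V' (u p) o\<^sub>L (id_blinfun + W p)) p"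
  proof (rule picard_fixed_point[of 1 "\<lambda>p W. V' (u p) o\<^sub>L (id_blinfun + W)" "2 * K" K \<epsilon>])
    have "continuous_on (UNIV \<times> cball 0 1) (\<lambda>x::(real \<times> 'a) \<times> ('a \<Rightarrow>\<^sub>L 'a). V' (u (fst x)) o\<^sub>L (id_blinfun + snd x))"
      by (intro bounded_bilinear.continuous_on[OF bounded_bilinear_blinfun_compose]
          continuous_on_compose2[OF V'u] continuous_intros) auto
    then show "continuous_on (UNIV \<times> cball 0 1) (\<lambda>(p, W). V' (u p) o\<^sub>L (id_blinfun + W))"
      by (simp add: split_beta)
    fix p and W W' :: "'a \<Rightarrow>\<^sub>L 'a"
    have *: "norm (V' (u p) o\<^sub>L X) \<le> K * norm X" for X
      by (rule order_trans[OF norm_blinfun_compose mult_right_mono[OF K(2)[OF uC]]]) auto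
    show "norm (V' (u p) o\<^sub>L (id_blinfun + W)) \<le> 2 * K" if "norm W \<le> 1"
    proof -
      have "norm (id_blinfun + W) \<le> 2"
        using norm_triangle_ineq[of id_blinfun W] that norm_blinfun_id_le[where 'a='a] by linarith
      then have "K * norm (id_blinfun + W) \<le> K * 2" using K(1) by (intro mult_left_mono) auto
      then show ?thesis using *[of "id_blinfun + W"] by linarith
    qed
    have "(V' (u p) o\<^sub>L (id_blinfun + W)) - (V' (u p) o\<^sub>L (id_blinfun + W')) = V' (u p) o\<^sub>L (W - W')"
      by (auto intro!: blinfun_eqI simp: blinfun.bilinear_simps)
    then show "norm ((V' (u p) o\<^sub>L (id_blinfun + W)) - (V' (u p) o\<^sub>L (id_blinfun + W'))) \<le> K * norm (W - W')"
      using *[of "W - W'"] by simp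
    show "0 \<le> \<epsilon>" "0 \<le> K" "\<epsilon> * (2 * K) \<le> 1" using K(1) \<epsilon> by linarith+
    show "0 \<le> (1::real)" by simp
  qed (rule \<epsilon> that; assumption)+
  have Wc: "continuous_on UNIV (\<lambda>p. V' (u p) o\<^sub>L (id_blinfun + W p))"
    by (intro bounded_bilinear.continuous_on[OF bounded_bilinear_blinfun_compose] V'u continuous_intros W(1))
  have Wh: "W p h = time_integral \<epsilon> (\<lambda>p. V' (u p) (h + W p h)) p" for p h
  proof -
    obtain t x where p: "p = (t, x)" by (cases p)
    have "blinfun_apply (integral {0..1} (\<lambda>\<theta>. V' (u (\<theta> * \<tau>, x)) o\<^sub>L (id_blinfun + W (\<theta> * \<tau>, x)))) h
        = integral {0..1} (\<lambda>\<theta>. V' (u (\<theta> * \<tau>, x)) (h + W (\<theta> * \<tau>, x) h))" for \<tau>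
      by (subst integral_linear[OF time_integrand_regular(2)[OF Wc, of \<tau> x] blinfun.bounded_linear_left, of h, symmetric])
         (simp add: o_def blinfun.bilinear_simps)
    then show ?thesis
      by (subst W(3)) (simp add: p time_integral_def Let_def blinfun.bilinear_simps)
  qed
  have tc: "continuous_on {-\<epsilon>..\<epsilon>} (\<lambda>s. f (s, x))" if "continuous_on UNIV f" for f :: "real \<times> 'a \<Rightarrow> 'a" and x
    by (rule continuous_on_compose2[OF that]) (auto intro!: continuous_intros)
  have lip: "norm (w (t, x + h) - w (t, x)) \<le> norm h"
    if x: "x \<in> cball y0 r" "x + h \<in> cball y0 r" and t: "t \<in> {-\<epsilon>..\<epsilon>}" for t x h
  proof -
    have Vx: "continuous_on UNIV (\<lambda>p::real \<times> 'a. V (u (fst p, snd p + h)))"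
      by (rule continuous_on_compose2[OF Vu]) (auto intro!: continuous_intros)
    have eq: "w (s, x + h) - w (s, x) = time_integral \<epsilon> (\<lambda>p. V (u (fst p, snd p + h)) - V (u p)) (s, x)" for s
      by (subst time_integral_diff[OF Vx Vu, symmetric]) (simp add: wu time_integral_def Let_def)
    have "norm (w (t, x + h) - w (t, x)) \<le> 2 * (norm h / 2)"
    proof (rule half_sup_bound[where f = "\<lambda>t. norm (w (t, x + h) - w (t, x))"])
      fix B assume B: "\<forall>s\<in>{-\<epsilon>..\<epsilon>}. norm (w (s, x + h) - w (s, x)) \<le> B"
      have "norm (V (u (s, x + h)) - V (u (s, x))) \<le> K * (norm h + B)" if "s \<in> {-\<epsilon>..\<epsilon>}" for s
      proof -
        have "norm (V (u (s, x + h)) - V (u (s, x))) \<le> K * norm (u (s, x + h) - u (s, x))"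
          by (rule K(3)[OF uC uC])
        also have "u (s, x + h) - u (s, x) = h + (w (s, x + h) - w (s, x))"
          using x by (simp add: u_def \<kappa>_id)
        also have "norm \<dots> \<le> norm h + B"
          using B that norm_triangle_ineq[of h "w (s, x + h) - w (s, x)"] by fastforce
        finally show ?thesis using K(1) by simp
      qed
      then have bd: "norm (time_integral \<epsilon> (\<lambda>p. V (u (fst p, snd p + h)) - V (u p)) (s, x)) \<le> \<epsilon> * (K * (norm h + B))" for s
        by (intro time_integral_bound continuous_on_diff Vx Vu) (use \<epsilon> in auto)
      have "B \<ge> 0" by (rule order_trans[OF norm_ge_zero bspec[OF B t]])
      then have "\<epsilon> * (K * (norm h + B)) \<le> norm h / 2 + B / 2"
        using mult_right_mono[OF \<epsilon>(3), of "norm h + B"] by (simp add: algebra_simps)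
      then show "\<forall>s\<in>{-\<epsilon>..\<epsilon>}. norm (w (s, x + h) - w (s, x)) \<le> norm h / 2 + B / 2"
        unfolding eq by (intro ballI order_trans[OF bd])
    qed (use \<epsilon>(1) t in \<open>auto intro!: continuous_on_norm continuous_on_diff tc w(1)\<close>)
    then show ?thesis by simp
  qed
  have dx: "((\<lambda>x. w (t, x)) has_derivative blinfun_apply (W (t, x))) (at x)"
    if x: "x \<in> ball y0 r" and t: "\<bar>t\<bar> < \<epsilon>" for t x
    unfolding has_derivative_at_alt
  proof (intro conjI allI impI)
    show "bounded_linear (blinfun_apply (W (t, x)))" by (rule blinfun.bounded_linear_right)
    fix e :: real assume e: "e > 0"
    \<comment> \<open>The error is bounded by \<open>2 \<cdot> \<epsilon>e' \<cdot> 2|h|\<close>: the increment of \<open>u\<close> is at most \<open>2|h|\<close>, and absorbing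
       half of the supremum doubles the bound.\<close>
    define e' where "e' = e / (4 * \<epsilon>)"
    have e': "e' > 0" using e \<epsilon> by (simp add: e'_def)
    have "uniformly_continuous_on ?C V'" by (rule compact_uniformly_continuous[OF VC(1)]) auto
    then obtain \<delta> where \<delta>: "\<delta> > 0" "\<And>a b. a \<in> ?C \<Longrightarrow> b \<in> ?C \<Longrightarrow> dist b a < \<delta> \<Longrightarrow> dist (V' b) (V' a) < e'"
      unfolding uniformly_continuous_on_def using e' by metis
    obtain \<rho> where \<rho>: "\<rho> > 0" "ball x \<rho> \<subseteq> ball y0 r" using openE[OF open_ball x] by blast
    have "norm (w (t, x + h) - w (t, x) - W (t, x) h) \<le> e * norm h" if h: "norm h < min \<rho> (\<delta> / 2)" for h
    proof -
      have "x + h \<in> ball x \<rho>" using h by (simp add: dist_norm)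
      then have xh: "x + h \<in> cball y0 r" and x': "x \<in> cball y0 r" using \<rho> x by (auto dest: subsetD)
      have t': "t \<in> {-\<epsilon>..\<epsilon>}" using t by auto
      define R where "R p = V (u (fst p, snd p + h)) - V (u p) - V' (u p) (h + W p h)" for p
      have c1: "continuous_on UNIV (\<lambda>p::real \<times> 'a. V (u (fst p, snd p + h)))"
        by (rule continuous_on_compose2[OF Vu]) (auto intro!: continuous_intros)
      have c2: "continuous_on UNIV (\<lambda>p. V' (u p) (h + W p h))"
        by (intro bounded_bilinear.continuous_on[OF bounded_bilinear_blinfun_apply] V'u W(1) continuous_intros)
      have Rc: "continuous_on UNIV R" unfolding R_def by (intro continuous_on_diff c1 c2 Vu)
      have Wp: "continuous_on UNIV (\<lambda>p. W p h)"
        by (rule bounded_bilinear.continuous_on[OF bounded_bilinear_blinfun_apply W(1) continuous_on_const])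
      have Wcx: "continuous_on {-\<epsilon>..\<epsilon>} (\<lambda>s. w (s, x + h) - w (s, x) - W (s, x) h)"
        by (intro continuous_on_diff tc[OF w(1)] tc[OF Wp])
      have eq: "w (s, x + h) - w (s, x) - W (s, x) h = time_integral \<epsilon> R (s, x)" for s
      proof -
        have "w (s, x + h) = time_integral \<epsilon> (\<lambda>p. V (u (fst p, snd p + h))) (s, x)"
          by (simp add: wu time_integral_def Let_def)
        then show ?thesis
          unfolding R_def
          by (simp only: wu[of "(s, x)"] Wh[of "(s, x)" h] time_integral_diff[OF c1 Vu]
              time_integral_diff[OF continuous_on_diff[OF c1 Vu] c2])
      qed
      have "norm (w (t, x + h) - w (t, x) - W (t, x) h) \<le> 2 * (\<epsilon> * (e' * (2 * norm h)))"
      proof (rule half_sup_bound[where f = "\<lambda>t. norm (w (t, x + h) - w (t, x) - W (t, x) h)"])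
        fix B assume B: "\<forall>s\<in>{-\<epsilon>..\<epsilon>}. norm (w (s, x + h) - w (s, x) - W (s, x) h) \<le> B"
        have "norm (R (s, x)) \<le> e' * (2 * norm h) + K * B" if s: "s \<in> {-\<epsilon>..\<epsilon>}" for s
        proof -
          define a where "a = u (s, x)"
          define b where "b = u (s, x + h)"
          have ab: "b - a = h + (w (s, x + h) - w (s, x))"
            using xh x' by (simp add: a_def b_def u_def \<kappa>_id)
          have nab: "norm (b - a) \<le> 2 * norm h"
            using lip[OF x' xh s] norm_triangle_ineq[of h "w (s, x + h) - w (s, x)"] by (simp add: ab)
          have aC: "a \<in> ?C" "b \<in> ?C" by (simp_all only: a_def b_def uC)
          have "norm (V b - V a - V' a (b - a)) \<le> norm (b - a) * e'"
          proof (rule differentiable_bound_linearization[where S = "?C \<inter> ball a \<delta>" and f' = "\<lambda>x. blinfun_apply (V' x)"])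
            have b\<delta>: "b \<in> ball a \<delta>" using nab h by (auto simp: dist_norm norm_minus_commute)
            have "convex (?C \<inter> ball a \<delta>)" by (intro convex_Int convex_cball convex_ball)
            then show "a + t *\<^sub>R (b - a) \<in> ?C \<inter> ball a \<delta>" if "t \<in> {0..1}" for t
              using that aC b\<delta> \<delta>(1) convexD_alt[of "?C \<inter> ball a \<delta>" a b t] by (simp add: algebra_simps)
            show "(V has_derivative blinfun_apply (V' y)) (at y within ?C \<inter> ball a \<delta>)" if "y \<in> ?C \<inter> ball a \<delta>" for y
              using that VC(2) by (auto intro: has_derivative_at_withinI)
            show "onorm (blinfun_apply (V' y) - blinfun_apply (V' a)) \<le> e'" if "y \<in> ?C \<inter> ball a \<delta>" for y
            proof -
              have "blinfun_apply (V' y) - blinfun_apply (V' a) = blinfun_apply (V' y - V' a)"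
                by (simp add: minus_blinfun.rep_eq fun_diff_def)
              then show ?thesis
                using \<delta>(2)[of a y] that aC by (simp add: dist_norm norm_blinfun.rep_eq[symmetric] norm_minus_commute)
            qed
            show "a \<in> ?C \<inter> ball a \<delta>" using aC \<delta> by simp
          qed
          also have "\<dots> \<le> e' * (2 * norm h)" using nab e' by (simp add: mult.commute)
          finally have 1: "norm (V b - V a - V' a (b - a)) \<le> e' * (2 * norm h)" .
          have "norm (V' a (w (s, x + h) - w (s, x) - W (s, x) h)) \<le> K * B"
            by (rule order_trans[OF norm_blinfun mult_mono]) (use K(1) K(2)[OF aC(1)] B s in auto)
          moreover have "R (s, x) = (V b - V a - V' a (b - a)) + V' a (w (s, x + h) - w (s, x) - W (s, x) h)"
            unfolding R_def ab by (simp add: blinfun.bilinear_simps a_def b_def)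
          ultimately show ?thesis using 1 by (simp only:) (rule order_trans[OF norm_triangle_ineq], linarith)
        qed
        then have bd: "norm (time_integral \<epsilon> R (s, x)) \<le> \<epsilon> * (e' * (2 * norm h) + K * B)" for s
          by (intro time_integral_bound Rc) (use \<epsilon> in auto)
        have "B \<ge> 0" by (rule order_trans[OF norm_ge_zero bspec[OF B t']])
        then have "\<epsilon> * (e' * (2 * norm h) + K * B) \<le> \<epsilon> * (e' * (2 * norm h)) + B / 2"
          using mult_right_mono[OF \<epsilon>(3), of "B"] by (simp add: algebra_simps)
        then show "\<forall>s\<in>{-\<epsilon>..\<epsilon>}. norm (w (s, x + h) - w (s, x) - W (s, x) h) \<le> \<epsilon> * (e' * (2 * norm h)) + B / 2"
          unfolding eq by (intro ballI order_trans[OF bd])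
      qed (use \<epsilon>(1) t Wcx in \<open>auto intro!: continuous_on_norm\<close>)
      also have "\<dots> = e * norm h" using \<epsilon>(1) by (simp add: e'_def)
      finally show ?thesis .
    qed
    then show "\<exists>d>0. \<forall>y. norm (y - x) < d \<longrightarrow> norm (w (t, y) - w (t, x) - W (t, x) (y - x)) \<le> e * norm (y - x)"
      using \<rho>(1) \<delta>(1) by (intro exI[of _ "min \<rho> (\<delta> / 2)"]) (metis add_diff_cancel_left' diff_add_cancel add.commute half_gt_zero min_less_iff_conj)
  qed
  define \<Phi> where "\<Phi> t x = x + w (t, x)" for t x
  have \<Phi>u: "\<Phi> t x = u (t, x)" if "x \<in> ball y0 r" for t x
    using that by (simp add: \<Phi>_def u_def \<kappa>_id)
  have dt: "((\<lambda>s. \<Phi> s x) has_vector_derivative V (\<Phi> t x)) (at t)" if "\<bar>t\<bar> < \<epsilon>" "x \<in> ball y0 r" for t x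
  proof -
    have "((\<lambda>s. x + time_integral \<epsilon> (\<lambda>p. V (u p)) (s, x)) has_vector_derivative 0 + V (u (t, x))) (at t)"
      by (intro has_vector_derivative_add has_vector_derivative_const time_integral_has_derivative Vu that)
    moreover have "(\<lambda>s. \<Phi> s x) = (\<lambda>s. x + time_integral \<epsilon> (\<lambda>p. V (u p)) (s, x))"
      unfolding \<Phi>_def by (subst wu) (rule refl)
    ultimately show ?thesis using \<Phi>u[OF that(2), of t] by (simp only: add_0)
  qed
  show thesis
  proof (rule that[OF \<epsilon>(1) r(1), of \<Phi>])
    let ?X = "{-\<epsilon><..<\<epsilon>}" and ?Y = "ball y0 r"
    show "C1_on (?X \<times> ?Y) (\<lambda>(t, x). \<Phi> t x)"
    proof (rule C1_onI[where f' = "\<lambda>p. (blinfun_scaleR_left (V (u p)) o\<^sub>L fst_blinfun) + ((id_blinfun + W p) o\<^sub>L snd_blinfun)"])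
      have "continuous_on UNIV (\<lambda>p. (blinfun_scaleR_left (V (u p)) o\<^sub>L fst_blinfun) + ((id_blinfun + W p) o\<^sub>L (snd_blinfun :: (real \<times> 'a) \<Rightarrow>\<^sub>L 'a)))"
        by (intro continuous_on_add bounded_bilinear.continuous_on[OF bounded_bilinear_blinfun_compose]
            bounded_linear.continuous_on[OF bounded_linear_blinfun_scaleR_left] Vu W(1) continuous_intros)
      then show "continuous_on (?X \<times> ?Y) (\<lambda>p. (blinfun_scaleR_left (V (u p)) o\<^sub>L fst_blinfun) + ((id_blinfun + W p) o\<^sub>L (snd_blinfun :: (real \<times> 'a) \<Rightarrow>\<^sub>L 'a)))"
        by (rule continuous_on_subset) auto
      fix p assume "p \<in> ?X \<times> ?Y"
      then obtain t x where p: "p = (t, x)" "\<bar>t\<bar> < \<epsilon>" "t \<in> ?X" "x \<in> ?Y" by (cases p) auto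
      have "((\<lambda>(t, x). \<Phi> t x) has_derivative (\<lambda>(dt, dx). dt *\<^sub>R V (\<Phi> t x) + (id_blinfun + W (t, x)) dx)) (at (t, x) within ?X \<times> ?Y)"
      proof (rule has_derivative_partialsI[where fy = "\<lambda>t x. id_blinfun + W (t, x)"])
        show "((\<lambda>t. \<Phi> t x) has_derivative (\<lambda>dt. dt *\<^sub>R V (\<Phi> t x))) (at t within ?X)"
          using dt[OF p(2,4)] unfolding has_vector_derivative_def by (rule has_derivative_at_withinI)
        show "(\<Phi> t has_derivative blinfun_apply (id_blinfun + W (t, x))) (at x within ?Y)" if "t \<in> ?X" "x \<in> ?Y" for t x
        proof -
          have "((\<lambda>x. x + w (t, x)) has_derivative (\<lambda>h. h + blinfun_apply (W (t, x)) h)) (at x)"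
            by (rule has_derivative_add[OF has_derivative_ident dx]) (use that in auto)
          moreover have "blinfun_apply (id_blinfun + W (t, x)) = (\<lambda>h. h + blinfun_apply (W (t, x)) h)"
            by (simp add: fun_eq_iff plus_blinfun.rep_eq)
          ultimately show ?thesis unfolding \<Phi>_def by (simp add: has_derivative_at_withinI)
        qed
        have "continuous_on UNIV (\<lambda>(t, x). id_blinfun + W (t, x))"
          unfolding split_beta by (simp add: continuous_on_add W(1))
        then have "continuous (at (t, x)) (\<lambda>(t, x). id_blinfun + W (t, x))"
          using continuous_on_eq_continuous_at[OF open_UNIV, of "\<lambda>(t, x). id_blinfun + W (t, x)"] by blast
        then show "continuous (at (t, x) within ?X \<times> ?Y) (\<lambda>(t, x). id_blinfun + W (t, x))"
          by (rule continuous_at_imp_continuous_at_within)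
      qed (use p in auto)
      moreover have "at (t, x) within ?X \<times> ?Y = at (t, x)"
        by (rule at_within_open) (use p in \<open>simp_all add: open_Times\<close>)
      moreover have "blinfun_apply ((blinfun_scaleR_left (V (u p)) o\<^sub>L fst_blinfun) + ((id_blinfun + W p) o\<^sub>L snd_blinfun))
          = (\<lambda>(dt, dx). dt *\<^sub>R V (\<Phi> t x) + (id_blinfun + W (t, x)) dx)"
        using p by (simp add: \<Phi>u plus_blinfun.rep_eq fun_eq_iff split_beta)
      ultimately show "((\<lambda>(t, x). \<Phi> t x) has_derivative blinfun_apply ((blinfun_scaleR_left (V (u p)) o\<^sub>L fst_blinfun) + ((id_blinfun + W p) o\<^sub>L snd_blinfun))) (at p)"
        using p by simp
    qed
    show "\<Phi> 0 x = x" for x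
      using \<epsilon> by (simp add: \<Phi>_def wu time_integral_def)
    show "\<Phi> t x \<in> S \<and> ((\<lambda>s. \<Phi> s x) has_vector_derivative V (\<Phi> t x)) (at t)" if "\<bar>t\<bar> < \<epsilon>" "x \<in> ?Y" for t x
      using dt[OF that] subsetD[OF r(2) uC, of "(t, x)"] \<Phi>u[OF that(2), of t] by simp
  qed
qed

section \<open>Invariance of sets to which a vector field is tangent\<close>

text \<open>A Gronwall inequality for functions that need not be differentiable, such as a squared distance:
  at each time \<open>u\<close> is touched from above by a differentiable \<open>k\<close> whose slope is at most \<open>L u\<close>. Comparison
  with \<open>\<epsilon> exp ((L + 1) t)\<close> works because this function grows strictly faster than \<open>u\<close> can where the
  two meet.\<close>

lemma subsolution_nonpos:
  fixes u :: "real \<Rightarrow> real"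
  assumes cont: "continuous_on {0..T} u" and u0: "u 0 \<le> 0"
    and step: "\<And>t. 0 \<le> t \<Longrightarrow> t < T \<Longrightarrow> \<exists>k k'. (k has_real_derivative k') (at 0) \<and> k 0 = u t \<and> k' \<le> L * u t \<and>
        (\<forall>\<^sub>F h in at_right 0. u (t + h) \<le> k h)"
    and t: "t \<in> {0..T}"
  shows "u t \<le> 0"
proof -
  have main: "u s \<le> \<epsilon> * exp ((L + 1) * s)" if \<epsilon>: "\<epsilon> > 0" and s: "s \<in> {0..T}" for \<epsilon> s
  proof (rule ccontr)
    define m where "m t = \<epsilon> * exp ((L + 1) * t)" for t
    assume "\<not> u s \<le> \<epsilon> * exp ((L + 1) * s)"
    then have us: "u s > m s" by (simp add: m_def)
    define A where "A = {r \<in> {0..s}. u r \<le> m r}"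
    have "continuous_on {0..s} u" by (rule continuous_on_subset[OF cont]) (use s in auto)
    then have "closed A" unfolding A_def m_def
      by (intro continuous_on_closed_Collect_le continuous_intros closed_atLeastAtMost) auto
    moreover have "0 \<in> A" using u0 \<epsilon> s by (auto simp: A_def m_def)
    moreover have bdd: "bdd_above A" unfolding A_def by (rule bdd_aboveI[of _ s]) auto
    ultimately have t1: "Sup A \<in> A" by (intro closed_contains_Sup) auto
    \<comment> \<open>The last time up to \<open>s\<close> at which the comparison function still dominates. The majorant \<open>k\<close> at that
       time shows that it dominates a little longer.\<close>
    define t1 where "t1 = Sup A"
    have t1A: "0 \<le> t1" "t1 \<le> s" "u t1 \<le> m t1" using t1 by (auto simp: A_def t1_def)
    then have "t1 < s" using us by (cases "t1 = s") auto
    then obtain k k' where k: "(k has_real_derivative k') (at 0)" "k 0 = u t1" "k' \<le> L * u t1"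
      "\<forall>\<^sub>F h in at_right 0. u (t1 + h) \<le> k h"
      using step[of t1] t1A s by auto
    have "\<forall>\<^sub>F h in at_right 0. k h < m (t1 + h)"
    proof (cases "u t1 = m t1")
      case True
      have "((\<lambda>h. k h - m (t1 + h)) has_real_derivative k' - (L + 1) * m t1) (at 0)"
        unfolding m_def by (auto intro!: derivative_eq_intros k(1))
      moreover have "k' - (L + 1) * m t1 < 0"
        using k(3) True \<epsilon> by (simp add: algebra_simps m_def) (smt (verit) exp_gt_zero mult_pos_pos)
      ultimately obtain d where d: "d > 0" "\<And>h. 0 < h \<Longrightarrow> h < d \<Longrightarrow> k (0 + h) - m (t1 + (0 + h)) < k 0 - m (t1 + 0)"
        using DERIV_neg_dec_right by blast
      then show ?thesis using k(2) True unfolding eventually_at_right_field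
        by (intro exI[of _ d]) auto
    next
      case False
      have "isCont (\<lambda>h. k h - m (t1 + h)) 0"
        unfolding m_def by (intro continuous_intros DERIV_isCont[OF k(1)])
      then have "((\<lambda>h. k h - m (t1 + h)) \<longlongrightarrow> k 0 - m (t1 + 0)) (at_right 0)"
        unfolding isCont_def by (rule tendsto_mono[OF at_le[OF subset_UNIV]])
      moreover have "k 0 - m (t1 + 0) < 0" using False k(2) t1A by simp
      ultimately have "\<forall>\<^sub>F h in at_right 0. k h - m (t1 + h) < 0" by (rule order_tendstoD)
      then show ?thesis by simp
    qed
    moreover have "\<forall>\<^sub>F h in at_right 0. 0 < h \<and> h < s - t1"
      using \<open>t1 < s\<close> unfolding eventually_at_right_field by (intro exI[of _ "s - t1"]) auto
    ultimately have "\<forall>\<^sub>F h in at_right 0. t1 + h \<in> A \<and> 0 < h"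
      using k(4) by eventually_elim (use t1A in \<open>auto simp: A_def\<close>)
    then obtain h where "t1 + h \<in> A" "0 < h"
      using eventually_happens'[OF trivial_limit_at_right_real] by blast
    with cSup_upper[OF this(1) bdd] show False by (simp add: t1_def)
  qed
  have "u t \<le> 0 + e" if "e > 0" for e
  proof -
    have "u t \<le> e / exp ((L + 1) * t) * exp ((L + 1) * t)"
      by (rule main[OF divide_pos_pos[OF that exp_gt_zero] t])
    then show ?thesis by simp
  qed
  then show ?thesis by (rule field_le_epsilon)
qed

text \<open>Let \<open>p\<close> be a nearest point of \<open>N\<close> to \<open>y t\<close> and let \<open>c\<close> run in \<open>N\<close> from \<open>p\<close> with velocity \<open>V p\<close>. The square of
  the distance from \<open>y (t + h)\<close> to \<open>c h\<close> is a majorant of the squared distance to \<open>N\<close>, and the Lipschitz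
  condition bounds its slope by \<open>2K\<close> times its value. Trajectories are confined to half the radius
  because \<open>p\<close> can be twice as far from \<open>y0\<close> as \<open>y t\<close> is.\<close>

lemma forward_invariance:
  fixes V :: "'a::euclidean_space \<Rightarrow> 'a"
  assumes N: "closed N" "y0 \<in> N"
    and lip: "\<And>x y. x \<in> ball y0 R \<Longrightarrow> y \<in> ball y0 R \<Longrightarrow> norm (V x - V y) \<le> K * norm (x - y)"
    and tangent: "\<And>p. p \<in> N \<Longrightarrow> p \<in> ball y0 R \<Longrightarrow>
      \<exists>c. c 0 = p \<and> (c has_vector_derivative V p) (at 0) \<and> (\<forall>\<^sub>F h in at_right 0. c h \<in> N)"
    and y: "\<And>t. \<bar>t\<bar> < \<epsilon> \<Longrightarrow> (y has_vector_derivative V (y t)) (at t)"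
      "\<And>t. \<bar>t\<bar> < \<epsilon> \<Longrightarrow> y t \<in> ball y0 (R / 2)" "y 0 \<in> N"
    and t: "0 \<le> t" "t < \<epsilon>"
  shows "y t \<in> N"
proof -
  define u where "u t = (infdist (y t) N)\<^sup>2" for t
  have "u t \<le> 0"
  proof (rule subsolution_nonpos[of t u "2 * K"])
    have "continuous_on {0..t} y"
      by (rule continuous_at_imp_continuous_on)
         (use t in \<open>auto intro!: has_vector_derivative_continuous[OF y(1)]\<close>)
    then show "continuous_on {0..t} u" unfolding u_def by (intro continuous_intros)
    show "u 0 \<le> 0" using y(3) by (simp add: u_def)
    fix s assume s: "0 \<le> s" "s < t"
    then have s\<epsilon>: "\<bar>s\<bar> < \<epsilon>" using t by auto
    obtain p where p: "p \<in> N" "infdist (y s) N = dist (y s) p"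
      using infdist_attains_inf[OF N(1), of "y s"] N(2) by blast
    have yb: "dist y0 (y s) < R / 2" using y(2)[OF s\<epsilon>] by simp
    moreover have "dist (y s) p \<le> dist (y s) y0" using infdist_le[OF N(2), of "y s"] p by simp
    ultimately have "dist y0 p < R" using dist_triangle[of y0 p "y s"] by (simp add: dist_commute)
    then have pb: "p \<in> ball y0 R" by simp
    have R: "R > 0" using yb zero_le_dist[of y0 "y s"] by linarith
    have yb': "y s \<in> ball y0 R" using yb R by simp
    obtain c where c: "c 0 = p" "(c has_vector_derivative V p) (at 0)" "\<forall>\<^sub>F h in at_right 0. c h \<in> N"
      using tangent[OF p(1) pb] by blast
    define k where "k h = (y (s + h) - c h) \<bullet> (y (s + h) - c h)" for h
    have "((\<lambda>h. y (s + h)) has_vector_derivative V (y s)) (at 0)"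
    proof -
      have "((\<lambda>h. s + h) has_vector_derivative 1) (at 0)"
        by (auto intro!: derivative_eq_intros)
      moreover have "(y has_vector_derivative V (y s)) (at (s + 0))" using y(1)[OF s\<epsilon>] by simp
      ultimately show ?thesis using vector_diff_chain_at[of "\<lambda>h. s + h" 1 0 y] by (simp add: o_def)
    qed
    from has_vector_derivative_diff[OF this c(2)]
    have D: "((\<lambda>h. y (s + h) - c h) has_derivative (\<lambda>h. h *\<^sub>R (V (y s) - V p))) (at 0)"
      by (simp add: has_vector_derivative_def)
    have "(k has_real_derivative 2 * ((y s - p) \<bullet> (V (y s) - V p))) (at 0)"
      unfolding k_def has_field_derivative_def
      by (rule has_derivative_eq_rhs[OF has_derivative_inner[OF D D]])
         (simp add: c(1) inner_commute fun_eq_iff)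
    moreover have "k 0 = u s" by (simp add: k_def u_def p(2) c(1) dist_norm dot_square_norm)
    moreover have "2 * ((y s - p) \<bullet> (V (y s) - V p)) \<le> 2 * K * u s"
    proof -
      have "(y s - p) \<bullet> (V (y s) - V p) \<le> norm (y s - p) * norm (V (y s) - V p)" by (rule norm_cauchy_schwarz)
      also have "\<dots> \<le> norm (y s - p) * (K * norm (y s - p))" by (intro mult_left_mono lip yb' pb) auto
      finally show ?thesis by (simp add: u_def p(2) dist_norm power2_eq_square algebra_simps)
    qed
    moreover have "\<forall>\<^sub>F h in at_right 0. u (s + h) \<le> k h"
      using c(3)
    proof eventually_elim
      case (elim h)
      have "infdist (y (s + h)) N \<le> dist (y (s + h)) (c h)" by (rule infdist_le[OF elim])
      then have "u (s + h) \<le> (dist (y (s + h)) (c h))\<^sup>2" unfolding u_def by (intro power_mono infdist_nonneg)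
      then show ?case by (simp add: k_def dist_norm dot_square_norm)
    qed
    ultimately show "\<exists>k k'. (k has_real_derivative k') (at 0) \<and> k 0 = u s \<and> k' \<le> 2 * K * u s \<and>
        (\<forall>\<^sub>F h in at_right 0. u (s + h) \<le> k h)" by blast
  qed (use t in auto)
  then have "infdist (y t) N = 0" by (simp add: u_def)
  then show ?thesis using in_closed_iff_infdist_zero[OF N(1)] N(2) by blast
qed

text \<open>Nagumo's invariance theorem for Lipschitz vector fields. It applies also
  to sets on which the restricted field is too irregular for the uniqueness theorem of
  ordinary differential equations.\<close>

theorem tangent_set_invariant:
  fixes V :: "'a::euclidean_space \<Rightarrow> 'a"
  assumes N: "closed N" "y0 \<in> N"
    and lip: "\<And>x y. x \<in> ball y0 R \<Longrightarrow> y \<in> ball y0 R \<Longrightarrow> norm (V x - V y) \<le> K * norm (x - y)"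
    and tangent: "\<And>p. p \<in> N \<Longrightarrow> p \<in> ball y0 R \<Longrightarrow>
      \<exists>c. c 0 = p \<and> (c has_vector_derivative V p) (at 0) \<and> (\<forall>\<^sub>F h in at 0. c h \<in> N)"
    and y: "\<And>t. \<bar>t\<bar> < \<epsilon> \<Longrightarrow> (y has_vector_derivative V (y t)) (at t)"
      "\<And>t. \<bar>t\<bar> < \<epsilon> \<Longrightarrow> y t \<in> ball y0 (R / 2)" "y 0 \<in> N"
    and t: "\<bar>t\<bar> < \<epsilon>"
  shows "y t \<in> N"
proof (cases "t \<ge> 0")
  case True
  show ?thesis
  proof (rule forward_invariance[OF N lip _ y])
    show "\<exists>c. c 0 = p \<and> (c has_vector_derivative V p) (at 0) \<and> (\<forall>\<^sub>F h in at_right 0. c h \<in> N)"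
      if "p \<in> N" "p \<in> ball y0 R" for p
      using tangent[OF that] by (auto intro: filter_leD[OF at_le])
  qed (use True t in auto)
next
  case False
  have rev: "((\<lambda>t. f (- t)) has_vector_derivative - f') (at t)"
    if "(f has_vector_derivative f') (at (- t))" for f :: "real \<Rightarrow> 'a" and f' t
  proof -
    have "(uminus has_vector_derivative (-1)) (at t)" by (auto intro!: derivative_eq_intros)
    from vector_diff_chain_at[OF this that] show ?thesis by (simp add: o_def)
  qed
  have "(\<lambda>t. y (- t)) (- t) \<in> N"
  proof (rule forward_invariance[OF N, where V = "\<lambda>x. - V x" and R = R and K = K and \<epsilon> = \<epsilon> and y = "\<lambda>t. y (- t)"])
    show "norm (- V x - - V y) \<le> K * norm (x - y)" if "x \<in> ball y0 R" "y \<in> ball y0 R" for x y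
      using lip[OF that] by (simp add: norm_minus_commute)
    show "\<exists>c. c 0 = p \<and> (c has_vector_derivative - V p) (at 0) \<and> (\<forall>\<^sub>F h in at_right 0. c h \<in> N)"
      if p: "p \<in> N" "p \<in> ball y0 R" for p
    proof -
      obtain c where c: "c 0 = p" "(c has_vector_derivative V p) (at 0)" "\<forall>\<^sub>F h in at 0. c h \<in> N"
        using tangent[OF p] by blast
      have "filterlim uminus (at 0) (at_right (0::real))"
        by (auto simp: filterlim_at eventually_at_filter intro!: tendsto_eq_intros)
      from eventually_compose_filterlim[OF c(3) this]
      have "\<forall>\<^sub>F h in at_right 0. c (- h) \<in> N" .
      then show ?thesis using c rev[of c "V p" 0] by (intro exI[of _ "\<lambda>h. c (- h)"]) auto
    qed
    show "((\<lambda>t. y (- t)) has_vector_derivative - V (y (- s))) (at s)" if "\<bar>s\<bar> < \<epsilon>" for s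
      by (rule rev[OF y(1)]) (use that in simp)
    show "y (- s) \<in> ball y0 (R / 2)" if "\<bar>s\<bar> < \<epsilon>" for s
      by (rule y(2)) (use that in simp)
  qed (use y(3) False t in auto)
  then show ?thesis by simp
qed

section \<open>Symmetry of the second derivative\<close>

text \<open>The second difference is symmetric in \<open>u\<close> and \<open>v\<close>, while two applications of the mean value theorem
  single out an order of differentiation; comparing both orders proves symmetry of the Hessian.\<close>

lemma second_difference_mean_value:
  fixes \<phi> :: "'a::real_inner \<Rightarrow> real"
  assumes r: "ball x r \<subseteq> S"
    and n: "\<And>y. y \<in> S \<Longrightarrow> (\<phi> has_derivative (\<lambda>h. n y \<bullet> h)) (at y)"
    and n': "\<And>y. y \<in> S \<Longrightarrow> (n has_derivative blinfun_apply (n' y)) (at y)"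
    and s: "0 < s" "s * (norm u + norm v) < r"
  shows "\<exists>y. dist y x \<le> s * (norm u + norm v) \<and>
    \<phi> (x + s *\<^sub>R u + s *\<^sub>R v) - \<phi> (x + s *\<^sub>R u) - \<phi> (x + s *\<^sub>R v) + \<phi> x = s\<^sup>2 * (n' y v \<bullet> u)"
proof -
  have d: "dist (x + a *\<^sub>R u + b *\<^sub>R v) x \<le> s * (norm u + norm v)" if "0 \<le> a" "a \<le> s" "0 \<le> b" "b \<le> s" for a b
  proof -
    have "norm (a *\<^sub>R u + b *\<^sub>R v) \<le> a * norm u + b * norm v"
      using norm_triangle_ineq[of "a *\<^sub>R u" "b *\<^sub>R v"] that by simp
    also have "\<dots> \<le> s * norm u + s * norm v" using that by (intro add_mono mult_right_mono) auto
    finally show ?thesis by (simp add: dist_norm algebra_simps)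
  qed
  have inS: "x + a *\<^sub>R u + b *\<^sub>R v \<in> S" if "0 \<le> a" "a \<le> s" "0 \<le> b" "b \<le> s" for a b
    using d[OF that] s(2) r by (auto simp: dist_commute)
  define g where "g a = \<phi> (x + a *\<^sub>R u + s *\<^sub>R v) - \<phi> (x + a *\<^sub>R u)" for a
  have line: "((\<lambda>a. \<phi> (p + a *\<^sub>R u)) has_real_derivative n (p + a *\<^sub>R u) \<bullet> u) (at a)"
    if "p + a *\<^sub>R u \<in> S" for p a
  proof -
    have "((\<lambda>a. p + a *\<^sub>R u) has_derivative (\<lambda>h. h *\<^sub>R u)) (at a)" by (auto intro!: derivative_eq_intros)
    from has_derivative_compose[OF this n[OF that]] show ?thesis
      unfolding has_field_derivative_def by (rule has_derivative_eq_rhs) (simp add: fun_eq_iff mult.commute)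
  qed
  have "\<exists>a. 0 < a \<and> a < s \<and> g s - g 0 = (s - 0) * (n (x + a *\<^sub>R u + s *\<^sub>R v) \<bullet> u - n (x + a *\<^sub>R u) \<bullet> u)"
  proof (rule MVT2[OF s(1)])
    fix a assume "0 \<le> a" "a \<le> s"
    then have "(x + s *\<^sub>R v) + a *\<^sub>R u \<in> S" "x + a *\<^sub>R u \<in> S"
      using inS[of a s] inS[of a 0] s by (auto simp: algebra_simps)
    from DERIV_diff[OF line[OF this(1)] line[OF this(2)]]
    show "(g has_real_derivative n (x + a *\<^sub>R u + s *\<^sub>R v) \<bullet> u - n (x + a *\<^sub>R u) \<bullet> u) (at a)"
      unfolding g_def by (simp add: algebra_simps)
  qed
  then obtain a where a: "0 < a" "a < s" "g s - g 0 = s * (n (x + a *\<^sub>R u + s *\<^sub>R v) \<bullet> u - n (x + a *\<^sub>R u) \<bullet> u)"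
    by auto
  define q where "q b = n (x + a *\<^sub>R u + b *\<^sub>R v) \<bullet> u" for b
  have "\<exists>b. 0 < b \<and> b < s \<and> q s - q 0 = (s - 0) * (n' (x + a *\<^sub>R u + b *\<^sub>R v) v \<bullet> u)"
  proof (rule MVT2[OF s(1)])
    fix b assume b: "0 \<le> b" "b \<le> s"
    have "((\<lambda>b. x + a *\<^sub>R u + b *\<^sub>R v) has_derivative (\<lambda>h. h *\<^sub>R v)) (at b)" by (auto intro!: derivative_eq_intros)
    from has_derivative_compose[OF this n'[OF inS]] a b
    have "((\<lambda>b. n (x + a *\<^sub>R u + b *\<^sub>R v)) has_derivative (\<lambda>h. n' (x + a *\<^sub>R u + b *\<^sub>R v) (h *\<^sub>R v))) (at b)" by simp
    from has_derivative_inner_left[OF this, of u]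
    show "(q has_real_derivative n' (x + a *\<^sub>R u + b *\<^sub>R v) v \<bullet> u) (at b)"
      unfolding q_def has_field_derivative_def
      by (rule has_derivative_eq_rhs) (simp add: fun_eq_iff mult.commute blinfun.scaleR_right)
  qed
  then obtain b where b: "0 < b" "b < s" "q s - q 0 = s * (n' (x + a *\<^sub>R u + b *\<^sub>R v) v \<bullet> u)" by auto
  have "g s - g 0 = s * (q s - q 0)" using a(3) by (simp add: q_def)
  then have "g s - g 0 = s\<^sup>2 * (n' (x + a *\<^sub>R u + b *\<^sub>R v) v \<bullet> u)" by (simp add: b(3) power2_eq_square)
  then show ?thesis using d[of a b] a b by (intro exI[of _ "x + a *\<^sub>R u + b *\<^sub>R v"]) (auto simp: g_def)
qed

lemma gradient_derivative_symmetric: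
  fixes \<phi> :: "'a::real_inner \<Rightarrow> real"
  assumes S: "open S" "x \<in> S"
    and n: "\<And>y. y \<in> S \<Longrightarrow> (\<phi> has_derivative (\<lambda>h. n y \<bullet> h)) (at y)"
    and n': "\<And>y. y \<in> S \<Longrightarrow> (n has_derivative blinfun_apply (n' y)) (at y)" "continuous_on S n'"
  shows "n' x u \<bullet> v = n' x v \<bullet> u"
proof -
  obtain r where r: "r > 0" "ball x r \<subseteq> S" using S open_contains_ball by blast
  have lim: "((\<lambda>s. (\<phi> (x + s *\<^sub>R u + s *\<^sub>R v) - \<phi> (x + s *\<^sub>R u) - \<phi> (x + s *\<^sub>R v) + \<phi> x) / s\<^sup>2) \<longlongrightarrow> n' x v \<bullet> u) (at_right 0)"
    for u v
  proof (rule tendstoI)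
    fix e :: real assume e: "e > 0"
    have "isCont (\<lambda>y. n' y v \<bullet> u) x"
      using n'(2) S by (intro continuous_intros) (auto simp: continuous_on_eq_continuous_at)
    then obtain d where d: "d > 0" "\<And>y. dist y x < d \<Longrightarrow> dist (n' y v \<bullet> u) (n' x v \<bullet> u) < e"
      unfolding continuous_at_eps_delta using e by blast
    have "((\<lambda>s. s * (norm u + norm v)) \<longlongrightarrow> 0) (at_right 0)" by (auto intro!: tendsto_eq_intros)
    then have "\<forall>\<^sub>F s in at_right 0. s * (norm u + norm v) < min r d"
      by (rule order_tendstoD) (use r d in auto)
    moreover have "\<forall>\<^sub>F s::real in at_right 0. 0 < s" by (rule eventually_at_right_less)
    ultimately show "\<forall>\<^sub>F s in at_right 0. dist ((\<phi> (x + s *\<^sub>R u + s *\<^sub>R v) - \<phi> (x + s *\<^sub>R u) - \<phi> (x + s *\<^sub>R v) + \<phi> x) / s\<^sup>2) (n' x v \<bullet> u) < e"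
    proof eventually_elim
      case (elim s)
      then obtain y where "dist y x \<le> s * (norm u + norm v)"
        "\<phi> (x + s *\<^sub>R u + s *\<^sub>R v) - \<phi> (x + s *\<^sub>R u) - \<phi> (x + s *\<^sub>R v) + \<phi> x = s\<^sup>2 * (n' y v \<bullet> u)"
        using second_difference_mean_value[OF r(2) n n'(1), of s u v] by auto
      then show ?case using d(2)[of y] elim by simp
    qed
  qed
  have eq: "\<phi> (x + s *\<^sub>R v + s *\<^sub>R u) - \<phi> (x + s *\<^sub>R v) - \<phi> (x + s *\<^sub>R u) + \<phi> x
      = \<phi> (x + s *\<^sub>R u + s *\<^sub>R v) - \<phi> (x + s *\<^sub>R u) - \<phi> (x + s *\<^sub>R v) + \<phi> x" for s
    by (simp add: algebra_simps)
  show ?thesis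
    using tendsto_unique[OF _ lim[of v u, unfolded eq] lim[of u v]] by (simp add: trivial_limit_at_right_real)
qed

section \<open>Inverses of operators and of maps\<close>

text \<open>Where one factor vanishes, the other one need only be continuous. This is the step from continuity
  of inversion to its differentiability: in \<open>B y - B x = - B y (A y - A x) B x\<close> the middle factor vanishes
  at \<open>y = x\<close>.\<close>

lemma has_derivative_bilinear_vanishing:
  fixes op :: "'b::real_normed_vector \<Rightarrow> 'c::real_normed_vector \<Rightarrow> 'd::real_normed_vector"
  assumes "bounded_bilinear op" and f: "isCont f x" and g: "(g has_derivative g') (at x)" "g x = 0"
  shows "((\<lambda>y. op (f y) (g y)) has_derivative (\<lambda>h. op (f x) (g' h))) (at x)"
proof -
  interpret bounded_bilinear op by fact
  interpret g': bounded_linear g' using g(1) by (rule has_derivative_bounded_linear)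
  obtain K where K: "K > 0" "\<And>a b. norm (op a b) \<le> norm a * norm b * K" using pos_bounded by blast
  obtain G where G: "G > 0" "\<And>h. norm (g' h) \<le> norm h * G" using g'.pos_bounded by blast
  show ?thesis unfolding has_derivative_at_alt
  proof (intro conjI allI impI)
    show "bounded_linear (\<lambda>h. op (f x) (g' h))"
      by (rule bounded_linear_compose[OF bounded_linear_right g'.bounded_linear])
    fix e :: real assume e: "e > 0"
    define G1 where "G1 = G + 1"
    have G1: "G1 > 0" using G(1) by (simp add: G1_def)
    define F1 where "F1 = norm (f x) + 1"
    have F1: "F1 > 0" "norm (f x) \<le> F1" by (auto simp: F1_def add_nonneg_pos)
    define e1 where "e1 = e / (2 * K * G1)"
    define e2 where "e2 = min 1 (e / (2 * K * F1))"
    have e12: "e1 > 0" "e2 > 0" using e K(1) G1 F1(1) by (auto simp: e1_def e2_def)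
    obtain d1 where d1: "d1 > 0" "\<And>y. norm (y - x) < d1 \<Longrightarrow> norm (f y - f x) < e1"
      using f e12 unfolding continuous_at_eps_delta dist_norm by blast
    obtain d2 where d2: "d2 > 0" "\<And>y. norm (y - x) < d2 \<Longrightarrow> norm (g y - g x - g' (y - x)) \<le> e2 * norm (y - x)"
      using g(1) e12 unfolding has_derivative_at_alt by blast
    have "norm (op (f y) (g y) - op (f x) (g x) - op (f x) (g' (y - x))) \<le> e * norm (y - x)"
      if y: "norm (y - x) < min d1 d2" for y
    proof -
      let ?h = "y - x"
      have a: "norm (g y - g' ?h) \<le> e2 * norm ?h" using d2(2)[of y] y g(2) by simp
      have "norm (g y) \<le> norm (g y - g' ?h) + norm (g' ?h)" by (metis diff_add_cancel norm_triangle_ineq)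
      also have "\<dots> \<le> 1 * norm ?h + norm ?h * G"
        by (intro add_mono order_trans[OF a] mult_right_mono G) (auto simp: e2_def)
      finally have b: "norm (g y) \<le> G1 * norm ?h" by (simp add: algebra_simps G1_def)
      have "op (f y) (g y) - op (f x) (g x) - op (f x) (g' ?h) = op (f y - f x) (g y) + op (f x) (g y - g' ?h)"
        by (simp add: g(2) diff_left diff_right zero_right)
      also have "norm \<dots> \<le> norm (f y - f x) * norm (g y) * K + norm (f x) * norm (g y - g' ?h) * K"
        by (rule order_trans[OF norm_triangle_ineq add_mono[OF K(2) K(2)]])
      also have "\<dots> \<le> e1 * (G1 * norm ?h) * K + norm (f x) * ((e / (2 * K * F1)) * norm ?h) * K"
      proof (intro add_mono mult_right_mono mult_mono mult_left_mono b)
        show "norm (f y - f x) \<le> e1" using d1(2)[of y] y by simp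
        show "norm (g y - g' ?h) \<le> e / (2 * K * F1) * norm ?h"
          by (rule order_trans[OF a mult_right_mono]) (auto simp: e2_def)
      qed (use e12 K in auto)
      also have "e1 * (G1 * norm ?h) * K = e / 2 * norm ?h"
        using K(1) G1 by (simp add: e1_def)
      also have "norm (f x) * ((e / (2 * K * F1)) * norm ?h) * K
          = (norm (f x) / F1) * (e / 2 * norm ?h)"
        using K(1) F1(1) by (simp add: field_simps)
      also have "\<dots> \<le> 1 * (e / 2 * norm ?h)"
        by (rule mult_right_mono) (use e F1 in \<open>auto simp: divide_le_eq_1\<close>)
      finally show ?thesis by (simp add: algebra_simps)
    qed
    then show "\<exists>d>0. \<forall>y. norm (y - x) < d \<longrightarrow>
        norm (op (f y) (g y) - op (f x) (g x) - op (f x) (g' (y - x))) \<le> e * norm (y - x)"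
      using d1 d2 by (intro exI[of _ "min d1 d2"]) auto
  qed
qed

lemma blinfun_inverse_diff:
  assumes "A x o\<^sub>L B x = id_blinfun" "B y o\<^sub>L A y = id_blinfun"
  shows "B y = B x - (B y o\<^sub>L ((A y - A x) o\<^sub>L B x))"
proof (rule blinfun_eqI)
  fix v
  have "A x (B x v) = v" "B y (A y (B x v)) = B x v"
    using assms by (metis blinfun_apply_blinfun_compose blinfun_apply_id_blinfun)+
  then show "B y v = (B x - (B y o\<^sub>L ((A y - A x) o\<^sub>L B x))) v"
    by (simp add: blinfun.bilinear_simps)
qed

text \<open>The identity for \<open>B y - B x\<close> first gives \<open>|B y| \<le> 2 (|B x| + 1)\<close> near \<open>x\<close>, and with this bound it gives
  continuity.\<close>

lemma continuous_on_blinfun_inverse: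
  assumes A: "continuous_on S A"
    and inv: "\<And>x. x \<in> S \<Longrightarrow> A x o\<^sub>L B x = id_blinfun" "\<And>x. x \<in> S \<Longrightarrow> B x o\<^sub>L A x = id_blinfun"
  shows "continuous_on S B"
  unfolding continuous_on_def
proof
  fix x assume x: "x \<in> S"
  have lim: "((\<lambda>y. norm (A y - A x)) \<longlongrightarrow> 0) (at x within S)"
    by (intro tendsto_norm_zero LIM_zero) (use A x in \<open>simp add: continuous_on_def\<close>)
  define b where "b = norm (B x) + 1"
  have b: "b > 0" "norm (B x) \<le> b" by (auto simp: b_def add_nonneg_pos)
  have "\<forall>\<^sub>F y in at x within S. norm (A y - A x) < 1 / (2 * b)"
    by (rule order_tendstoD(2)[OF lim]) (use b in auto)
  moreover have "\<forall>\<^sub>F y in at x within S. y \<in> S" by (simp add: eventually_at_filter)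
  ultimately have "\<forall>\<^sub>F y in at x within S. norm (B y - B x) \<le> 2 * b * b * norm (A y - A x)"
  proof eventually_elim
    case (elim y)
    define D where "D = B y o\<^sub>L ((A y - A x) o\<^sub>L B x)"
    have eq: "B y = B x - D" unfolding D_def by (rule blinfun_inverse_diff[where A = A]) (use inv x elim in auto)
    have "norm D \<le> norm (B y) * (norm (A y - A x) * norm (B x))"
      unfolding D_def by (rule order_trans[OF norm_blinfun_compose mult_left_mono[OF norm_blinfun_compose]]) simp
    also have "\<dots> \<le> norm (B y) * (norm (A y - A x) * b)" using b by (intro mult_left_mono) auto
    finally have D: "norm D \<le> norm (B y) * (norm (A y - A x) * b)" .
    have "norm (A y - A x) * b \<le> 1 / (2 * b) * b" using elim b by (intro mult_right_mono) auto
    then have "norm (A y - A x) * b \<le> 1 / 2" using b by simp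
    then have "norm D \<le> norm (B y) * (1 / 2)" by (intro order_trans[OF D] mult_left_mono) auto
    moreover have "norm (B y) \<le> norm (B x) + norm D" using eq norm_triangle_ineq4[of "B x" D] by simp
    ultimately have "norm (B y) \<le> 2 * b" using b by linarith
    then have "norm D \<le> 2 * b * (norm (A y - A x) * b)"
      by (intro order_trans[OF D] mult_right_mono) (use b in auto)
    then show ?case using eq by (simp add: mult_ac)
  qed
  moreover have "((\<lambda>y. 2 * b * b * norm (A y - A x)) \<longlongrightarrow> 0) (at x within S)"
    using tendsto_mult_right_zero[OF lim] .
  ultimately have "((\<lambda>y. B y - B x) \<longlongrightarrow> 0) (at x within S)"
    by (rule Lim_null_comparison)
  then show "(B \<longlongrightarrow> B x) (at x within S)" by (rule LIM_zero_cancel)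
qed

lemma C1_on_blinfun_inverse:
  assumes S: "open S" and A: "C1_on S A"
    and inv: "\<And>x. x \<in> S \<Longrightarrow> A x o\<^sub>L B x = id_blinfun" "\<And>x. x \<in> S \<Longrightarrow> B x o\<^sub>L A x = id_blinfun"
  shows "C1_on S B"
proof -
  obtain A' where A': "continuous_on S A'" "\<And>x. x \<in> S \<Longrightarrow> (A has_derivative blinfun_apply (A' x)) (at x)"
    using C1_onE[OF A] by blast
  have Bc: "continuous_on S B"
    by (rule continuous_on_blinfun_inverse[OF C1_on_imp_continuous_on[OF A] inv])
  let ?l = "bounded_bilinear.prod_left (o\<^sub>L)" and ?r = "bounded_bilinear.prod_right (o\<^sub>L)"
  note bb = bounded_bilinear_blinfun_compose
  define B' where "B' x = - (?r (B x) o\<^sub>L (?l (B x) o\<^sub>L A' x))" for x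
  show ?thesis
  proof (rule C1_onI)
    show "continuous_on S B'" unfolding B'_def
      by (intro continuous_on_minus bounded_bilinear.continuous_on[OF bb] A'(1)
          bounded_linear.continuous_on[OF bounded_bilinear.bounded_linear_prod_left[OF bb] Bc]
          bounded_linear.continuous_on[OF bounded_bilinear.bounded_linear_prod_right[OF bb] Bc])
    fix x assume x: "x \<in> S"
    have "isCont B x" using Bc S x continuous_on_eq_continuous_at by blast
    moreover have "((\<lambda>y. (A y - A x) o\<^sub>L B x) has_derivative (\<lambda>h. A' x h o\<^sub>L B x)) (at x)"
      by (rule bounded_linear.has_derivative[OF bounded_bilinear.bounded_linear_left[OF bb]])
         (use A'(2)[OF x] in \<open>auto intro!: derivative_eq_intros\<close>)
    ultimately have "((\<lambda>y. B y o\<^sub>L ((A y - A x) o\<^sub>L B x)) has_derivative (\<lambda>h. B x o\<^sub>L (A' x h o\<^sub>L B x))) (at x)"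
      by (intro has_derivative_bilinear_vanishing[OF bb]) (auto simp: blinfun_compose_zero)
    then have "((\<lambda>y. B x - (B y o\<^sub>L ((A y - A x) o\<^sub>L B x))) has_derivative (\<lambda>h. 0 - (B x o\<^sub>L (A' x h o\<^sub>L B x)))) (at x)"
      by (intro has_derivative_diff has_derivative_const)
    then have "(B has_derivative (\<lambda>h. 0 - (B x o\<^sub>L (A' x h o\<^sub>L B x)))) (at x)"
      by (rule has_derivative_transform_within_open[OF _ S x]) (rule blinfun_inverse_diff[symmetric], use inv x in auto)
    moreover have "blinfun_apply (B' x) = (\<lambda>h. 0 - (B x o\<^sub>L (A' x h o\<^sub>L B x)))"
      by (simp add: B'_def fun_eq_iff uminus_blinfun.rep_eq bounded_bilinear.prod_left.rep_eq[OF bb] bounded_bilinear.prod_right.rep_eq[OF bb])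
    ultimately show "(B has_derivative blinfun_apply (B' x)) (at x)" by simp
  qed
qed

text \<open>The derivative of the inverse is the inverse of the derivative, hence continuous.\<close>

lemma C1_local_inverse:
  fixes f :: "'a::euclidean_space \<Rightarrow> 'a"
  assumes "open U" "C1_on U f" "x0 \<in> U" "(f has_derivative (\<lambda>h. h)) (at x0)"
  obtains U' W g where "open U'" "U' \<subseteq> U" "x0 \<in> U'" "open W" "f x0 \<in> W" "homeomorphism U' W f g" "C1_on W g"
proof -
  obtain f' where f': "continuous_on U f'" "\<And>x. x \<in> U \<Longrightarrow> (f has_derivative blinfun_apply (f' x)) (at x)"
    using C1_onE[OF assms(2)] by blast
  have "blinfun_apply (f' x0) = (\<lambda>h. h)"
    using has_derivative_unique[OF f'(2)[OF assms(3)] assms(4)] .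
  then have "id_blinfun o\<^sub>L f' x0 = id_blinfun" by (auto intro!: blinfun_eqI)
  from inverse_function_theorem[OF assms(1) f'(2) f'(1) assms(3) this]
  obtain U' W g g' where U': "open U'" "U' \<subseteq> U" "x0 \<in> U'" "open W" "f x0 \<in> W" "homeomorphism U' W f g"
    and g: "\<And>y. y \<in> W \<Longrightarrow> (g has_derivative (g' y)) (at y)"
      "\<And>y. y \<in> W \<Longrightarrow> g' y = inv (blinfun_apply (f'(g y)))" "\<And>y. y \<in> W \<Longrightarrow> bij (blinfun_apply (f'(g y)))"
    by metis
  have gW: "continuous_on W g" "g ` W \<subseteq> U" using U'(2,6) unfolding homeomorphism_def by auto
  have g'b: "blinfun_apply (Blinfun (g' y)) = g' y" if "y \<in> W" for y
    by (rule bounded_linear_Blinfun_apply[OF has_derivative_bounded_linear[OF g(1)[OF that]]])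
  have "C1_on W g"
  proof (rule C1_onI[where f' = "\<lambda>y. Blinfun (g' y)"])
    show "continuous_on W (\<lambda>y. Blinfun (g' y))"
    proof (rule continuous_on_blinfun_inverse)
      show "continuous_on W (\<lambda>y. f' (g y))" by (rule continuous_on_compose2[OF f'(1) gW])
      fix y assume y: "y \<in> W"
      show "f' (g y) o\<^sub>L Blinfun (g' y) = id_blinfun"
        by (rule blinfun_eqI) (simp add: g'b[OF y], simp add: g(2)[OF y] surj_f_inv_f[OF bij_is_surj[OF g(3)[OF y]]])
      show "Blinfun (g' y) o\<^sub>L f' (g y) = id_blinfun"
        by (rule blinfun_eqI) (simp add: g'b[OF y], simp add: g(2)[OF y] inv_f_f[OF bij_is_inj[OF g(3)[OF y]]])
    qed
  qed (use g(1) g'b in auto)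
  then show thesis using that[OF U'] by blast
qed

section \<open>Level sets in a straightening chart\<close>

text \<open>A covector that vanishes on the kernel of another one is a multiple of it; here the kernel is the
  tangent space of a hypersurface.\<close>

lemma parallel_if_orthogonal_complement:
  fixes n p :: "'a::real_inner"
  assumes "n \<noteq> 0" "\<And>w. n \<bullet> w = 0 \<Longrightarrow> p \<bullet> w = 0"
  shows "\<exists>\<mu>. p = \<mu> *\<^sub>R n"
proof
  define w where "w = p - ((p \<bullet> n) / (n \<bullet> n)) *\<^sub>R n"
  have "n \<bullet> w = 0" using assms(1) by (simp add: w_def inner_diff_right inner_commute)
  then have "w \<bullet> w = 0" using assms(2)[of w] unfolding w_def inner_diff_left[of p] by simp
  then show "p = ((p \<bullet> n) / (n \<bullet> n)) *\<^sub>R n" by (simp add: w_def)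
qed

lemma C1_on_real_imp_C1_differentiable_on:
  fixes X :: "real \<Rightarrow> 'a::real_normed_vector"
  assumes "C1_on S X" shows "X C1_differentiable_on S"
proof -
  obtain X' where X': "continuous_on S X'" "\<And>t. t \<in> S \<Longrightarrow> (X has_derivative blinfun_apply (X' t)) (at t)"
    using C1_onE[OF assms] by blast
  have "(X has_vector_derivative X' t 1) (at t)" if "t \<in> S" for t
    using X'(2)[OF that] unfolding has_vector_derivative_def
    by (rule has_derivative_eq_rhs) (simp add: fun_eq_iff flip: blinfun.scaleR_right)
  moreover have "continuous_on S (\<lambda>t. X' t 1)"
    by (rule bounded_bilinear.continuous_on[OF bounded_bilinear_blinfun_apply X'(1) continuous_on_const])
  ultimately show ?thesis unfolding C1_differentiable_on_def by (intro exI[of _ "\<lambda>t. X' t 1"]) auto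
qed

lemma C1_on_has_frechet_derivative:
  "C1_on S f \<Longrightarrow> x \<in> S \<Longrightarrow> (f has_derivative frechet_derivative f (at x)) (at x)"
  by (metis C1_onE differentiableI frechet_derivative_works)

lemma has_vector_derivative_composed:
  fixes X :: "real \<Rightarrow> 'a::real_normed_vector"
  assumes "(X has_vector_derivative v) (at t)" "(f has_derivative f') (at (X t))"
  shows "((\<lambda>s. f (X s)) has_vector_derivative f' v) (at t)"
proof -
  interpret bounded_linear f' by (rule has_derivative_bounded_linear[OF assms(2)])
  show ?thesis using has_derivative_compose[OF assms(1)[unfolded has_vector_derivative_def] assms(2)]
    by (simp add: has_vector_derivative_def scaleR)
qed

lemma vector_derivative_0_if_eventually_const:
  fixes f :: "real \<Rightarrow> 'a::real_normed_vector"
  assumes "(f has_vector_derivative D) (at t)" "\<forall>\<^sub>F h in at t. f h = c" "f t = c"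
  shows "D = 0"
proof -
  have "((\<lambda>_. c) has_vector_derivative D) (at t)"
    using has_derivative_transform_eventually[OF assms(1)[unfolded has_vector_derivative_def], of "\<lambda>_. c"] assms(2,3)
    unfolding has_vector_derivative_def by simp
  moreover have "((\<lambda>_. c) has_vector_derivative 0) (at t)" by simp
  ultimately show ?thesis by (rule vector_derivative_unique_at)
qed

text \<open>A level set \<open>\<phi> = 0\<close> that the \<open>C\<^sup>1\<close> diffeomorphism \<open>\<psi>\<close> maps to the hyperplane orthogonal to \<open>b\<close>. Covectors are
  represented by vectors through the Euclidean inner product, so \<open>n\<close> stands for \<open>d\<phi>\<close>.\<close>

locale level_set_chart =
  fixes \<Omega> :: "'a::euclidean_space set" and b :: 'a
    and \<phi> :: "'a \<Rightarrow> real" and n :: "'a \<Rightarrow> 'a" and \<psi> \<psi>i :: "'a \<Rightarrow> 'a"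
  assumes \<Omega>: "open \<Omega>"
    and \<phi>_deriv: "\<And>x. x \<in> \<Omega> \<Longrightarrow> (\<phi> has_derivative (\<lambda>h. n x \<bullet> h)) (at x)"
    and n: "C1_on \<Omega> n"
    and \<psi>: "C1_on \<Omega> \<psi>" "open (\<psi> ` \<Omega>)" "C1_on (\<psi> ` \<Omega>) \<psi>i" "\<And>x. x \<in> \<Omega> \<Longrightarrow> \<psi>i (\<psi> x) = x"
    and b: "b \<bullet> b = 1" "\<And>x. x \<in> \<Omega> \<Longrightarrow> \<phi> x = \<psi> x \<bullet> b"
begin

lemma \<psi>_deriv: "x \<in> \<Omega> \<Longrightarrow> (\<psi> has_derivative frechet_derivative \<psi> (at x)) (at x)"
  by (rule C1_on_has_frechet_derivative[OF \<psi>(1)])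

lemma \<psi>i_deriv: "x \<in> \<Omega> \<Longrightarrow> (\<psi>i has_derivative frechet_derivative \<psi>i (at (\<psi> x))) (at (\<psi> x))"
  by (rule C1_on_has_frechet_derivative[OF \<psi>(3)]) (rule imageI)

lemma chart_derivatives_left_inverse:
  assumes x: "x \<in> \<Omega>"
  shows "frechet_derivative \<psi>i (at (\<psi> x)) (frechet_derivative \<psi> (at x) v) = v"
proof -
  have "((\<lambda>x. \<psi>i (\<psi> x)) has_derivative (\<lambda>h. frechet_derivative \<psi>i (at (\<psi> x)) (frechet_derivative \<psi> (at x) h))) (at x)"
    by (rule has_derivative_compose[OF \<psi>_deriv[OF x] \<psi>i_deriv[OF x]])
  moreover have "((\<lambda>x. \<psi>i (\<psi> x)) has_derivative (\<lambda>h. h)) (at x)"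
    by (rule has_derivative_transform_within_open[OF has_derivative_ident \<Omega> x]) (simp add: \<psi>(4))
  ultimately have "(\<lambda>h. frechet_derivative \<psi>i (at (\<psi> x)) (frechet_derivative \<psi> (at x) h)) = (\<lambda>h. h)"
    by (rule has_derivative_unique)
  then show ?thesis by (rule fun_cong)
qed

lemma chart_derivatives_right_inverse:
  assumes x: "x \<in> \<Omega>"
  shows "frechet_derivative \<psi> (at x) (frechet_derivative \<psi>i (at (\<psi> x)) v) = v"
proof -
  have "(\<psi> has_derivative frechet_derivative \<psi> (at x)) (at (\<psi>i (\<psi> x)))"
    using \<psi>_deriv[OF x] \<psi>(4)[OF x] by simp
  then have "((\<lambda>y. \<psi> (\<psi>i y)) has_derivative (\<lambda>h. frechet_derivative \<psi> (at x) (frechet_derivative \<psi>i (at (\<psi> x)) h))) (at (\<psi> x))"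
    by (rule has_derivative_compose[OF \<psi>i_deriv[OF x]])
  moreover have "((\<lambda>y. \<psi> (\<psi>i y)) has_derivative (\<lambda>h. h)) (at (\<psi> x))"
    by (rule has_derivative_transform_within_open[OF has_derivative_ident \<psi>(2) imageI[OF x]]) (use \<psi>(4) in force)
  ultimately have "(\<lambda>h. frechet_derivative \<psi> (at x) (frechet_derivative \<psi>i (at (\<psi> x)) h)) = (\<lambda>h. h)"
    by (rule has_derivative_unique)
  then show ?thesis by (rule fun_cong)
qed

lemma chart_derivative_normal:
  assumes x: "x \<in> \<Omega>"
  shows "frechet_derivative \<psi> (at x) v \<bullet> b = n x \<bullet> v"
proof -
  have "((\<lambda>x. \<psi> x \<bullet> b) has_derivative (\<lambda>h. frechet_derivative \<psi> (at x) h \<bullet> b)) (at x)"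
    by (rule has_derivative_inner_left[OF \<psi>_deriv[OF x]])
  then have "(\<phi> has_derivative (\<lambda>h. frechet_derivative \<psi> (at x) h \<bullet> b)) (at x)"
    by (rule has_derivative_transform_within_open[OF _ \<Omega> x]) (simp add: b(2))
  then have "(\<lambda>h. frechet_derivative \<psi> (at x) h \<bullet> b) = (\<lambda>h. n x \<bullet> h)"
    by (rule has_derivative_unique[OF _ \<phi>_deriv[OF x]])
  then show ?thesis by (rule fun_cong)
qed

lemma n_nonzero: "x \<in> \<Omega> \<Longrightarrow> n x \<noteq> 0"
  using chart_derivative_normal[of x "frechet_derivative \<psi>i (at (\<psi> x)) b"] b(1)
  by (auto simp: chart_derivatives_right_inverse)

text \<open>The preimage under \<open>\<psi>\<close> of a straight line in the hyperplane.\<close>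

lemma tangent_curve:
  assumes x: "x \<in> \<Omega>" "\<phi> x = 0" and v: "n x \<bullet> v = 0"
  obtains X \<epsilon> where "\<epsilon> > 0" "X 0 = x" "(X has_vector_derivative v) (at 0)"
    "X C1_differentiable_on {-\<epsilon><..<\<epsilon>}" "\<And>t. t \<in> {-\<epsilon><..<\<epsilon>} \<Longrightarrow> X t \<in> \<Omega> \<and> \<phi> (X t) = 0"
proof -
  define w where "w = frechet_derivative \<psi> (at x) v"
  have wv: "frechet_derivative \<psi>i (at (\<psi> x)) w = v" "w \<bullet> b = 0"
    using chart_derivatives_left_inverse[OF x(1)] chart_derivative_normal[OF x(1)] v by (simp_all add: w_def)
  define line where "line t = \<psi> x + t *\<^sub>R w" for t
  have lineC: "C1_on T line" for T
    unfolding line_def by (intro C1_on_add C1_on_const C1_on_scaleR C1_on_id)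
  have "open (line -` (\<psi> ` \<Omega>))"
    by (rule open_vimage[OF \<psi>(2) C1_on_imp_continuous_on[OF lineC]])
  moreover have "0 \<in> line -` (\<psi> ` \<Omega>)" using x by (simp add: line_def)
  ultimately obtain \<epsilon> where \<epsilon>: "\<epsilon> > 0" "ball 0 \<epsilon> \<subseteq> line -` (\<psi> ` \<Omega>)" by (meson openE)
  define X where "X t = \<psi>i (line t)" for t
  have inO: "line t \<in> \<psi> ` \<Omega>" if "t \<in> {-\<epsilon><..<\<epsilon>}" for t
  proof -
    have "t \<in> ball 0 \<epsilon>" using that by auto
    then show ?thesis using \<epsilon>(2) by blast
  qed
  show thesis
  proof (rule that[OF \<epsilon>(1)])
    show "X 0 = x" using x by (simp add: X_def line_def \<psi>(4))
    have "(line has_vector_derivative w) (at 0)" unfolding line_def by (auto intro!: derivative_eq_intros)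
    then show "(X has_vector_derivative v) (at 0)"
    proof -
      have "(\<psi>i has_derivative frechet_derivative \<psi>i (at (\<psi> x))) (at (line 0))"
        using \<psi>i_deriv[OF x(1)] by (simp add: line_def)
      from has_vector_derivative_composed[OF \<open>(line has_vector_derivative w) (at 0)\<close> this] show ?thesis
        unfolding X_def wv(1) .
    qed
    show "X C1_differentiable_on {-\<epsilon><..<\<epsilon>}"
      unfolding X_def by (intro C1_on_real_imp_C1_differentiable_on C1_on_compose[OF \<psi>(3) lineC] inO)
    fix t assume "t \<in> {-\<epsilon><..<\<epsilon>}"
    then obtain y where y: "y \<in> \<Omega>" "line t = \<psi> y" using inO by blast
    have "\<psi> y \<bullet> b = 0" using x(2) wv(2) b(2)[OF x(1)] by (simp add: y(2)[symmetric] line_def inner_add_left)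
    then show "X t \<in> \<Omega> \<and> \<phi> (X t) = 0" using y by (simp add: X_def \<psi>(4) b(2))
  qed
qed

end

section \<open>The geodesic flow on the conormals of a null level set\<close>

text \<open>\<open>G x\<close> is the metric at \<open>x\<close> as an operator from vectors to covectors, and \<open>B x\<close> is its inverse; thus \<open>B x (n x)\<close>
  is the metric gradient of \<open>\<phi>\<close>, and \<open>null\<close> says that it is tangent to the level set, equivalently a
  null vector. The number \<open>s\<close> prescribes the scale and the time direction of the field at \<open>z\<close>.\<close>

locale null_level_set = level_set_chart \<Omega> b \<phi> n \<psi> \<psi>i
  for \<Omega> :: "'a::euclidean_space set" and b \<phi> n \<psi> \<psi>i +
  fixes z :: 'a and G B :: "'a \<Rightarrow> 'a \<Rightarrow>\<^sub>L 'a" and DG :: "'a \<Rightarrow> 'a \<Rightarrow>\<^sub>L 'a \<Rightarrow>\<^sub>L 'a" and s :: real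
  assumes G_deriv: "\<And>x. x \<in> \<Omega> \<Longrightarrow> (G has_derivative blinfun_apply (DG x)) (at x)"
    and DG: "C1_on \<Omega> DG"
    and G_sym: "\<And>x u v. x \<in> \<Omega> \<Longrightarrow> G x u \<bullet> v = G x v \<bullet> u"
    and G_inverse: "\<And>x. x \<in> \<Omega> \<Longrightarrow> G x o\<^sub>L B x = id_blinfun" "\<And>x. x \<in> \<Omega> \<Longrightarrow> B x o\<^sub>L G x = id_blinfun"
    and null: "\<And>x. x \<in> \<Omega> \<Longrightarrow> \<phi> x = 0 \<Longrightarrow> n x \<bullet> B x (n x) = 0"
    and z: "z \<in> \<Omega>" "\<phi> z = 0"
    and s: "s \<noteq> 0"
begin

lemma G_B [simp]: "x \<in> \<Omega> \<Longrightarrow> G x (B x v) = v"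
  using G_inverse(1) by (metis blinfun_apply_blinfun_compose blinfun_apply_id_blinfun)

lemma B_G [simp]: "x \<in> \<Omega> \<Longrightarrow> B x (G x v) = v"
  using G_inverse(2) by (metis blinfun_apply_blinfun_compose blinfun_apply_id_blinfun)

lemma G_C1: "C1_on \<Omega> G"
  by (rule C1_onI[OF C1_on_imp_continuous_on[OF DG] G_deriv])

lemma B_C1: "C1_on \<Omega> B"
  by (rule C1_on_blinfun_inverse[OF \<Omega> G_C1 G_inverse])

text \<open>The Hamiltonian vector field of \<open>(x, p) \<mapsto> g\<^sup>-\<^sup>1(p, p) / 2\<close>, whose trajectories are the geodesics \<open>x\<close> with
  momentum \<open>p = g x'\<close>. The derivative of \<open>g\<^sup>-\<^sup>1\<close> is expressed by that of \<open>g\<close>. In this form the geodesic equation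
  contains no derivative of the inverse metric, and vectors normal to the level set correspond to multiples of \<open>d\<phi>\<close>.\<close>

definition spray :: "'a \<times> 'a \<Rightarrow> 'a \<times> 'a" where
  "spray p = (B (fst p) (snd p),
     (1/2) *\<^sub>R (\<Sum>i\<in>Basis. (DG (fst p) i (B (fst p) (snd p)) \<bullet> B (fst p) (snd p)) *\<^sub>R i))"

lemma spray_snd_inner: "snd (spray (x, p)) \<bullet> w = (1/2) * (DG x w (B x p) \<bullet> B x p)"
proof -
  have "DG x w = (\<Sum>i\<in>Basis. (w \<bullet> i) *\<^sub>R DG x i)"
    by (subst euclidean_representation[of w, symmetric]) (simp only: blinfun.sum_right blinfun.scaleR_right)
  then show ?thesis
    by (simp add: spray_def inner_sum_left blinfun.sum_left blinfun.scaleR_left mult.commute inner_commute[of w])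
qed

lemma spray_C1: "C1_on (\<Omega> \<times> UNIV) spray"
proof -
  have x: "C1_on (\<Omega> \<times> UNIV) fst" "C1_on (\<Omega> \<times> UNIV) snd"
    by (auto intro!: C1_on_linear bounded_linear_fst bounded_linear_snd)
  have B: "C1_on (\<Omega> \<times> UNIV) (\<lambda>p. B (fst p) (snd p))"
    by (rule C1_on_blinfun_apply[OF C1_on_compose[OF B_C1 x(1)] x(2)]) auto
  have "C1_on (\<Omega> \<times> UNIV) (\<lambda>p. DG (fst p))" by (rule C1_on_compose[OF DG x(1)]) auto
  then show ?thesis unfolding spray_def
    by (intro C1_on_Pair B C1_on_scaleR C1_on_const C1_on_sum C1_on_inner C1_on_blinfun_apply)
qed

text \<open>With \<open>N\<close> the metric gradient, this says that \<open>g(\<nabla>\<^sub>N N, w) = 0\<close> for \<open>w\<close> tangent to the level set, so that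
  \<open>\<nabla>\<^sub>N N\<close> is a multiple of \<open>N\<close>. It follows by differentiating \<open>g(N, N) = 0\<close> along \<open>w\<close>, which is allowed because
  \<open>w\<close> is tangent, and exchanging the two arguments of the Hessian of \<open>\<phi>\<close>.\<close>

lemma conormal_transport:
  assumes x: "x \<in> \<Omega>" "\<phi> x = 0" and w: "n x \<bullet> w = 0"
    and n': "\<And>y. y \<in> \<Omega> \<Longrightarrow> (n has_derivative blinfun_apply (n' y)) (at y)" "continuous_on \<Omega> n'"
  shows "DG x w (B x (n x)) \<bullet> B x (n x) = 2 * (n' x (B x (n x)) \<bullet> w)"
proof -
  define N where "N y = B y (n y)" for y
  obtain N' where N': "(N has_derivative blinfun_apply (N' x)) (at x)"
    using C1_onE[OF C1_on_blinfun_apply[OF B_C1 n]] x(1) unfolding N_def by metis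
  obtain X \<epsilon> where X: "\<epsilon> > 0" "X 0 = x" "(X has_vector_derivative w) (at 0)"
    "\<And>t. t \<in> {-\<epsilon><..<\<epsilon>} \<Longrightarrow> X t \<in> \<Omega> \<and> \<phi> (X t) = 0"
    using tangent_curve[OF x w] by metis
  have "((\<lambda>y. n y \<bullet> N y) has_derivative (\<lambda>h. n x \<bullet> N' x h + n' x h \<bullet> N x)) (at x)"
    by (rule has_derivative_inner[OF n'(1)[OF x(1)] N'])
  then have "((\<lambda>t. n (X t) \<bullet> N (X t)) has_vector_derivative n x \<bullet> N' x w + n' x w \<bullet> N x) (at 0)"
    using has_vector_derivative_composed[OF X(3), of "\<lambda>y. n y \<bullet> N y"] X(2) by simp
  moreover have "\<forall>\<^sub>F t in at 0. n (X t) \<bullet> N (X t) = 0"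
  proof -
    have "\<forall>\<^sub>F t in at 0. t \<in> {-\<epsilon><..<\<epsilon>}"
      using X(1) by (intro eventually_at_in_open') auto
    then show ?thesis by eventually_elim (use X(4) null in \<open>auto simp: N_def\<close>)
  qed
  ultimately have 1: "n x \<bullet> N' x w + n' x w \<bullet> N x = 0"
    by (rule vector_derivative_0_if_eventually_const) (use X(2) null x in \<open>simp add: N_def\<close>)
  have "((\<lambda>y. G y (N y)) has_derivative (\<lambda>h. G x (N' x h) + DG x h (N x))) (at x)"
    by (rule bounded_bilinear.FDERIV[OF bounded_bilinear_blinfun_apply G_deriv[OF x(1)] N'])
  then have "(n has_derivative (\<lambda>h. G x (N' x h) + DG x h (N x))) (at x)"
    by (rule has_derivative_transform_within_open[OF _ \<Omega> x(1)]) (simp add: N_def)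
  then have "G x (N' x w) + DG x w (N x) = n' x w"
    using has_derivative_unique[OF n'(1)[OF x(1)]] by metis
  then have "G x (N' x w) \<bullet> N x + DG x w (N x) \<bullet> N x = n' x w \<bullet> N x"
    by (simp flip: inner_add_left)
  moreover have "G x (N' x w) \<bullet> N x = n x \<bullet> N' x w"
    using G_sym[OF x(1), of "N' x w" "N x"] x(1) by (simp add: N_def)
  moreover have "n' x w \<bullet> N x = n' x (N x) \<bullet> w"
    by (rule gradient_derivative_symmetric[OF \<Omega> x(1) \<phi>_deriv n'])
  ultimately show ?thesis using 1 by (simp add: N_def)
qed

text \<open>The conormal line bundle of the level set.\<close>

definition conormals :: "('a \<times> 'a) set" where
  "conormals = {(x, p). x \<in> \<Omega> \<and> \<phi> x = 0 \<and> (\<exists>\<sigma>. p = \<sigma> *\<^sub>R n x)}"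

text \<open>Move \<open>x\<close> along the level set with the velocity that the spray prescribes and keep the covector a
  multiple of \<open>n\<close>. Then the velocity of the covector can differ from the second component of the spray
  only by a multiple of \<open>n\<close>, which a factor \<open>\<sigma> + h\<mu>\<close> corrects.\<close>

lemma spray_tangent_to_conormals:
  assumes "q \<in> conormals"
  shows "\<exists>c. c 0 = q \<and> (c has_vector_derivative spray q) (at 0) \<and> (\<forall>\<^sub>F h in at 0. c h \<in> conormals)"
proof -
  obtain x \<sigma> where q: "q = (x, \<sigma> *\<^sub>R n x)" and x: "x \<in> \<Omega>" "\<phi> x = 0"
    using assms by (auto simp: conormals_def)
  obtain n' where n': "continuous_on \<Omega> n'" "\<And>y. y \<in> \<Omega> \<Longrightarrow> (n has_derivative blinfun_apply (n' y)) (at y)"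
    using C1_onE[OF n] by blast
  define v where "v = B x (\<sigma> *\<^sub>R n x)"
  have v: "v = \<sigma> *\<^sub>R B x (n x)" by (simp add: v_def blinfun.scaleR_right)
  have nv: "n x \<bullet> v = 0" using null[OF x] by (simp add: v)
  obtain X \<epsilon> where X: "\<epsilon> > 0" "X 0 = x" "(X has_vector_derivative v) (at 0)"
    "\<And>t. t \<in> {-\<epsilon><..<\<epsilon>} \<Longrightarrow> X t \<in> \<Omega> \<and> \<phi> (X t) = 0"
    using tangent_curve[OF x, of v] nv by metis
  have "(snd (spray q) - \<sigma> *\<^sub>R n' x v) \<bullet> w = 0" if "n x \<bullet> w = 0" for w
    using conormal_transport[OF x that n'(2,1)] unfolding q
    by (simp add: spray_snd_inner inner_diff_left v[unfolded v_def] blinfun.scaleR_right v)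
  then obtain \<mu> where \<mu>: "snd (spray q) - \<sigma> *\<^sub>R n' x v = \<mu> *\<^sub>R n x"
    using parallel_if_orthogonal_complement[OF n_nonzero[OF x(1)]] by blast
  define c where "c h = (X h, (\<sigma> + h * \<mu>) *\<^sub>R n (X h))" for h
  have "((\<lambda>h. n (X h)) has_vector_derivative n' x v) (at 0)"
    using has_vector_derivative_composed[OF X(3), of n] n'(2)[OF x(1)] X(2) by simp
  then have "((\<lambda>h. (\<sigma> + h * \<mu>) *\<^sub>R n (X h)) has_vector_derivative (\<sigma> + 0 * \<mu>) *\<^sub>R n' x v + \<mu> *\<^sub>R n (X 0)) (at 0)"
    by (intro has_vector_derivative_scaleR) (auto intro!: derivative_eq_intros)
  then have "((\<lambda>h. (\<sigma> + h * \<mu>) *\<^sub>R n (X h)) has_vector_derivative snd (spray q)) (at 0)"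
    using \<mu> X(2) by (simp add: algebra_simps)
  from has_vector_derivative_Pair[OF X(3) this]
  have "(c has_vector_derivative spray q) (at 0)" unfolding c_def by (simp add: spray_def q v_def)
  moreover have "\<forall>\<^sub>F h in at 0. c h \<in> conormals"
  proof -
    have "\<forall>\<^sub>F t in at 0. t \<in> {-\<epsilon><..<\<epsilon>}"
      using X(1) by (intro eventually_at_in_open') auto
    then show ?thesis by eventually_elim (use X(4) in \<open>auto simp: c_def conormals_def\<close>)
  qed
  ultimately show ?thesis using X(2) by (intro exI[of _ c]) (simp add: c_def q)
qed

text \<open>Parametrised by \<open>(x, \<sigma>)\<close>, the spray on the conormal bundle is only continuous in the second component, since the
  multiplier \<open>\<mu>\<close> above involves second derivatives of \<open>\<phi>\<close>. The flow is therefore taken in the ambient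
  space, where it is \<open>C\<^sup>1\<close>, and preserves the bundle by Nagumo's theorem.\<close>

lemma conormal_flow:
  obtains \<epsilon> r \<Phi> where "\<epsilon> > 0" "r > 0"
    "C1_on ({-\<epsilon><..<\<epsilon>} \<times> ball (z, s *\<^sub>R n z) r) (\<lambda>(t, q). \<Phi> t q)"
    "\<And>q. q \<in> ball (z, s *\<^sub>R n z) r \<Longrightarrow> \<Phi> 0 q = q"
    "\<And>t q. \<bar>t\<bar> < \<epsilon> \<Longrightarrow> q \<in> ball (z, s *\<^sub>R n z) r \<Longrightarrow> fst (\<Phi> t q) \<in> \<Omega>"
    "\<And>t q. \<bar>t\<bar> < \<epsilon> \<Longrightarrow> q \<in> ball (z, s *\<^sub>R n z) r \<Longrightarrow>
       ((\<lambda>t. \<Phi> t q) has_vector_derivative spray (\<Phi> t q)) (at t)"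
    "\<And>t q. \<bar>t\<bar> < \<epsilon> \<Longrightarrow> q \<in> ball (z, s *\<^sub>R n z) r \<Longrightarrow> q \<in> conormals \<Longrightarrow> \<Phi> t q \<in> conormals"
proof -
  let ?q = "(z, s *\<^sub>R n z)"
  have op: "open (\<Omega> \<times> (UNIV :: 'a set))" "?q \<in> \<Omega> \<times> UNIV" using \<Omega> z by (auto intro: open_Times)
  obtain \<epsilon>0 r0 \<Phi> where \<Phi>: "\<epsilon>0 > 0" "r0 > 0" "C1_on ({-\<epsilon>0<..<\<epsilon>0} \<times> ball ?q r0) (\<lambda>(t, q). \<Phi> t q)"
    "\<And>q. q \<in> ball ?q r0 \<Longrightarrow> \<Phi> 0 q = q"
    "\<And>t q. \<bar>t\<bar> < \<epsilon>0 \<Longrightarrow> q \<in> ball ?q r0 \<Longrightarrow> \<Phi> t q \<in> \<Omega> \<times> UNIV \<and>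
       ((\<lambda>t. \<Phi> t q) has_vector_derivative spray (\<Phi> t q)) (at t)"
    using local_flow[OF op(1) spray_C1 op(2)] by metis
  obtain R where R: "R > 0" "cball z R \<subseteq> \<Omega>" using \<Omega> z(1) open_contains_cball by blast
  have ball_sub: "fst q \<in> cball z R" if "q \<in> cball ?q R" for q
    using that dist_fst_le[of ?q q] by (auto simp: dist_commute)
  obtain V' where V': "continuous_on (\<Omega> \<times> UNIV) V'" "\<And>q. q \<in> \<Omega> \<times> UNIV \<Longrightarrow> (spray has_derivative blinfun_apply (V' q)) (at q)"
    using C1_onE[OF spray_C1] by blast
  have sub: "cball ?q R \<subseteq> \<Omega> \<times> UNIV" 
  proof
    fix q assume "q \<in> cball ?q R"
    then have "fst q \<in> \<Omega>" using ball_sub R(2) by blast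
    then show "q \<in> \<Omega> \<times> UNIV" by (simp add: mem_Times_iff)
  qed
  have V'R: "continuous_on (cball ?q R) V'" "\<And>q. q \<in> cball ?q R \<Longrightarrow> (spray has_derivative blinfun_apply (V' q)) (at q)"
    using continuous_on_subset[OF V'(1) sub] V'(2)[OF subsetD[OF sub]] by -
  obtain K where K: "\<And>p q. p \<in> cball ?q R \<Longrightarrow> q \<in> cball ?q R \<Longrightarrow> norm (spray p - spray q) \<le> K * norm (p - q)"
  proof (rule C1_on_compact_bounds[OF V'R compact_cball convex_cball])
    fix K assume "\<And>x y. x \<in> cball ?q R \<Longrightarrow> y \<in> cball ?q R \<Longrightarrow> norm (spray x - spray y) \<le> K * norm (x - y)"
    then show thesis by (rule that)
  qed
  \<comment> \<open>The bundle over a compact ball is closed, which invariance requires.\<close>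
  define N where "N = {q \<in> conormals. fst q \<in> cball z R}"
  have N_eq: "N = {q \<in> cball z R \<times> UNIV. \<phi> (fst q) = 0 \<and>
      (n (fst q) \<bullet> n (fst q)) *\<^sub>R snd q - (snd q \<bullet> n (fst q)) *\<^sub>R n (fst q) = 0}" (is "_ = ?N")
  proof (intro equalityI subsetI)
    fix q assume "q \<in> N"
    then show "q \<in> ?N" by (auto simp: N_def conormals_def)
  next
    fix q assume q: "q \<in> ?N"
    then have x: "fst q \<in> \<Omega>" using R by auto
    have "snd q = (1 / (n (fst q) \<bullet> n (fst q))) *\<^sub>R ((n (fst q) \<bullet> n (fst q)) *\<^sub>R snd q)"
      using n_nonzero[OF x] by simp
    also have "(n (fst q) \<bullet> n (fst q)) *\<^sub>R snd q = (snd q \<bullet> n (fst q)) *\<^sub>R n (fst q)" using q by simp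
    finally have "snd q = ((snd q \<bullet> n (fst q)) / (n (fst q) \<bullet> n (fst q))) *\<^sub>R n (fst q)" by simp
    then show "q \<in> N" using q x by (auto simp: N_def conormals_def)
  qed
  have "closed N"
  proof -
    have "continuous_on (cball z R) n" "continuous_on (cball z R) \<phi>"
      using C1_on_imp_continuous_on[OF n] R(2) continuous_on_subset
        has_derivative_continuous[OF \<phi>_deriv] by (blast, meson continuous_at_imp_continuous_on subsetD)
    then have "continuous_on (cball z R \<times> UNIV) (\<lambda>q::'a \<times> 'a. n (fst q))"
      "continuous_on (cball z R \<times> UNIV) (\<lambda>q::'a \<times> 'a. \<phi> (fst q))"
      by (auto intro!: continuous_on_compose2[of "cball z R" _ _ fst] continuous_intros)
    then have "closed {q \<in> cball z R \<times> UNIV. (\<phi> (fst q),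
      (n (fst q) \<bullet> n (fst q)) *\<^sub>R snd q - (snd q \<bullet> n (fst q)) *\<^sub>R n (fst q)) = (0, 0)}"
      by (intro continuous_closed_preimage_constant continuous_intros closed_Times) auto
    then show ?thesis unfolding N_eq by simp
  qed
  have qN: "?q \<in> N" using z R by (auto simp: N_def conormals_def)
  have tangent: "\<exists>c. c 0 = p \<and> (c has_vector_derivative spray p) (at 0) \<and> (\<forall>\<^sub>F h in at 0. c h \<in> N)"
    if p: "p \<in> N" "p \<in> ball ?q R" for p
  proof -
    obtain c where c: "c 0 = p" "(c has_vector_derivative spray p) (at 0)" "\<forall>\<^sub>F h in at 0. c h \<in> conormals"
      using spray_tangent_to_conormals[of p] p by (auto simp: N_def)
    have "(c \<longlongrightarrow> c 0) (at 0)"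
      using has_vector_derivative_continuous[OF c(2)] by (simp add: isCont_def)
    then have "\<forall>\<^sub>F h in at 0. c h \<in> ball ?q R"
      by (rule topological_tendstoD) (use c(1) p(2) in auto)
    with c(3) have "\<forall>\<^sub>F h in at 0. c h \<in> N"
      by eventually_elim (use ball_sub in \<open>auto simp: N_def\<close>)
    then show ?thesis using c by blast
  qed
  have "continuous_on ({-\<epsilon>0<..<\<epsilon>0} \<times> ball ?q r0) (\<lambda>(t, q). \<Phi> t q)" by (rule C1_on_imp_continuous_on[OF \<Phi>(3)])
  then have "open (({-\<epsilon>0<..<\<epsilon>0} \<times> ball ?q r0) \<inter> (\<lambda>(t, q). \<Phi> t q) -` ball ?q (R / 2))"
    by (rule continuous_open_preimage) (auto intro: open_Times)
  moreover have "(0, ?q) \<in> ({-\<epsilon>0<..<\<epsilon>0} \<times> ball ?q r0) \<inter> (\<lambda>(t, q). \<Phi> t q) -` ball ?q (R / 2)"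
    using \<Phi> R(1) by auto
  ultimately obtain A A' where A: "open A" "open A'" "0 \<in> A" "?q \<in> A'"
    "A \<times> A' \<subseteq> ({-\<epsilon>0<..<\<epsilon>0} \<times> ball ?q r0) \<inter> (\<lambda>(t, q). \<Phi> t q) -` ball ?q (R / 2)"
    by (rule open_prod_elim) auto
  obtain \<epsilon> where \<epsilon>: "\<epsilon> > 0" "ball 0 \<epsilon> \<subseteq> A" using A by (meson openE)
  obtain r where r: "r > 0" "ball ?q r \<subseteq> A'" using A by (meson openE)
  have in0: "\<bar>t\<bar> < \<epsilon>0 \<and> q \<in> ball ?q r0 \<and> \<Phi> t q \<in> ball ?q (R / 2)" if "\<bar>t\<bar> < \<epsilon>" "q \<in> ball ?q r" for t q
  proof -
    have "t \<in> ball 0 \<epsilon>" using that(1) by (simp add: dist_real_def)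
    then have "(t, q) \<in> A \<times> A'" using that(2) \<epsilon>(2) r(2) by blast
    then have "(t, q) \<in> {-\<epsilon>0<..<\<epsilon>0} \<times> ball ?q r0" "\<Phi> t q \<in> ball ?q (R / 2)" using A(5) by auto
    then show ?thesis by (simp add: abs_less_iff)
  qed
  show thesis
  proof (rule that[OF \<epsilon>(1) r(1), of \<Phi>])
    show "C1_on ({-\<epsilon><..<\<epsilon>} \<times> ball ?q r) (\<lambda>(t, q). \<Phi> t q)"
    proof (rule C1_on_subset[OF \<Phi>(3)], rule subsetI)
      fix p assume "p \<in> {-\<epsilon><..<\<epsilon>} \<times> ball ?q r"
      then show "p \<in> {-\<epsilon>0<..<\<epsilon>0} \<times> ball ?q r0" using in0[of "fst p" "snd p"] by (auto simp: mem_Times_iff abs_less_iff)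
    qed
    show "\<Phi> 0 q = q" if "q \<in> ball ?q r" for q using in0[of 0 q] that \<epsilon>(1) \<Phi>(4) by simp
    fix t q assume tq: "\<bar>t\<bar> < \<epsilon>" "q \<in> ball ?q r"
    show "fst (\<Phi> t q) \<in> \<Omega>" "((\<lambda>t. \<Phi> t q) has_vector_derivative spray (\<Phi> t q)) (at t)"
      using \<Phi>(5)[of t q] in0[OF tq] by (auto simp: mem_Times_iff)
    assume q: "q \<in> conormals"
    have "\<Phi> t q \<in> N"
    proof (rule tangent_set_invariant[OF \<open>closed N\<close> qN _ tangent, where K = K and \<epsilon> = \<epsilon>])
      show "norm (spray x - spray y) \<le> K * norm (x - y)" if "x \<in> ball ?q R" "y \<in> ball ?q R" for x y
        by (rule K) (use that in auto)
      show "((\<lambda>t. \<Phi> t q) has_vector_derivative spray (\<Phi> t q)) (at t)" if "\<bar>t\<bar> < \<epsilon>" for t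
        using \<Phi>(5)[of t q] in0[OF that tq(2)] by auto
      show "\<Phi> t q \<in> ball ?q (R / 2)" if "\<bar>t\<bar> < \<epsilon>" for t using in0[OF that tq(2)] by auto
      have "\<Phi> 0 q = q" using in0[of 0 q] tq \<epsilon>(1) \<Phi>(4) by simp
      moreover have "q \<in> ball ?q (R / 2)" using in0[of 0 q] tq \<epsilon>(1) \<open>\<Phi> 0 q = q\<close> by simp
      then have "fst q \<in> cball z R" using R(1) by (intro ball_sub) auto
      ultimately show "\<Phi> 0 q \<in> N" using q by (simp add: N_def)
    qed (use tq in auto)
    then show "\<Phi> t q \<in> conormals" by (simp add: N_def)
  qed
qed

end

context null_level_set begin

text \<open>The last equation is the geodesic equation for \<open>\<gamma>\<close>, lowered with the metric: \<open>a\<close> is the acceleration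
  of \<open>\<gamma>\<close> in coordinates. The field \<open>l\<close> consists of the velocities of the geodesics that start on a slice of
  the level set with momentum \<open>s n\<close>. To see that it is \<open>C\<^sup>1\<close>, these geodesics are made into a local
  diffeomorphism \<open>F\<close> in the coordinates \<open>\<psi>\<close>, whose derivative at \<open>\<psi> z\<close> is the identity.\<close>

theorem geodesic_conormal_field:
  obtains W l where "open W" "z \<in> W" "W \<subseteq> \<Omega>" "C1_on W l" "l z = s *\<^sub>R B z (n z)"
    "\<And>x. x \<in> W \<Longrightarrow> \<phi> x = 0 \<Longrightarrow> \<exists>\<sigma>. l x = \<sigma> *\<^sub>R B x (n x)"
    "\<And>x. x \<in> W \<Longrightarrow> \<phi> x = 0 \<Longrightarrow> \<exists>\<gamma> a. \<gamma> 0 = x \<and> (\<gamma> has_vector_derivative l x) (at 0) \<and>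
        (\<forall>\<^sub>F h in at 0. \<gamma> h \<in> W \<and> \<phi> (\<gamma> h) = 0) \<and>
        ((\<lambda>h. l (\<gamma> h)) has_vector_derivative a) (at 0) \<and>
        (\<forall>w. G x a \<bullet> w + DG x (l x) (l x) \<bullet> w = (1/2) * (DG x w (l x) \<bullet> l x))"
proof -
  obtain \<epsilon> r \<Phi> where \<epsilon>: "\<epsilon> > 0" and r: "r > 0"
    and \<Phi>C: "C1_on ({-\<epsilon><..<\<epsilon>} \<times> ball (z, s *\<^sub>R n z) r) (\<lambda>(t, q). \<Phi> t q)"
    and \<Phi>0: "\<And>q. q \<in> ball (z, s *\<^sub>R n z) r \<Longrightarrow> \<Phi> 0 q = q"
    and \<Phi>\<Omega>: "\<And>t q. \<bar>t\<bar> < \<epsilon> \<Longrightarrow> q \<in> ball (z, s *\<^sub>R n z) r \<Longrightarrow> fst (\<Phi> t q) \<in> \<Omega>"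
    and \<Phi>': "\<And>t q. \<bar>t\<bar> < \<epsilon> \<Longrightarrow> q \<in> ball (z, s *\<^sub>R n z) r \<Longrightarrow>
       ((\<lambda>t. \<Phi> t q) has_vector_derivative spray (\<Phi> t q)) (at t)"
    and \<Phi>N: "\<And>t q. \<bar>t\<bar> < \<epsilon> \<Longrightarrow> q \<in> ball (z, s *\<^sub>R n z) r \<Longrightarrow> q \<in> conormals \<Longrightarrow> \<Phi> t q \<in> conormals"
    using conormal_flow by blast
  let ?p = "(z, s *\<^sub>R n z)"
  define v0 where "v0 = B z (s *\<^sub>R n z)"
  define a where "a = frechet_derivative \<psi> (at z) v0"
  define q0 where "q0 = \<psi> z"
  define \<psi>i' where "\<psi>i' = frechet_derivative \<psi>i (at q0)"
  define \<psi>' where "\<psi>' = frechet_derivative \<psi> (at z)"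
  have \<psi>': "(\<psi> has_derivative \<psi>') (at z)" unfolding \<psi>'_def by (rule \<psi>_deriv[OF z(1)])
  have \<psi>i': "(\<psi>i has_derivative \<psi>i') (at q0)" unfolding \<psi>i'_def q0_def by (rule \<psi>i_deriv[OF z(1)])
  interpret \<psi>': bounded_linear \<psi>' by (rule has_derivative_bounded_linear[OF \<psi>'])
  interpret \<psi>i': bounded_linear \<psi>i' by (rule has_derivative_bounded_linear[OF \<psi>i'])
  have \<psi>\<psi>i: "\<psi>' (\<psi>i' w) = w" for w
    unfolding \<psi>'_def \<psi>i'_def q0_def by (rule chart_derivatives_right_inverse[OF z(1)])
  have q0b: "q0 \<bullet> b = 0" using b(2)[OF z(1)] z(2) by (simp add: q0_def)
  have ab: "a \<bullet> b = 0"
    unfolding a_def chart_derivative_normal[OF z(1)] v0_def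
    using null[OF z] by (simp add: blinfun.scaleR_right)
  have v0a: "\<psi>i' a = v0" "\<psi>' v0 = a"
    unfolding \<psi>i'_def q0_def a_def \<psi>'_def by (simp_all add: chart_derivatives_left_inverse[OF z(1)])
  have "v0 \<noteq> 0"
  proof
    assume "v0 = 0"
    then have "G z v0 = 0" by simp
    then show False using n_nonzero[OF z(1)] s by (simp add: v0_def z(1))
  qed
  then have a0: "a \<bullet> a \<noteq> 0" using v0a \<psi>i'.zero by force
  \<comment> \<open>\<open>\<pi>\<close> projects to the hyperplane that represents the level set, \<open>T\<close> is the time coordinate in the
     direction \<open>a\<close> of the initial geodesic, and \<open>P\<close> projects along \<open>a\<close> to the slice \<open>T = 0\<close>. A point \<open>y\<close> of the hyperplane is
     sent to time \<open>T y\<close> on the geodesic from \<open>P y\<close>, whose initial state is \<open>J (P y)\<close>.\<close>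
  define \<pi> where "\<pi> y = y - (y \<bullet> b) *\<^sub>R b" for y
  define T where "T y = ((y - q0) \<bullet> a) / (a \<bullet> a)" for y
  define P where "P y = y - T y *\<^sub>R a" for y
  define J where "J y = (\<psi>i y, s *\<^sub>R n (\<psi>i y))" for y
  have \<pi>C: "C1_on S \<pi>" for S
    unfolding \<pi>_def by (intro C1_on_diff C1_on_scaleR C1_on_inner C1_on_id C1_on_const)
  have TC: "C1_on S T" for S
    unfolding T_def divide_inverse by (intro C1_on_mult C1_on_diff C1_on_inner C1_on_id C1_on_const)
  have PC: "C1_on S P" for S
    unfolding P_def by (intro C1_on_diff C1_on_scaleR TC C1_on_id C1_on_const)
  have T\<pi>C: "C1_on S (\<lambda>y. T (\<pi> y))" "C1_on S (\<lambda>y. P (\<pi> y))" for S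
    by (rule C1_on_compose[OF TC[of UNIV] \<pi>C], simp) (rule C1_on_compose[OF PC[of UNIV] \<pi>C], simp)
  have \<psi>i\<Omega>: "\<psi>i y \<in> \<Omega>" if "y \<in> \<psi> ` \<Omega>" for y using that \<psi>(4) by auto
  have JC: "C1_on (\<psi> ` \<Omega>) J"
    unfolding J_def by (intro C1_on_Pair C1_on_scaleR C1_on_const \<psi>(3) C1_on_compose[OF n \<psi>(3) \<psi>i\<Omega>])
  define U1 where "U1 = (\<lambda>y. P (\<pi> y)) -` (\<psi> ` \<Omega>)"
  have U1: "open U1"
    unfolding U1_def by (rule open_vimage[OF \<psi>(2) C1_on_imp_continuous_on[OF T\<pi>C(2)]])
  define I where "I y = (T (\<pi> y), J (P (\<pi> y)))" for y
  have IC: "C1_on U1 I"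
    unfolding I_def by (intro C1_on_Pair T\<pi>C C1_on_compose[OF JC T\<pi>C(2)]) (simp add: U1_def)
  let ?D = "{-\<epsilon><..<\<epsilon>} \<times> ball ?p r"
  define U where "U = U1 \<inter> I -` ?D"
  have U: "open U" unfolding U_def
    by (rule continuous_open_preimage[OF C1_on_imp_continuous_on[OF IC] U1]) (auto intro: open_Times)
  define Q where "Q y = (case I y of (t, q) \<Rightarrow> \<Phi> t q)" for y
  have QC: "C1_on U Q"
    unfolding Q_def by (rule C1_on_compose[OF \<Phi>C C1_on_subset[OF IC]]) (auto simp: U_def)
  have Q\<Omega>: "fst (Q y) \<in> \<Omega>" if "y \<in> U" for y
    using that \<Phi>\<Omega>[of "fst (I y)" "snd (I y)"] by (auto simp: U_def Q_def split_beta mem_Times_iff)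
  \<comment> \<open>The last summand makes \<open>F\<close> a local diffeomorphism of the full space which preserves the \<open>b\<close>-coordinate, so
     that its inverse also maps the hyperplane into itself and every nearby point of the level set
     lies on one of the geodesics.\<close>
  define F where "F y = \<psi> (fst (Q y)) + (y \<bullet> b) *\<^sub>R b" for y
  have FC: "C1_on U F"
    unfolding F_def
    by (intro C1_on_add C1_on_scaleR C1_on_inner C1_on_id C1_on_const C1_on_compose[OF \<psi>(1) C1_on_fst[OF QC]] Q\<Omega>)
  have \<pi>q0: "\<pi> q0 = q0" "T q0 = 0" "P q0 = q0" using q0b by (simp_all add: \<pi>_def T_def P_def)
  have Jq0: "J q0 = ?p" using z(1) by (simp add: J_def q0_def \<psi>(4))
  have Iq0: "I q0 = (0, ?p)" by (simp add: I_def \<pi>q0 Jq0)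
  have q0U: "q0 \<in> U" using z(1) \<epsilon> r by (simp add: U_def U1_def \<pi>q0 Iq0) (simp add: q0_def)
  have Qq0: "Q q0 = ?p" using \<Phi>0[of ?p] r by (simp add: Q_def Iq0)
  have Fq0: "F q0 = q0" by (simp add: F_def Qq0 q0b) (simp add: q0_def)
  have FD: "(F has_derivative (\<lambda>h. h)) (at q0)"
  proof -
    obtain D where D: "((\<lambda>(t, q). \<Phi> t q) has_derivative blinfun_apply D) (at (0, ?p))"
      using C1_onE[OF \<Phi>C] \<epsilon> r by (metis (no_types, lifting) SigmaI centre_in_ball greaterThanLessThan_iff neg_less_0_iff_less)
    have Dt: "D (1, 0) = spray ?p"
    proof -
      have "((\<lambda>t. (t, ?p)) has_vector_derivative (1, 0)) (at 0)"
        by (auto intro!: derivative_eq_intros has_vector_derivative_Pair)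
      from has_vector_derivative_composed[OF this D]
      have "((\<lambda>t. \<Phi> t ?p) has_vector_derivative D (1, 0)) (at 0)" by simp
      moreover have "((\<lambda>t. \<Phi> t ?p) has_vector_derivative spray ?p) (at 0)"
        using \<Phi>'[of 0 ?p] \<Phi>0[of ?p] \<epsilon> r by simp
      ultimately show ?thesis by (rule vector_derivative_unique_at)
    qed
    have Dq: "D (0, h) = h" for h
    proof -
      have "((\<lambda>q. (0, q)) has_derivative (\<lambda>h. (0, h))) (at ?p)"
        by (auto intro!: derivative_eq_intros)
      from has_derivative_compose[OF this D]
      have "(\<Phi> 0 has_derivative (\<lambda>h. D (0, h))) (at ?p)" by simp
      moreover have "(\<Phi> 0 has_derivative (\<lambda>h. h)) (at ?p)"
        by (rule has_derivative_transform_within_open[OF has_derivative_ident open_ball[of ?p r]]) (use r \<Phi>0 in auto)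
      ultimately have "(\<lambda>h. D (0, h)) = (\<lambda>h. h)" by (rule has_derivative_unique)
      then show ?thesis by (rule fun_cong)
    qed
    have D_eq: "D (t, h) = t *\<^sub>R spray ?p + h" for t h
    proof -
      have "(t, h) = t *\<^sub>R (1, 0) + (0, h)" by simp
      then show ?thesis by (simp only: blinfun.add_right blinfun.scaleR_right Dt Dq)
    qed
    define T' where "T' h = (h \<bullet> a) / (a \<bullet> a)" for h
    have dT: "(T has_derivative T') (at q0)"
      unfolding T_def T'_def using a0 by (auto intro!: derivative_eq_intros)
    have d\<pi>: "(\<pi> has_derivative \<pi>) (at q0)"
      unfolding \<pi>_def by (auto intro!: derivative_eq_intros)
    have dP: "(P has_derivative (\<lambda>h. h - T' h *\<^sub>R a)) (at q0)"
      unfolding P_def by (auto intro!: derivative_eq_intros dT)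
    obtain n' where dn: "(n has_derivative n') (at (\<psi>i q0))"
      using C1_on_has_frechet_derivative[OF n z(1)] \<psi>(4)[OF z(1)] by (auto simp: q0_def)
    have dJ: "(J has_derivative (\<lambda>h. (\<psi>i' h, s *\<^sub>R n' (\<psi>i' h)))) (at q0)"
      unfolding J_def
      by (intro has_derivative_Pair has_derivative_scaleR_right \<psi>i' has_derivative_compose[OF \<psi>i' dn])
    have dP\<pi>: "((\<lambda>y. P (\<pi> y)) has_derivative (\<lambda>h. \<pi> h - T' (\<pi> h) *\<^sub>R a)) (at q0)"
      by (rule has_derivative_compose[OF d\<pi>]) (simp add: \<pi>q0 dP)
    have dT\<pi>: "((\<lambda>y. T (\<pi> y)) has_derivative (\<lambda>h. T' (\<pi> h))) (at q0)"
      by (rule has_derivative_compose[OF d\<pi>]) (simp add: \<pi>q0 dT)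
    have dJP: "((\<lambda>y. J (P (\<pi> y))) has_derivative
        (\<lambda>h. (\<psi>i' (\<pi> h - T' (\<pi> h) *\<^sub>R a), s *\<^sub>R n' (\<psi>i' (\<pi> h - T' (\<pi> h) *\<^sub>R a))))) (at q0)"
      by (rule has_derivative_compose[OF dP\<pi>]) (simp add: \<pi>q0 dJ)
    have "(I has_derivative (\<lambda>h. (T' (\<pi> h), (\<psi>i' (\<pi> h - T' (\<pi> h) *\<^sub>R a), s *\<^sub>R n' (\<psi>i' (\<pi> h - T' (\<pi> h) *\<^sub>R a)))))) (at q0)"
      unfolding I_def by (rule has_derivative_Pair[OF dT\<pi> dJP])
    from has_derivative_compose[OF this, of "\<lambda>(t, q). \<Phi> t q" "blinfun_apply D"] D
    have "(Q has_derivative (\<lambda>h. D (T' (\<pi> h), (\<psi>i' (\<pi> h - T' (\<pi> h) *\<^sub>R a), s *\<^sub>R n' (\<psi>i' (\<pi> h - T' (\<pi> h) *\<^sub>R a)))))) (at q0)"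
      unfolding Q_def Iq0 by simp
    from has_derivative_fst[OF this]
    have "((\<lambda>y. fst (Q y)) has_derivative (\<lambda>h. T' (\<pi> h) *\<^sub>R v0 + \<psi>i' (\<pi> h - T' (\<pi> h) *\<^sub>R a))) (at q0)"
      by (simp add: D_eq spray_def v0_def)
    moreover have "T' (\<pi> h) *\<^sub>R v0 + \<psi>i' (\<pi> h - T' (\<pi> h) *\<^sub>R a) = \<psi>i' (\<pi> h)" for h
      by (simp add: \<psi>i'.diff \<psi>i'.scaleR v0a)
    ultimately have "((\<lambda>y. fst (Q y)) has_derivative (\<lambda>h. \<psi>i' (\<pi> h))) (at q0)" by simp
    from has_derivative_compose[OF this, of \<psi> \<psi>'] \<psi>'
    have "((\<lambda>y. \<psi> (fst (Q y))) has_derivative \<pi>) (at q0)" by (simp add: Qq0 \<psi>\<psi>i)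
    then have "(F has_derivative (\<lambda>h. \<pi> h + (h \<bullet> b) *\<^sub>R b)) (at q0)"
      unfolding F_def by (auto intro!: derivative_eq_intros)
    then show ?thesis by (simp add: \<pi>_def)
  qed
  obtain U' W' g where U': "open U'" "U' \<subseteq> U" "q0 \<in> U'" "open W'" "F q0 \<in> W'" "homeomorphism U' W' F g" "C1_on W' g"
    using C1_local_inverse[OF U FC q0U FD] by blast
  have g: "g (F y) = y" "F y \<in> W'" if "y \<in> U'" for y
    using U'(6) that by (auto simp: homeomorphism_def)
  have Fg: "F (g w) = w" "g w \<in> U'" if "w \<in> W'" for w
    using U'(6) that by (auto simp: homeomorphism_def)
  define W where "W = \<Omega> \<inter> \<psi> -` W'"
  define l where "l x = fst (spray (Q (g (\<psi> x))))" for x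
  \<comment> \<open>Each point of the level set is reached by a geodesic from the slice, with momentum a multiple of \<open>n\<close>.\<close>
  have leaf: "y \<bullet> b = 0 \<and> x = fst (Q y) \<and> Q y \<in> conormals \<and> J (P (\<pi> y)) \<in> conormals" if x: "x \<in> W" "\<phi> x = 0" "y = g (\<psi> x)" for x y
  proof -
    have y: "y \<in> U'" "F y = \<psi> x" using x Fg by (auto simp: W_def)
    have yU: "y \<in> U" using y U' by auto
    have "P (\<pi> y) \<bullet> b = 0"
      using b(1) by (simp add: P_def \<pi>_def inner_diff_left ab)
    moreover obtain x' where x': "x' \<in> \<Omega>" "P (\<pi> y) = \<psi> x'" using yU by (auto simp: U_def U1_def)
    ultimately have "\<phi> x' = 0" by (simp add: b(2))
    then have JN: "J (P (\<pi> y)) \<in> conormals" using x' by (auto simp: J_def \<psi>(4) conormals_def)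
    then have QN: "Q y \<in> conormals"
      using yU by (auto simp: Q_def I_def U_def intro!: \<Phi>N)
    then have "\<psi> (fst (Q y)) \<bullet> b = 0" by (auto simp: conormals_def b(2))
    moreover have "\<psi> x \<bullet> b = 0" using x b(2)[of x] by (simp add: W_def)
    ultimately have yb: "y \<bullet> b = 0" using y(2) b(1) by (simp add: F_def[of y] inner_add_left flip: y(2))
    then have "\<psi> (fst (Q y)) = \<psi> x" using y(2) by (simp add: F_def)
    then have "fst (Q y) = x" using \<psi>(4) Q\<Omega>[OF yU] x(1) by (metis IntD1 W_def)
    then show ?thesis using yb QN JN by simp
  qed
  show thesis
  proof (rule that[of W l])
    show "open W" unfolding W_def
      by (rule continuous_open_preimage[OF C1_on_imp_continuous_on[OF \<psi>(1)] \<Omega> U'(4)])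
    show "W \<subseteq> \<Omega>" by (simp add: W_def)
    show "z \<in> W" using z(1) U'(5) Fq0 by (simp add: W_def q0_def)
    have "C1_on W (\<lambda>x. g (\<psi> x))"
      by (rule C1_on_compose[OF U'(7) C1_on_subset[OF \<psi>(1)]]) (auto simp: W_def)
    then have "C1_on W (\<lambda>x. Q (g (\<psi> x)))"
      by (rule C1_on_compose[OF QC]) (use Fg U'(2) in \<open>auto simp: W_def\<close>)
    then have "C1_on W (\<lambda>x. spray (Q (g (\<psi> x))))"
      by (rule C1_on_compose[OF spray_C1]) (use Fg U'(2) Q\<Omega> in \<open>auto simp: W_def mem_Times_iff\<close>)
    then show "C1_on W l" unfolding l_def by (rule C1_on_fst)
    have "g (\<psi> z) = q0" using g(1)[OF U'(3)] Fq0 by (simp add: q0_def)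
    then show "l z = s *\<^sub>R B z (n z)" by (simp add: l_def Qq0 spray_def blinfun.scaleR_right)
    fix x assume x: "x \<in> W" "\<phi> x = 0"
    define y where "y = g (\<psi> x)"
    note lf = leaf[OF x y_def]
    have "Q y \<in> conormals" "fst (Q y) = x" using lf by simp_all
    then obtain \<sigma> where "snd (Q y) = \<sigma> *\<^sub>R n x" unfolding conormals_def case_prod_unfold by blast
    with \<open>fst (Q y) = x\<close> have \<sigma>: "Q y = (x, \<sigma> *\<^sub>R n x)" by (simp add: prod_eq_iff)
    have lx: "l x = B x (\<sigma> *\<^sub>R n x)" by (simp add: l_def \<sigma> spray_def flip: y_def)
    then show "\<exists>\<sigma>. l x = \<sigma> *\<^sub>R B x (n x)" by (auto simp: blinfun.scaleR_right)
    have x\<Omega>: "x \<in> \<Omega>" using x(1) by (simp add: W_def)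
    have yU': "y \<in> U'" using x(1) Fg by (auto simp: W_def y_def)
    then have yU: "y \<in> U" using U'(2) by blast
    define q where "q = J (P (\<pi> y))"
    have \<pi>y: "\<pi> y = y" using lf by (simp add: \<pi>_def)
    define t where "t = T y"
    have tq: "\<bar>t\<bar> < \<epsilon>" "q \<in> ball ?p r" using yU by (auto simp: U_def I_def q_def t_def \<pi>y)
    \<comment> \<open>Moving along \<open>a\<close> in coordinates only changes the time, so it follows one geodesic.\<close>
    have yh: "I (y + h *\<^sub>R a) = (t + h, q)" "(y + h *\<^sub>R a) \<bullet> b = 0" for h
    proof -
      show yhb: "(y + h *\<^sub>R a) \<bullet> b = 0" using lf ab by (simp add: inner_add_left)
      have "T (y + h *\<^sub>R a) = t + h" using a0 by (simp add: T_def t_def field_simps inner_simps)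
      moreover from this have "P (y + h *\<^sub>R a) = P y" by (simp add: P_def t_def algebra_simps)
      moreover have "\<pi> (y + h *\<^sub>R a) = y + h *\<^sub>R a" using yhb by (simp add: \<pi>_def)
      ultimately show "I (y + h *\<^sub>R a) = (t + h, q)" by (simp add: I_def q_def \<pi>y)
    qed
    define c where "c h = \<Phi> (t + h) q" for h
    have Qc: "Q (y + h *\<^sub>R a) = c h" for h by (simp add: Q_def yh c_def)
    have c0: "c 0 = (x, \<sigma> *\<^sub>R n x)" using Qc[of 0] \<sigma> by simp
    have "((\<lambda>h. t + h) has_vector_derivative 1) (at 0)" by (auto intro!: derivative_eq_intros)
    from vector_diff_chain_at[OF this, of "\<lambda>t. \<Phi> t q" "spray (\<Phi> t q)"] \<Phi>'[OF tq]
    have c': "(c has_vector_derivative spray (c 0)) (at 0)" by (simp add: o_def c_def[abs_def])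
    define \<gamma> where "\<gamma> h = fst (c h)" for h
    have "((\<lambda>h. y + h *\<^sub>R a) \<longlongrightarrow> y) (at 0)" by (auto intro!: tendsto_eq_intros)
    then have ev: "\<forall>\<^sub>F h in at 0. y + h *\<^sub>R a \<in> U'"
      by (rule topological_tendstoD) (use U' yU' in auto)
    have step: "\<gamma> h \<in> W \<and> \<phi> (\<gamma> h) = 0 \<and> l (\<gamma> h) = B (\<gamma> h) (snd (c h))" if "y + h *\<^sub>R a \<in> U'" for h
    proof -
      have "F (y + h *\<^sub>R a) = \<psi> (\<gamma> h)" using yh(2) by (simp add: F_def Qc \<gamma>_def)
      then have w: "g (\<psi> (\<gamma> h)) = y + h *\<^sub>R a" "\<psi> (\<gamma> h) \<in> W'" using g[OF that] by auto
      have "\<gamma> h \<in> \<Omega>" using Q\<Omega>[of "y + h *\<^sub>R a"] that U'(2) by (auto simp: Qc \<gamma>_def)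
      then have \<gamma>W: "\<gamma> h \<in> W" using w by (simp add: W_def)
      have "I (y + h *\<^sub>R a) \<in> ?D" using that U'(2) by (auto simp: U_def)
      then have "\<bar>t + h\<bar> < \<epsilon>" unfolding yh(1) by auto
      then have "c h \<in> conormals" unfolding c_def by (rule \<Phi>N[OF _ tq(2)]) (use lf in \<open>simp add: q_def\<close>)
      then have "\<phi> (\<gamma> h) = 0" by (auto simp: conormals_def \<gamma>_def)
      then show ?thesis using \<gamma>W by (simp add: l_def w Qc spray_def) (simp add: \<gamma>_def)
    qed
    have \<gamma>0: "\<gamma> 0 = x" by (simp add: \<gamma>_def c0)
    have \<gamma>': "(\<gamma> has_vector_derivative l x) (at 0)"
      using has_vector_derivative_composed[OF c' bounded_linear.has_derivative[OF bounded_linear_fst has_derivative_ident]]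
      by (simp add: \<gamma>_def[abs_def] c0 spray_def lx)
    have evW: "\<forall>\<^sub>F h in at 0. \<gamma> h \<in> W \<and> \<phi> (\<gamma> h) = 0" using ev by eventually_elim (use step in blast)
    obtain l' where l': "(l has_derivative l') (at x)"
      using C1_on_has_frechet_derivative[OF \<open>C1_on W l\<close> x(1)] by blast
    have l\<gamma>: "((\<lambda>h. l (\<gamma> h)) has_vector_derivative l' (l x)) (at 0)"
      by (rule has_vector_derivative_composed[OF \<gamma>']) (simp add: \<gamma>0 l')
    have main: "G x (l' (l x)) \<bullet> w + DG x (l x) (l x) \<bullet> w = (1/2) * (DG x w (l x) \<bullet> l x)" for w
    proof -
      have "((\<lambda>h. G (\<gamma> h)) has_vector_derivative DG x (l x)) (at 0)"
        by (rule has_vector_derivative_composed[OF \<gamma>']) (simp add: \<gamma>0 G_deriv[OF x\<Omega>])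
      from bounded_bilinear.has_vector_derivative[OF bounded_bilinear_blinfun_apply this l\<gamma>]
      have "((\<lambda>h. G (\<gamma> h) (l (\<gamma> h))) has_vector_derivative (G x (l' (l x)) + DG x (l x) (l x))) (at 0)"
        by (simp add: \<gamma>0)
      moreover have "\<forall>\<^sub>F h in at 0. G (\<gamma> h) (l (\<gamma> h)) = snd (c h)"
        using ev by eventually_elim (use step in \<open>auto simp: W_def\<close>)
      moreover have "G (\<gamma> 0) (l (\<gamma> 0)) = snd (c 0)" by (simp add: \<gamma>0 lx c0 x\<Omega>)
      ultimately have "((\<lambda>h. snd (c h)) has_vector_derivative (G x (l' (l x)) + DG x (l x) (l x))) (at 0)"
        unfolding has_vector_derivative_def by (rule has_derivative_transform_eventually) simp
      moreover have "((\<lambda>h. snd (c h)) has_vector_derivative snd (spray (c 0))) (at 0)"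
        using has_vector_derivative_composed[OF c' bounded_linear.has_derivative[OF bounded_linear_snd has_derivative_ident]] .
      ultimately have "G x (l' (l x)) + DG x (l x) (l x) = snd (spray (c 0))"
        by (rule vector_derivative_unique_at)
      then show ?thesis using spray_snd_inner[of x "\<sigma> *\<^sub>R n x" w] by (simp add: c0 lx flip: inner_add_left)
    qed
    show "\<exists>\<gamma> a. \<gamma> 0 = x \<and> (\<gamma> has_vector_derivative l x) (at 0) \<and>
        (\<forall>\<^sub>F h in at 0. \<gamma> h \<in> W \<and> \<phi> (\<gamma> h) = 0) \<and>
        ((\<lambda>h. l (\<gamma> h)) has_vector_derivative a) (at 0) \<and>
        (\<forall>w. G x a \<bullet> w + DG x (l x) (l x) \<bullet> w = (1/2) * (DG x w (l x) \<bullet> l x))"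
      using \<gamma>0 \<gamma>' evW l\<gamma> main by blast
  qed
qed

end

section \<open>Functions of class \<open>C\<^sup>k\<close> and charts\<close>

lemma Ck_on_1_imp_C1_on:
  fixes f :: "'a::euclidean_space \<Rightarrow> 'b::real_normed_vector"
  assumes "Ck_on 1 S f"
  shows "C1_on S f"
proof -
  have f: "\<And>x. x \<in> S \<Longrightarrow> (f has_derivative frechet_derivative f (at x)) (at x)"
    "\<And>v. continuous_on S (\<lambda>x. frechet_derivative f (at x) v)"
    using assms by (auto simp: frechet_derivative_works)
  have bl: "blinfun_apply (Blinfun (frechet_derivative f (at x))) = frechet_derivative f (at x)" if "x \<in> S" for x
    by (rule bounded_linear_Blinfun_apply[OF has_derivative_bounded_linear[OF f(1)[OF that]]])
  show ?thesis
  proof (rule C1_onI)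
    show "continuous_on S (\<lambda>x. Blinfun (frechet_derivative f (at x)))"
    proof (rule continuous_on_blinfun_componentwise)
      fix i :: 'a
      show "continuous_on S (\<lambda>x. blinfun_apply (Blinfun (frechet_derivative f (at x))) i)"
        using f(2)[of i] by (rule continuous_on_eq) (simp add: bl)
    qed
  qed (use f(1) bl in auto)
qed

lemma C1_on_imp_Ck_on_1:
  assumes "C1_on S f"
  shows "Ck_on 1 S f"
proof -
  obtain f' where f': "continuous_on S f'" "\<And>x. x \<in> S \<Longrightarrow> (f has_derivative blinfun_apply (f' x)) (at x)"
    using C1_onE[OF assms] by blast
  have "continuous_on S (\<lambda>x. frechet_derivative f (at x) v)" for v
  proof (rule continuous_on_eq)
    show "continuous_on S (\<lambda>x. f' x v)"
      by (rule bounded_bilinear.continuous_on[OF bounded_bilinear_blinfun_apply f'(1) continuous_on_const])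
    show "f' x v = frechet_derivative f (at x) v" if "x \<in> S" for x
      using frechet_derivative_at[OF f'(2)[OF that]] by simp
  qed
  then show ?thesis using f'(2) by (auto intro: differentiableI)
qed

text \<open>The iterated directional derivatives of \<open>Ck_on\<close> are assembled into an operator-valued map.\<close>

lemma Ck_on_2_imp_C1_derivative:
  fixes f :: "'a::euclidean_space \<Rightarrow> 'b::real_normed_vector"
  assumes "Ck_on 2 S f"
  shows "\<exists>f'. C1_on S f' \<and> (\<forall>x\<in>S. (f has_derivative blinfun_apply (f' x)) (at x))"
proof -
  have f: "(f has_derivative frechet_derivative f (at x)) (at x)" if "x \<in> S" for x
    using assms that by (auto simp: numeral_2_eq_2 frechet_derivative_works)
  have f2: "C1_on S (\<lambda>x. frechet_derivative f (at x) v)" for v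
    using assms by (intro Ck_on_1_imp_C1_on) (auto simp: numeral_2_eq_2)
  define f' where "f' x = (\<Sum>i\<in>Basis. blinfun_scaleR_left (frechet_derivative f (at x) i) o\<^sub>L blinfun_inner_right i)" for x
  show ?thesis
  proof (intro exI conjI ballI)
    show "C1_on S f'"
      unfolding f'_def
      by (intro C1_on_sum C1_on_bounded_linear[OF bounded_bilinear.bounded_linear_left[OF bounded_bilinear_blinfun_compose]]
          C1_on_bounded_linear[OF bounded_linear_blinfun_scaleR_left] f2)
    fix x assume x: "x \<in> S"
    interpret bounded_linear "frechet_derivative f (at x)" by (rule has_derivative_bounded_linear[OF f[OF x]])
    have "blinfun_apply (f' x) h = frechet_derivative f (at x) h" for h
    proof -
      have "frechet_derivative f (at x) h = frechet_derivative f (at x) (\<Sum>i\<in>Basis. (h \<bullet> i) *\<^sub>R i)"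
        by (simp add: euclidean_representation)
      then show ?thesis
        by (simp add: f'_def blinfun.sum_left sum scaleR blinfun_inner_right.rep_eq inner_commute)
    qed
    then have "blinfun_apply (f' x) = frechet_derivative f (at x)" by (rule ext)
    then show "(f has_derivative blinfun_apply (f' x)) (at x)" using f[OF x] by simp
  qed
qed

lemma Ck_on_2_imp_C1_on:
  fixes f :: "'a::euclidean_space \<Rightarrow> 'b::real_normed_vector"
  assumes "Ck_on 2 S f"
  shows "C1_on S f"
proof -
  obtain f' where f': "C1_on S f'" "\<forall>x\<in>S. (f has_derivative blinfun_apply (f' x)) (at x)"
    using Ck_on_2_imp_C1_derivative[OF assms] by blast
  show ?thesis by (rule C1_onI[OF C1_on_imp_continuous_on[OF f'(1)]]) (rule bspec[OF f'(2)])
qed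

lemma Ck_on_2_frechet_C1:
  "Ck_on 2 S (f :: 'a::euclidean_space \<Rightarrow> _) \<Longrightarrow> C1_on S (\<lambda>x. frechet_derivative f (at x) v)"
  by (intro Ck_on_1_imp_C1_on) (auto simp: numeral_2_eq_2)

lemma frechet_derivative_eqI: "(f has_derivative f') (at x) \<Longrightarrow> frechet_derivative f (at x) = f'"
  by (rule frechet_derivative_at[symmetric])

lemma is_chart_homeomorphism:
  "is_chart c \<Longrightarrow> homeomorphism (cdom c) (cmap c ` cdom c) (cmap c) (cinv c)"
  by (simp add: is_chart_def)

lemma open_cdom: "is_chart c \<Longrightarrow> open (cdom c)" "is_chart c \<Longrightarrow> open (cmap c ` cdom c)"
  by (simp_all add: is_chart_def)

lemma cinv_cmap [simp]: "is_chart c \<Longrightarrow> p \<in> cdom c \<Longrightarrow> cinv c (cmap c p) = p"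
  by (rule homeomorphism_apply1[OF is_chart_homeomorphism])

lemma cmap_cinv [simp]: "is_chart c \<Longrightarrow> x \<in> cmap c ` cdom c \<Longrightarrow> cmap c (cinv c x) = x"
  by (rule homeomorphism_apply2[OF is_chart_homeomorphism])

lemma cinv_in [simp]: "is_chart c \<Longrightarrow> x \<in> cmap c ` cdom c \<Longrightarrow> cinv c x \<in> cdom c"
  using homeomorphism_image2[OF is_chart_homeomorphism] by blast

lemma open_chart_image:
  assumes c: "is_chart c" and V: "open V"
  shows "open (cmap c ` (V \<inter> cdom c))"
proof -
  have "cmap c ` (V \<inter> cdom c) = cmap c ` cdom c \<inter> cinv c -` V"
  proof (intro equalityI subsetI)
    fix x assume "x \<in> cmap c ` cdom c \<inter> cinv c -` V"
    then have "cinv c x \<in> V \<inter> cdom c" "x = cmap c (cinv c x)" using c by auto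
    then show "x \<in> cmap c ` (V \<inter> cdom c)" by blast
  qed (use c in auto)
  moreover have "open (cmap c ` cdom c \<inter> cinv c -` V)"
    by (rule continuous_open_preimage) (use c V in \<open>simp_all add: homeomorphism_cont2[OF is_chart_homeomorphism] open_cdom\<close>)
  ultimately show ?thesis by simp
qed

lemma open_chart_preimage:
  assumes c: "is_chart c" and W: "open W"
  shows "open {p \<in> cdom c. cmap c p \<in> W}"
proof -
  have "open (cdom c \<inter> cmap c -` W)"
    by (rule continuous_open_preimage) (use c W in \<open>simp_all add: homeomorphism_cont1[OF is_chart_homeomorphism] open_cdom\<close>)
  moreover have "cdom c \<inter> cmap c -` W = {p \<in> cdom c. cmap c p \<in> W}" by auto
  ultimately show ?thesis by simp
qed

lemma open_overlap: "is_chart c \<Longrightarrow> is_chart d \<Longrightarrow> open (cmap c ` (cdom c \<inter> cdom d))"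
  using open_chart_image[of c "cdom d"] by (simp add: open_cdom Int_commute)

section \<open>Tangent vectors in charts\<close>

text \<open>Tangent vectors are handled through their component in one chart, which determines them.\<close>

locale manifold =
  fixes A :: "('m::{t2_space, second_countable_topology}, 'e::euclidean_space) chart set"
  assumes A: "smooth_manifold A"
begin

lemma chart: "c \<in> A \<Longrightarrow> is_chart c"
  using A by (simp add: smooth_manifold_def)

lemma transition_Ck:
  "c \<in> A \<Longrightarrow> d \<in> A \<Longrightarrow> Ck_on k (cmap c ` (cdom c \<inter> cdom d)) (cmap d \<circ> cinv c)"
  using A by (auto simp: smooth_manifold_def Ck_compatible_def)

abbreviation dtrans :: "('m, 'e) chart \<Rightarrow> ('m, 'e) chart \<Rightarrow> 'e \<Rightarrow> 'e \<Rightarrow> 'e" where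
  "dtrans c d x \<equiv> frechet_derivative (cmap d \<circ> cinv c) (at x)"

lemma transition_deriv:
  assumes "c \<in> A" "d \<in> A" "p \<in> cdom c" "p \<in> cdom d"
  shows "((cmap d \<circ> cinv c) has_derivative dtrans c d (cmap c p)) (at (cmap c p))"
  by (rule C1_on_has_frechet_derivative[OF Ck_on_2_imp_C1_on[OF transition_Ck]]) (use assms in auto)

lemma dtrans_self:
  assumes "c \<in> A" "p \<in> cdom c"
  shows "dtrans c c (cmap c p) = (\<lambda>u. u)"
proof (rule frechet_derivative_eqI)
  note c = chart[OF assms(1)]
  show "((cmap c \<circ> cinv c) has_derivative (\<lambda>u. u)) (at (cmap c p))"
    by (rule has_derivative_transform_within_open[OF has_derivative_ident open_cdom(2)[OF c]])
       (use c assms in auto)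
qed

lemma dtrans_dtrans:
  assumes "c \<in> A" "d \<in> A" "d' \<in> A" "p \<in> cdom c" "p \<in> cdom d" "p \<in> cdom d'"
  shows "dtrans d d' (cmap d p) (dtrans c d (cmap c p) u) = dtrans c d' (cmap c p) u"
proof -
  note ch = chart[OF assms(1)] chart[OF assms(2)] chart[OF assms(3)]
  have "((cmap d' \<circ> cinv d) has_derivative dtrans d d' (cmap d p)) (at ((cmap d \<circ> cinv c) (cmap c p)))"
    using transition_deriv[of d d' p] assms ch by simp
  from has_derivative_compose[OF transition_deriv[of c d p] this]
  have 1: "((\<lambda>x. (cmap d' \<circ> cinv d) ((cmap d \<circ> cinv c) x)) has_derivative
      (\<lambda>u. dtrans d d' (cmap d p) (dtrans c d (cmap c p) u))) (at (cmap c p))" using assms by simp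
  have "((cmap d' \<circ> cinv c) has_derivative
      (\<lambda>u. dtrans d d' (cmap d p) (dtrans c d (cmap c p) u))) (at (cmap c p))"
    by (rule has_derivative_transform_within_open[OF 1 open_overlap[OF ch(1,2)]]) (use assms ch in auto)
  from frechet_derivative_eqI[OF this] show ?thesis by simp
qed

lemma coord_vec_in: "c \<in> A \<Longrightarrow> p \<in> cdom c \<Longrightarrow> coord_vec A c p u \<in> tangent_space A p"
  by (auto simp: tangent_space_def coord_vec_def dtrans_dtrans)

lemma coord_vec_self [simp]: "c \<in> A \<Longrightarrow> p \<in> cdom c \<Longrightarrow> coord_vec A c p u c = u"
  by (simp add: coord_vec_def dtrans_self)

lemma tangent_eq_coord_vec:
  assumes v: "v \<in> tangent_space A p" and c: "c \<in> A" "p \<in> cdom c"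
  shows "coord_vec A c p (v c) = v"
proof
  fix d
  show "coord_vec A c p (v c) d = v d"
  proof (cases "d \<in> A \<and> p \<in> cdom d")
    case True
    then have "v d = dtrans c d (cmap c p) (v c)" using v c unfolding tangent_space_def by blast
    then show ?thesis using True unfolding coord_vec_def by simp
  next
    case False
    then have "v d = 0" using v unfolding tangent_space_def by blast
    then show ?thesis using False unfolding coord_vec_def by presburger
  qed
qed

lemma tangent_eqI:
  "v \<in> tangent_space A p \<Longrightarrow> w \<in> tangent_space A p \<Longrightarrow> c \<in> A \<Longrightarrow> p \<in> cdom c \<Longrightarrow> v c = w c \<Longrightarrow> v = w"
  by (metis tangent_eq_coord_vec)

lemma dtrans_bounded_linear:
  "c \<in> A \<Longrightarrow> d \<in> A \<Longrightarrow> p \<in> cdom c \<Longrightarrow> p \<in> cdom d \<Longrightarrow> bounded_linear (dtrans c d (cmap c p))"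
  by (rule has_derivative_bounded_linear[OF transition_deriv])

lemma coord_vec_add:
  "c \<in> A \<Longrightarrow> p \<in> cdom c \<Longrightarrow> coord_vec A c p (u + v) = tadd (coord_vec A c p u) (coord_vec A c p v)"
  unfolding coord_vec_def tadd_def
  by (rule ext) (simp add: linear_add[OF bounded_linear.linear[OF dtrans_bounded_linear]])

lemma coord_vec_scale:
  "c \<in> A \<Longrightarrow> p \<in> cdom c \<Longrightarrow> coord_vec A c p (r *\<^sub>R u) = tscale r (coord_vec A c p u)"
  unfolding coord_vec_def tscale_def
  by (rule ext) (simp add: linear_scale[OF bounded_linear.linear[OF dtrans_bounded_linear]])

lemma coord_vec_0: "c \<in> A \<Longrightarrow> p \<in> cdom c \<Longrightarrow> coord_vec A c p 0 = tzero"
  unfolding coord_vec_def tzero_def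
  by (rule ext) (simp add: linear_0[OF bounded_linear.linear[OF dtrans_bounded_linear]])

lemma tzero_in: "tzero \<in> tangent_space A p"
  using coord_vec_in coord_vec_0 A by (metis UNIV_I UN_E smooth_manifold_def)

lemma Ck_field_1_iff:
  "Ck_field A 1 U X \<longleftrightarrow> (\<forall>p\<in>U. X p \<in> tangent_space A p) \<and>
     (\<forall>c\<in>A. C1_on (cmap c ` (U \<inter> cdom c)) (\<lambda>x. X (cinv c x) c))"
  unfolding Ck_field_def using Ck_on_1_imp_C1_on C1_on_imp_Ck_on_1 by blast

lemma Ck_field_1_subset: "Ck_field A 1 U X \<Longrightarrow> V \<subseteq> U \<Longrightarrow> Ck_field A 1 V X"
  unfolding Ck_field_1_iff by (blast intro: C1_on_subset)

text \<open>In another chart \<open>d\<close> the components are multiplied by the differential of the transition map, which is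
  \<open>C\<^sup>1\<close>. With constant \<open>f\<close> this gives the coordinate fields used in the Koszul formula.\<close>

lemma Ck_field_coord_vec:
  assumes c: "c \<in> A" and U: "open U" "U \<subseteq> cdom c" and f: "C1_on (cmap c ` U) f"
  shows "Ck_field A 1 U (\<lambda>q. coord_vec A c q (f (cmap c q)))"
  unfolding Ck_field_1_iff
proof (intro conjI ballI)
  show "coord_vec A c p (f (cmap c p)) \<in> tangent_space A p" if "p \<in> U" for p
    using that U(2) by (intro coord_vec_in c) auto
  fix d assume d: "d \<in> A"
  note ch = chart[OF c] chart[OF d]
  let ?S = "cmap d ` (U \<inter> cdom d)"
  have dc: "C1_on ?S (cmap c \<circ> cinv d)"
    by (rule C1_on_subset[OF Ck_on_2_imp_C1_on[OF transition_Ck[OF d c]]]) (use U in auto)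
  obtain T where T: "C1_on (cmap c ` (cdom c \<inter> cdom d)) T"
    "\<And>x. x \<in> cmap c ` (cdom c \<inter> cdom d) \<Longrightarrow> ((cmap d \<circ> cinv c) has_derivative blinfun_apply (T x)) (at x)"
    using Ck_on_2_imp_C1_derivative[OF transition_Ck[OF c d]] by blast
  have "C1_on ?S (\<lambda>x. T ((cmap c \<circ> cinv d) x) (f ((cmap c \<circ> cinv d) x)))"
  proof (intro C1_on_blinfun_apply C1_on_compose[OF T(1) dc] C1_on_compose[OF f dc])
    fix x assume "x \<in> ?S"
    then show "(cmap c \<circ> cinv d) x \<in> cmap c ` (cdom c \<inter> cdom d)" "(cmap c \<circ> cinv d) x \<in> cmap c ` U"
      using ch U(2) by auto
  qed
  then show "C1_on ?S (\<lambda>x. coord_vec A c (cinv d x) (f (cmap c (cinv d x))) d)"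
  proof (rule C1_on_cong[rotated 2])
    show "open ?S" by (rule open_chart_image[OF ch(2) U(1)])
    fix x assume "x \<in> ?S"
    then obtain q where q: "q \<in> U" "q \<in> cdom d" "x = cmap d q" by auto
    then have "dtrans c d (cmap c q) = blinfun_apply (T (cmap c q))"
      using U(2) by (intro frechet_derivative_eqI T(2)) auto
    then show "T ((cmap c \<circ> cinv d) x) (f ((cmap c \<circ> cinv d) x)) = coord_vec A c (cinv d x) (f (cmap c (cinv d x))) d"
      using q d ch by (simp add: coord_vec_def)
  qed
qed

end

section \<open>Bilinear forms\<close>

text \<open>Assembles the components of a \<open>C\<^sup>2\<close> metric into an operator-valued map \<open>G\<close>, as required for inverting it.\<close>

lemma bilinear_form_blinfun:
  fixes m :: "'e::euclidean_space \<Rightarrow> 'e \<Rightarrow> 'e \<Rightarrow> real"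
  assumes bil: "\<And>x. x \<in> S \<Longrightarrow> bilinear (m x)"
    and C2: "\<And>u v. Ck_on 2 S (\<lambda>x. m x u v)"
  obtains G :: "'e \<Rightarrow> 'e \<Rightarrow>\<^sub>L 'e" and DG where
    "\<And>x u v. x \<in> S \<Longrightarrow> G x u \<bullet> v = m x u v"
    "\<And>x. x \<in> S \<Longrightarrow> (G has_derivative blinfun_apply (DG x)) (at x)" "C1_on S DG"
proof -
  have "\<exists>D. C1_on S D \<and> (\<forall>x\<in>S. ((\<lambda>x. m x i j) has_derivative blinfun_apply (D x)) (at x))" for i j
    by (rule Ck_on_2_imp_C1_derivative[OF C2])
  then obtain D where D: "\<And>i j. C1_on S (D i j)"
    "\<And>i j x. x \<in> S \<Longrightarrow> ((\<lambda>x. m x i j) has_derivative blinfun_apply (D i j x)) (at x)" by metis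
  define E where "E i j = blinfun_scaleR_left j o\<^sub>L blinfun_inner_right i" for i j :: 'e
  have E: "E i j u = (u \<bullet> i) *\<^sub>R j" for i j u
    by (simp add: E_def blinfun_inner_right.rep_eq inner_commute)
  define G where "G x = (\<Sum>i\<in>Basis. \<Sum>j\<in>Basis. m x i j *\<^sub>R E i j)" for x
  define DG where "DG x = (\<Sum>i\<in>Basis. \<Sum>j\<in>Basis. blinfun_scaleR_left (E i j) o\<^sub>L D i j x)" for x
  show thesis
  proof (rule that)
    show "G x u \<bullet> v = m x u v" if x: "x \<in> S" for x u v
    proof -
      have "m x u v = m x (\<Sum>i\<in>Basis. (u \<bullet> i) *\<^sub>R i) (\<Sum>j\<in>Basis. (v \<bullet> j) *\<^sub>R j)"
        by (simp add: euclidean_representation)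
      also have "\<dots> = (\<Sum>(i, j)\<in>Basis \<times> Basis. m x ((u \<bullet> i) *\<^sub>R i) ((v \<bullet> j) *\<^sub>R j))"
        by (rule bilinear_sum[OF bil[OF x]])
      also have "\<dots> = (\<Sum>i\<in>Basis. \<Sum>j\<in>Basis. m x ((u \<bullet> i) *\<^sub>R i) ((v \<bullet> j) *\<^sub>R j))"
        by (simp add: sum.cartesian_product)
      also have "\<dots> = (\<Sum>i\<in>Basis. \<Sum>j\<in>Basis. m x i j * ((u \<bullet> i) * (v \<bullet> j)))"
        by (intro sum.cong refl) (simp add: bilinear_lmul[OF bil[OF x]] bilinear_rmul[OF bil[OF x]])
      also have "\<dots> = G x u \<bullet> v"
        by (simp add: G_def blinfun.sum_left blinfun.scaleR_left E inner_sum_left inner_commute[of v] mult.assoc)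
      finally show ?thesis by simp
    qed
    show "(G has_derivative blinfun_apply (DG x)) (at x)" if x: "x \<in> S" for x
      unfolding G_def
      by (rule has_derivative_eq_rhs[OF has_derivative_sum[OF has_derivative_sum[OF has_derivative_scaleR_left[OF D(2)[OF x]]]]])
         (simp add: DG_def blinfun.sum_left fun_eq_iff)
    show "C1_on S DG" unfolding DG_def
      by (intro C1_on_sum C1_on_bounded_linear[OF bounded_bilinear.bounded_linear_right[OF bounded_bilinear_blinfun_compose]] D(1))
  qed
qed

lemma blinfun_inverse_exists:
  fixes G :: "'e::euclidean_space \<Rightarrow>\<^sub>L 'e"
  assumes "\<And>u. G u = 0 \<Longrightarrow> u = 0"
  shows "\<exists>B. G o\<^sub>L B = id_blinfun \<and> B o\<^sub>L G = id_blinfun"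
proof -
  have lin: "linear (blinfun_apply G)" by (rule bounded_linear.linear[OF blinfun.bounded_linear_right])
  have "inj (blinfun_apply G)" using assms linear_injective_0[OF lin] by blast
  then obtain f where f: "linear f" "\<forall>x. f (G x) = x" "\<forall>x. G (f x) = x"
    using linear_injective_isomorphism[OF lin] by blast
  have "blinfun_apply (Blinfun f) = f"
    by (rule bounded_linear_Blinfun_apply) (use f(1) in \<open>rule linear_conv_bounded_linear[THEN iffD1]\<close>)
  then show ?thesis using f by (intro exI[of _ "Blinfun f"]) (auto intro!: blinfun_eqI)
qed

text \<open>In the coordinates \<open>u\<close> of an orthonormal frame the form is the Euclidean inner product with the sign of
  one coordinate reversed. The frame map \<open>F\<close> is injective, because reflecting the \<open>b0\<close>-coordinate of \<open>u\<close> turns the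
  form into the Euclidean one; hence it is onto and the frame is a basis.\<close>

lemma lorentz_normal_form:
  fixes m :: "'e::euclidean_space \<Rightarrow> 'e \<Rightarrow> real" and E :: "'e \<Rightarrow> 'e"
  assumes m: "bilinear m"
    and E: "b0 \<in> Basis" "\<And>b b'. b \<in> Basis \<Longrightarrow> b' \<in> Basis \<Longrightarrow>
       m (E b) (E b') = (if b \<noteq> b' then 0 else if b = b0 then -1 else 1)"
  obtains F where "linear F" "surj F" "\<And>u v. m (F u) (F v) = u \<bullet> v - 2 * ((u \<bullet> b0) * (v \<bullet> b0))"
proof -
  define F where "F u = (\<Sum>b\<in>Basis. (u \<bullet> b) *\<^sub>R E b)" for u
  have lin: "linear F"
    unfolding F_def by (intro linearI) (simp_all add: inner_add_left scaleR_add_left sum.distrib scaleR_sum_right)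
  have mF: "m (F u) (F v) = u \<bullet> v - 2 * ((u \<bullet> b0) * (v \<bullet> b0))" for u v
  proof -
    have "m (F u) (F v) = (\<Sum>(b, b')\<in>Basis \<times> Basis. m ((u \<bullet> b) *\<^sub>R E b) ((v \<bullet> b') *\<^sub>R E b'))"
      unfolding F_def by (rule bilinear_sum[OF m])
    also have "\<dots> = (\<Sum>b\<in>Basis. \<Sum>b'\<in>Basis. m ((u \<bullet> b) *\<^sub>R E b) ((v \<bullet> b') *\<^sub>R E b'))"
      by (simp add: sum.cartesian_product)
    also have "\<dots> = (\<Sum>b\<in>Basis. \<Sum>b'\<in>Basis. if b = b' then (u \<bullet> b) * (v \<bullet> b) * (if b = b0 then -1 else 1) else 0)"
      by (intro sum.cong refl) (simp add: bilinear_lmul[OF m] bilinear_rmul[OF m] E(2))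
    also have "\<dots> = (\<Sum>b\<in>Basis. (u \<bullet> b) * (v \<bullet> b) * (if b = b0 then -1 else 1))"
      by (intro sum.cong refl) simp
    also have "\<dots> = (\<Sum>b\<in>Basis. (u \<bullet> b) * (v \<bullet> b) - (if b = b0 then 2 * ((u \<bullet> b0) * (v \<bullet> b0)) else 0))"
      by (intro sum.cong refl) auto
    also have "\<dots> = (\<Sum>b\<in>Basis. (u \<bullet> b) * (v \<bullet> b)) - 2 * ((u \<bullet> b0) * (v \<bullet> b0))"
      using E(1) by (simp add: sum_subtractf)
    also have "(\<Sum>b\<in>Basis. (u \<bullet> b) * (v \<bullet> b)) = u \<bullet> v" by (rule euclidean_inner[symmetric])
    finally show ?thesis .
  qed
  have "inj F"
  proof (subst linear_injective_0[OF lin], intro allI impI)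
    fix u assume "F u = 0"
    then have "m (F u) (F (u - (2 * (u \<bullet> b0)) *\<^sub>R b0)) = 0" by (simp add: bilinear_lzero[OF m])
    then have "u \<bullet> u = 0"
      using E(1) unfolding mF by (simp add: inner_diff_left inner_diff_right algebra_simps)
    then show "u = 0" by simp
  qed
  then have "surj F" using linear_injective_imp_surjective[OF lin] by simp
  then show thesis using lin mF by (intro that)
qed

lemma lorentz_nondegenerate:
  fixes m :: "'e::euclidean_space \<Rightarrow> 'e \<Rightarrow> real" and E :: "'e \<Rightarrow> 'e"
  assumes m: "bilinear m"
    and E: "b0 \<in> Basis" "\<And>b b'. b \<in> Basis \<Longrightarrow> b' \<in> Basis \<Longrightarrow>
       m (E b) (E b') = (if b \<noteq> b' then 0 else if b = b0 then -1 else 1)"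
    and u: "\<And>v. m u v = 0"
  shows "u = 0"
proof -
  obtain F where F: "linear F" "surj F" "\<And>u v. m (F u) (F v) = u \<bullet> v - 2 * ((u \<bullet> b0) * (v \<bullet> b0))"
    using lorentz_normal_form[OF m E] by blast
  obtain a where a: "u = F a" using F(2) by (metis surjD)
  have "m (F a) (F (a - (2 * (a \<bullet> b0)) *\<^sub>R b0)) = 0" using u a by simp
  then have "a \<bullet> a = 0"
    using E(1) unfolding F(3) by (simp add: inner_diff_left inner_diff_right algebra_simps)
  then show ?thesis using a linear_0[OF F(1)] by simp
qed

text \<open>If \<open>N\<close> were orthogonal to \<open>T\<close>, the product of the time components would equal the inner product of the
  spatial parts. By Cauchy-Schwarz this is impossible: the spatial part of \<open>N\<close> is as long as its time
  component and the one of \<open>T\<close> is strictly shorter.\<close>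

lemma lorentz_null_timelike:
  fixes m :: "'e::euclidean_space \<Rightarrow> 'e \<Rightarrow> real" and E :: "'e \<Rightarrow> 'e"
  assumes m: "bilinear m"
    and E: "b0 \<in> Basis" "\<And>b b'. b \<in> Basis \<Longrightarrow> b' \<in> Basis \<Longrightarrow>
       m (E b) (E b') = (if b \<noteq> b' then 0 else if b = b0 then -1 else 1)"
    and N: "m N N = 0" "N \<noteq> 0" and T: "m T T < 0"
  shows "m N T \<noteq> 0"
proof
  assume NT: "m N T = 0"
  obtain F where F: "linear F" "surj F" "\<And>u v. m (F u) (F v) = u \<bullet> v - 2 * ((u \<bullet> b0) * (v \<bullet> b0))"
    using lorentz_normal_form[OF m E] by blast
  obtain a t where a: "N = F a" and t: "T = F t" using F(2) by (metis surjD)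
  define a0 t0 where "a0 = a \<bullet> b0" and "t0 = t \<bullet> b0"
  define a' t' where "a' = a - a0 *\<^sub>R b0" and "t' = t - t0 *\<^sub>R b0"
  have sq: "a' \<bullet> a' = a0\<^sup>2" "t' \<bullet> t' < t0\<^sup>2" "a' \<bullet> t' = a0 * t0"
    using N(1) T NT E(1)
    by (simp_all add: a t F(3) a'_def t'_def a0_def t0_def inner_diff_left inner_diff_right inner_commute power2_eq_square algebra_simps)
  have "a0 \<noteq> 0"
  proof
    assume "a0 = 0"
    then have "a = 0" using sq(1) by (simp add: a'_def)
    then show False using N(2) a linear_0[OF F(1)] by simp
  qed
  have "(a' \<bullet> t')\<^sup>2 \<le> (a' \<bullet> a') * (t' \<bullet> t')" by (rule Cauchy_Schwarz_ineq)
  also have "\<dots> < a0\<^sup>2 * t0\<^sup>2" using \<open>a0 \<noteq> 0\<close> sq by simp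
  finally show False by (simp add: sq(3) power_mult_distrib)
qed

section \<open>The metric and its connection in coordinates\<close>

locale lorentzian_manifold = manifold A
  for A :: "('m::{t2_space, second_countable_topology}, 'e::euclidean_space) chart set" +
  fixes g :: "('m, 'e) metric_tensor"
  assumes g: "lorentzian_metric A 2 g"
begin

definition g_coord :: "('m, 'e) chart \<Rightarrow> 'e \<Rightarrow> 'e \<Rightarrow> 'e \<Rightarrow> real" where
  "g_coord c x u v = g (cinv c x) (coord_vec A c (cinv c x) u) (coord_vec A c (cinv c x) v)"

lemma g_sym: "u \<in> tangent_space A p \<Longrightarrow> v \<in> tangent_space A p \<Longrightarrow> g p u v = g p v u"
  using g unfolding lorentzian_metric_def by blast

lemma g_add: "u \<in> tangent_space A p \<Longrightarrow> v \<in> tangent_space A p \<Longrightarrow> w \<in> tangent_space A p \<Longrightarrow>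
    g p (tadd u v) w = g p u w + g p v w"
  using g unfolding lorentzian_metric_def by blast

lemma g_scale: "u \<in> tangent_space A p \<Longrightarrow> w \<in> tangent_space A p \<Longrightarrow> g p (tscale r u) w = r * g p u w"
  using g unfolding lorentzian_metric_def by blast

context
  fixes c assumes c: "c \<in> A"
begin

lemma g_coord_sym: "x \<in> cmap c ` cdom c \<Longrightarrow> g_coord c x u v = g_coord c x v u"
  unfolding g_coord_def by (intro g_sym coord_vec_in c cinv_in chart)

lemma g_coord_bilinear:
  assumes x: "x \<in> cmap c ` cdom c"
  shows "bilinear (g_coord c x)"
proof -
  have p: "cinv c x \<in> cdom c" using x by (simp add: chart c)
  note in_T = coord_vec_in[OF c p]
  have add: "g_coord c x (u + v) w = g_coord c x u w + g_coord c x v w" for u v w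
    by (simp add: g_coord_def coord_vec_add[OF c p] g_add in_T)
  have scale: "g_coord c x (r *\<^sub>R u) w = r * g_coord c x u w" for r u w
    by (simp add: g_coord_def coord_vec_scale[OF c p] g_scale in_T)
  show ?thesis unfolding bilinear_def
  proof (intro conjI allI linearI)
    fix u v w r
    show "g_coord c x (u + v) w = g_coord c x u w + g_coord c x v w" by (rule add)
    show "g_coord c x (r *\<^sub>R u) w = r *\<^sub>R g_coord c x u w" by (simp add: scale)
    show "g_coord c x w (u + v) = g_coord c x w u + g_coord c x w v"
      unfolding g_coord_sym[OF x, of w] by (rule add)
    show "g_coord c x w (r *\<^sub>R u) = r *\<^sub>R g_coord c x w u"
      unfolding g_coord_sym[OF x, of w] by (simp add: scale)
  qed
qed

lemma g_eq_met:
  "p \<in> cdom c \<Longrightarrow> v \<in> tangent_space A p \<Longrightarrow> w \<in> tangent_space A p \<Longrightarrow>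
    g p v w = g_coord c (cmap c p) (v c) (w c)"
  by (simp add: g_coord_def chart[OF c] tangent_eq_coord_vec[OF _ c])

lemma g_coord_orthonormal_basis:
  assumes x: "x \<in> cmap c ` cdom c"
  shows "\<exists>(E :: 'e \<Rightarrow> 'e) b0. b0 \<in> Basis \<and> (\<forall>b\<in>Basis. \<forall>b'\<in>Basis.
     g_coord c x (E b) (E b') = (if b \<noteq> b' then 0 else if b = b0 then -1 else 1))"
proof -
  obtain p where p: "p \<in> cdom c" "x = cmap c p" using x by auto
  obtain E :: "'e \<Rightarrow> ('m, 'e) tvec" and b0 where E: "b0 \<in> Basis" "\<forall>b\<in>Basis. E b \<in> tangent_space A p"
    "\<forall>b\<in>Basis. \<forall>b'\<in>Basis. g p (E b) (E b') = (if b \<noteq> b' then 0 else if b = b0 then -1 else 1)"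
    using conjunct1[OF conjunct2[OF g[unfolded lorentzian_metric_def]], THEN spec[of _ p]] by blast
  then show ?thesis
    by (intro exI[of _ "\<lambda>b. E b c"] exI[of _ b0]) (simp add: p g_eq_met[symmetric])
qed

lemma g_coord_nondegenerate:
  assumes "x \<in> cmap c ` cdom c" "\<And>v. g_coord c x u v = 0"
  shows "u = 0"
proof -
  obtain E :: "'e \<Rightarrow> 'e" and b0 where "b0 \<in> Basis" "\<forall>b\<in>Basis. \<forall>b'\<in>Basis.
     g_coord c x (E b) (E b') = (if b \<noteq> b' then 0 else if b = b0 then -1 else 1)"
    using g_coord_orthonormal_basis[OF assms(1)] by blast
  then show ?thesis using lorentz_nondegenerate[OF g_coord_bilinear[OF assms(1)], of b0 E u] assms(2) by simp
qed

lemma g_coord_null_timelike: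
  assumes "x \<in> cmap c ` cdom c" "g_coord c x u u = 0" "u \<noteq> 0" "g_coord c x t t < 0"
  shows "g_coord c x u t \<noteq> 0"
proof -
  obtain E :: "'e \<Rightarrow> 'e" and b0 where "b0 \<in> Basis" "\<forall>b\<in>Basis. \<forall>b'\<in>Basis.
     g_coord c x (E b) (E b') = (if b \<noteq> b' then 0 else if b = b0 then -1 else 1)"
    using g_coord_orthonormal_basis[OF assms(1)] by blast
  then show ?thesis using lorentz_null_timelike[OF g_coord_bilinear[OF assms(1)], of b0 E u t] assms(2-4) by simp
qed

lemma g_coord_blinfun:
  "\<exists>(G :: 'e \<Rightarrow> 'e \<Rightarrow>\<^sub>L 'e) DG. (\<forall>x\<in>cmap c ` cdom c. (\<forall>u v. blinfun_apply (G x) u \<bullet> v = g_coord c x u v) \<and> (G has_derivative blinfun_apply (DG x)) (at x)) \<and>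
     C1_on (cmap c ` cdom c) DG"
proof -
  have C2: "Ck_on 2 (cmap c ` cdom c) (\<lambda>x. g_coord c x u v)" for u v
    using g c unfolding lorentzian_metric_def g_coord_def by blast
  show ?thesis
    by (rule bilinear_form_blinfun[OF g_coord_bilinear C2]) (assumption, blast)
qed

end

end

locale metric_chart = lorentzian_manifold A g
  for A :: "('m::{t2_space, second_countable_topology}, 'e::euclidean_space) chart set" and g +
  fixes c :: "('m, 'e) chart" and G :: "'e \<Rightarrow> 'e \<Rightarrow>\<^sub>L 'e" and DG :: "'e \<Rightarrow> 'e \<Rightarrow>\<^sub>L 'e \<Rightarrow>\<^sub>L 'e"
  assumes c: "c \<in> A"
    and G: "\<And>x u v. x \<in> cmap c ` cdom c \<Longrightarrow> G x u \<bullet> v = g_coord c x u v"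
    and G_deriv: "\<And>x. x \<in> cmap c ` cdom c \<Longrightarrow> (G has_derivative blinfun_apply (DG x)) (at x)"
    and DG: "C1_on (cmap c ` cdom c) DG"
begin

lemma g_eq: "p \<in> cdom c \<Longrightarrow> v \<in> tangent_space A p \<Longrightarrow> w \<in> tangent_space A p \<Longrightarrow>
    g p v w = G (cmap c p) (v c) \<bullet> w c"
  by (simp add: g_eq_met[OF c] G)

lemma G_sym: "x \<in> cmap c ` cdom c \<Longrightarrow> G x u \<bullet> v = G x v \<bullet> u"
  using g_coord_sym[OF c] by (simp add: G)

lemma G_inverse_exists:
  assumes "x \<in> cmap c ` cdom c"
  shows "\<exists>B. G x o\<^sub>L B = id_blinfun \<and> B o\<^sub>L G x = id_blinfun"
proof (rule blinfun_inverse_exists)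
  fix u assume "G x u = 0"
  then have "g_coord c x u v = 0" for v using G[OF assms, of u v] by simp
  then show "u = 0" by (rule g_coord_nondegenerate[OF c assms])
qed

abbreviation field_deriv :: "('m \<Rightarrow> ('m, 'e) tvec) \<Rightarrow> 'm \<Rightarrow> 'e \<Rightarrow> 'e" where
  "field_deriv X p \<equiv> frechet_derivative (\<lambda>x. X (cinv c x) c) (at (cmap c p))"

lemma field_deriv:
  assumes "Ck_field A 1 V X" "p \<in> V" "p \<in> cdom c"
  shows "((\<lambda>x. X (cinv c x) c) has_derivative field_deriv X p) (at (cmap c p))"
proof (rule C1_on_has_frechet_derivative)
  show "C1_on (cmap c ` (V \<inter> cdom c)) (\<lambda>x. X (cinv c x) c)"
    using assms(1) c unfolding Ck_field_1_iff by blast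
qed (use assms in auto)

lemma dir_deriv_metric:
  assumes V: "open V" "V \<subseteq> cdom c" "p \<in> V" and X: "Ck_field A 1 V X" and Y: "Ck_field A 1 V Y"
  shows "dir_deriv c p v (\<lambda>q. g q (X q) (Y q)) =
    G (cmap c p) (field_deriv X p (v c)) \<bullet> Y p c + DG (cmap c p) (v c) (X p c) \<bullet> Y p c
    + G (cmap c p) (X p c) \<bullet> field_deriv Y p (v c)"
proof -
  note ch = chart[OF c]
  have p: "p \<in> cdom c" using V by auto
  define X1 where "X1 x = X (cinv c x) c" for x
  define Y1 where "Y1 x = Y (cinv c x) c" for x
  have dX: "(X1 has_derivative field_deriv X p) (at (cmap c p))"
    unfolding X1_def by (rule field_deriv[OF X V(3) p])
  have dY: "(Y1 has_derivative field_deriv Y p) (at (cmap c p))"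
    unfolding Y1_def by (rule field_deriv[OF Y V(3) p])
  have "(G has_derivative blinfun_apply (DG (cmap c p))) (at (cmap c p))" using p by (intro G_deriv) auto
  from has_derivative_inner[OF bounded_bilinear.FDERIV[OF bounded_bilinear_blinfun_apply this dX] dY]
  have "((\<lambda>x. G x (X1 x) \<bullet> Y1 x) has_derivative (\<lambda>h. G (cmap c p) (X1 (cmap c p)) \<bullet> field_deriv Y p h
     + (G (cmap c p) (field_deriv X p h) + DG (cmap c p) h (X1 (cmap c p))) \<bullet> Y1 (cmap c p))) (at (cmap c p))" .
  then have "((\<lambda>q. g q (X q) (Y q)) \<circ> cinv c has_derivative (\<lambda>h. G (cmap c p) (X1 (cmap c p)) \<bullet> field_deriv Y p h
     + (G (cmap c p) (field_deriv X p h) + DG (cmap c p) h (X1 (cmap c p))) \<bullet> Y1 (cmap c p))) (at (cmap c p))"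
  proof (rule has_derivative_transform_within_open[OF _ open_chart_image[OF ch V(1)]])
    show "cmap c p \<in> cmap c ` (V \<inter> cdom c)" using p V by auto
    fix x assume "x \<in> cmap c ` (V \<inter> cdom c)"
    then obtain q where q: "q \<in> V" "q \<in> cdom c" "x = cmap c q" by auto
    have "X q \<in> tangent_space A q" "Y q \<in> tangent_space A q"
      using X Y q(1) unfolding Ck_field_def by blast+
    then show "G x (X1 x) \<bullet> Y1 x = ((\<lambda>q. g q (X q) (Y q)) \<circ> cinv c) x"
      using q ch by (simp add: g_eq X1_def Y1_def)
  qed
  from frechet_derivative_eqI[OF this]
  show ?thesis using p ch by (simp add: dir_deriv_def X1_def Y1_def inner_add_left)
qed

text \<open>The Koszul formula with third field \<open>Z\<close> the coordinate field of components \<open>e\<close>. As \<open>Z\<close> has constant components, the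
  brackets with \<open>Z\<close> are derivatives of \<open>X\<close> and \<open>Y\<close> which cancel, and only the derivative of \<open>Y\<close> in the direction
  \<open>X p\<close> remains besides the derivative of the metric. In particular the value at \<open>p\<close> depends on
  \<open>Y\<close> only through its value at \<open>p\<close> and its derivative along \<open>X p\<close>.\<close>

theorem koszul:
  assumes lc: "levi_civita A g nabla" and U: "open U" "p \<in> U" "p \<in> cdom c"
    and X: "Ck_field A 1 U X" and Y: "Ck_field A 1 U Y"
  shows "nabla X Y p \<in> tangent_space A p"
    and "2 * (G (cmap c p) (nabla X Y p c) \<bullet> e) = 2 * (G (cmap c p) (field_deriv Y p (X p c)) \<bullet> e)
      + DG (cmap c p) (X p c) (Y p c) \<bullet> e + DG (cmap c p) (Y p c) (X p c) \<bullet> e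
      - DG (cmap c p) e (X p c) \<bullet> Y p c"
proof -
  note ch = chart[OF c]
  define V where "V = U \<inter> cdom c"
  have V: "open V" "V \<subseteq> cdom c" "p \<in> V" using U open_cdom[OF ch] by (auto simp: V_def)
  have p: "p \<in> cdom c" by (rule U(3))
  have XY: "Ck_field A 1 V X" "Ck_field A 1 V Y"
    by (rule Ck_field_1_subset[OF X], simp add: V_def, rule Ck_field_1_subset[OF Y], simp add: V_def)
  define Z where "Z q = coord_vec A c q e" for q
  have Z: "Ck_field A 1 V Z"
    unfolding Z_def by (rule Ck_field_coord_vec[OF c V(1,2) C1_on_const])
  have Zp: "Z p c = e" using c p by (simp add: Z_def)
  have DZ: "field_deriv Z p = (\<lambda>_. 0)"
    by (rule frechet_derivative_eqI, rule has_derivative_transform_within_open[OF has_derivative_const open_cdom(2)[OF ch]])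
       (use p ch c in \<open>auto simp: Z_def\<close>)
  have f: "Ck_function A 1 V (\<lambda>_. 0)"
    unfolding Ck_function_def o_def by (intro ballI C1_on_imp_Ck_on_1 C1_on_const)
  have T: "nabla X Y p \<in> tangent_space A p" if "Ck_field A 1 V X" "Ck_field A 1 V Y" for X Y
    using lc V(1,3) c p that f unfolding levi_civita_def affine_connection_def by blast
  show "nabla X Y p \<in> tangent_space A p" by (rule T[OF XY])
  have tors: "nabla X Y p c = nabla Y X p c + (field_deriv Y p (X p c) - field_deriv X p (Y p c))"
    if "Ck_field A 1 V X" "Ck_field A 1 V Y" for X Y
  proof -
    have "nabla X Y p = tadd (nabla Y X p) (lie_bracket A X Y p)"
      using lc V(1,3) c p that unfolding levi_civita_def by blast
    then show ?thesis using c p by (simp add: tadd_def lie_bracket_def)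
  qed
  have compat: "dir_deriv c p (X p) (\<lambda>q. g q (Y q) (Z q)) =
      G (cmap c p) (nabla X Y p c) \<bullet> Z p c + G (cmap c p) (Y p c) \<bullet> nabla X Z p c"
    if XYZ: "Ck_field A 1 V X" "Ck_field A 1 V Y" "Ck_field A 1 V Z" for X Y Z
  proof -
    have "dir_deriv c p (X p) (\<lambda>q. g q (Y q) (Z q)) = g p (nabla X Y p) (Z p) + g p (Y p) (nabla X Z p)"
      using lc V(1,3) c p that unfolding levi_civita_def by blast
    moreover have "Y p \<in> tangent_space A p" "Z p \<in> tangent_space A p"
      using XYZ V(3) unfolding Ck_field_def by blast+
    ultimately show ?thesis using T XYZ p by (simp add: g_eq)
  qed
  let ?G = "\<lambda>v w. G (cmap c p) v \<bullet> w"
  define x y where "x = X p c" and "y = Y p c"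
  note d = dir_deriv_metric[OF V]
  have sym: "?G v w = ?G w v" for v w using G_sym p by auto
  \<comment> \<open>Metric compatibility, differentiating along \<open>X\<close>, \<open>Y\<close> and \<open>Z\<close> in turn.\<close>
  have 1: "?G (nabla X Y p c) e + ?G y (nabla X Z p c) = ?G (field_deriv Y p x) e + DG (cmap c p) x y \<bullet> e"
    using compat[OF XY(1,2) Z] d[OF XY(2) Z, of "X p"] by (simp add: Zp DZ x_def y_def)
  have 2: "?G (nabla Y X p c) e + ?G x (nabla Y Z p c) = ?G (field_deriv X p y) e + DG (cmap c p) y x \<bullet> e"
    using compat[OF XY(2,1) Z] d[OF XY(1) Z, of "Y p"] by (simp add: Zp DZ x_def y_def)
  have 3: "?G (nabla Z X p c) y + ?G x (nabla Z Y p c)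
      = ?G (field_deriv X p e) y + DG (cmap c p) e x \<bullet> y + ?G x (field_deriv Y p e)"
    using compat[OF Z XY] d[OF XY, of "Z p"] by (simp add: Zp x_def y_def)
  have t1: "nabla X Y p c = nabla Y X p c + (field_deriv Y p x - field_deriv X p y)"
    using tors[OF XY] by (simp add: x_def y_def)
  have t2: "nabla X Z p c = nabla Z X p c - field_deriv X p e"
    using tors[OF XY(1) Z] by (simp add: DZ Zp)
  have t3: "nabla Y Z p c = nabla Z Y p c - field_deriv Y p e"
    using tors[OF XY(2) Z] by (simp add: DZ Zp)
  have "?G (nabla Y X p c) e = ?G (nabla X Y p c) e - ?G (field_deriv Y p x) e + ?G (field_deriv X p y) e"
    by (simp add: t1 blinfun.bilinear_simps inner_simps)
  moreover have "?G y (nabla X Z p c) = ?G (nabla Z X p c) y - ?G (field_deriv X p e) y"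
    by (simp add: t2 sym[of y] blinfun.bilinear_simps inner_simps)
  moreover have "?G x (nabla Y Z p c) = ?G x (nabla Z Y p c) - ?G x (field_deriv Y p e)"
    by (simp add: t3 inner_simps)
  ultimately show "2 * ?G (nabla X Y p c) e = 2 * ?G (field_deriv Y p (X p c)) e
      + DG (cmap c p) (X p c) (Y p c) \<bullet> e + DG (cmap c p) (Y p c) (X p c) \<bullet> e
      - DG (cmap c p) e (X p c) \<bullet> Y p c"
    using 1 2 3 unfolding x_def[symmetric] y_def[symmetric] by linarith
qed

end

section \<open>Null hypersurfaces\<close>

text \<open>Two charts are needed. The chart \<open>c\<close> of the smooth atlas carries the metric, whose components are \<open>C\<^sup>2\<close> there. The
  chart \<open>d\<close> straightens \<open>H\<close>, but is only of class \<open>C\<^sup>2\<close>; metric components in it would be merely \<open>C\<^sup>1\<close>, and Christoffel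
  symbols merely continuous.\<close>

locale null_hypersurface_chart = metric_chart A g c G DG
  for A :: "('m::{t2_space, second_countable_topology}, 'e::euclidean_space) chart set" and g c G DG +
  fixes H :: "'m set" and d :: "('m, 'e) chart" and b :: 'e
  assumes d: "is_chart d" "Ck_compatible 2 d c"
    and unit: "b \<in> Basis"
    and straight: "cmap d ` (cdom d \<inter> H) = cmap d ` cdom d \<inter> {x. x \<bullet> b = 0}"
    and null: "\<And>p. p \<in> H \<Longrightarrow> \<exists>v\<in>tangent_space_in A H p. v \<noteq> tzero \<and> (\<forall>w\<in>tangent_space_in A H p. g p v w = 0)"
begin

abbreviation dom :: "'e set" where "dom \<equiv> cmap c ` (cdom c \<inter> cdom d)"
abbreviation \<psi> :: "'e \<Rightarrow> 'e" where "\<psi> \<equiv> cmap d \<circ> cinv c"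
abbreviation \<psi>i :: "'e \<Rightarrow> 'e" where "\<psi>i \<equiv> cmap c \<circ> cinv d"
definition \<phi> :: "'e \<Rightarrow> real" where "\<phi> x = \<psi> x \<bullet> b"
definition n :: "'e \<Rightarrow> 'e" where "n x = (\<Sum>i\<in>Basis. (frechet_derivative \<psi> (at x) i \<bullet> b) *\<^sub>R i)"

lemma dom_subset: "dom \<subseteq> cmap c ` cdom c" by auto

sublocale lv: level_set_chart dom b \<phi> n \<psi> \<psi>i
proof
  note ch = chart[OF c] d(1)
  show "open dom" by (rule open_overlap[OF ch])
  have C2: "Ck_on 2 dom \<psi>" "Ck_on 2 (cmap d ` (cdom d \<inter> cdom c)) \<psi>i"
    using d(2) by (simp_all add: Ck_compatible_def Int_commute)
  have im: "\<psi> ` dom = cmap d ` (cdom d \<inter> cdom c)"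
    using ch(1) by (auto simp: image_image image_iff)
  show "C1_on dom \<psi>" by (rule Ck_on_2_imp_C1_on[OF C2(1)])
  show "open (\<psi> ` dom)" unfolding im by (rule open_overlap[OF ch(2,1)])
  show "C1_on (\<psi> ` dom) \<psi>i" unfolding im by (rule Ck_on_2_imp_C1_on[OF C2(2)])
  show "\<psi>i (\<psi> x) = x" if "x \<in> dom" for x using that ch by auto
  show "b \<bullet> b = 1" using unit by simp
  show "\<phi> x = \<psi> x \<bullet> b" for x by (rule \<phi>_def)
  show "C1_on dom n"
    unfolding n_def by (intro C1_on_sum C1_on_scaleR C1_on_inner C1_on_const Ck_on_2_frechet_C1 C2)
  show "(\<phi> has_derivative (\<lambda>h. n x \<bullet> h)) (at x)" if x: "x \<in> dom" for x
  proof -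
    have D: "(\<psi> has_derivative frechet_derivative \<psi> (at x)) (at x)"
      by (rule C1_on_has_frechet_derivative[OF Ck_on_2_imp_C1_on[OF C2(1)] x])
    interpret bounded_linear "frechet_derivative \<psi> (at x)" by (rule has_derivative_bounded_linear[OF D])
    have "frechet_derivative \<psi> (at x) h \<bullet> b = n x \<bullet> h" for h
    proof -
      have "frechet_derivative \<psi> (at x) h = frechet_derivative \<psi> (at x) (\<Sum>i\<in>Basis. (h \<bullet> i) *\<^sub>R i)"
        by (simp add: euclidean_representation)
      then show ?thesis
        by (simp add: n_def sum scaleR inner_sum_left inner_commute[of _ h] inner_sum_right mult.commute)
    qed
    with has_derivative_inner_left[OF D, of b] show ?thesis by (simp add: \<phi>_def[abs_def])
  qed
qed

lemma H_iff:
  assumes "q \<in> cdom c" "q \<in> cdom d"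
  shows "q \<in> H \<longleftrightarrow> \<phi> (cmap c q) = 0"
proof
  have q: "\<phi> (cmap c q) = cmap d q \<bullet> b" using assms chart[OF c] by (simp add: \<phi>_def)
  show "\<phi> (cmap c q) = 0" if "q \<in> H"
    using straight assms that unfolding q by blast
  assume "\<phi> (cmap c q) = 0"
  then have "cmap d q \<in> cmap d ` (cdom d \<inter> H)" unfolding straight using assms q by simp
  then obtain q' where q': "q' \<in> cdom d" "q' \<in> H" "cmap d q = cmap d q'" by auto
  then have "q = q'" using assms(2) d(1) by (metis cinv_cmap)
  then show "q \<in> H" using q' by simp
qed

text \<open>Together with the converse below: the tangent space of \<open>H\<close> is the kernel of \<open>d\<phi>\<close>.\<close>

lemma coord_vec_tangent_in_H:
  assumes p: "p \<in> H" "p \<in> cdom c" "p \<in> cdom d" and w: "n (cmap c p) \<bullet> w = 0"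
  shows "coord_vec A c p w \<in> tangent_space_in A H p"
proof -
  note ch = chart[OF c]
  have x: "cmap c p \<in> dom" "\<phi> (cmap c p) = 0" using p H_iff by auto
  obtain X \<epsilon> where X: "\<epsilon> > 0" "X 0 = cmap c p" "(X has_vector_derivative w) (at 0)"
    "X C1_differentiable_on {-\<epsilon><..<\<epsilon>}" "\<And>t. t \<in> {-\<epsilon><..<\<epsilon>} \<Longrightarrow> X t \<in> dom \<and> \<phi> (X t) = 0"
    using lv.tangent_curve[OF x w] by metis
  define \<gamma> where "\<gamma> t = cinv c (X t)" for t
  have eq: "(cmap c \<circ> \<gamma>) t = X t" if "t \<in> {-\<epsilon><..<\<epsilon>}" for t
    using X(5)[OF that] ch dom_subset by (auto simp: \<gamma>_def)
  have der: "(cmap c \<circ> \<gamma> has_vector_derivative D) (at t)"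
    if "(X has_vector_derivative D) (at t)" "t \<in> {-\<epsilon><..<\<epsilon>}" for D t
    by (rule has_vector_derivative_transform_within_open[OF that(1) open_greaterThanLessThan that(2)]) (simp only: eq)
  have "(cmap c \<circ> \<gamma>) C1_differentiable_on {-\<epsilon><..<\<epsilon>}"
    using X(4) der unfolding C1_differentiable_on_def by blast
  moreover have "vector_derivative (cmap c \<circ> \<gamma>) (at 0) = w"
    by (rule vector_derivative_at[OF der[OF X(3)]]) (use X(1) in simp)
  moreover have "\<gamma> ` {-\<epsilon><..<\<epsilon>} \<subseteq> H \<inter> cdom c"
  proof (rule image_subsetI)
    fix t assume "t \<in> {-\<epsilon><..<\<epsilon>}"
    then obtain q where q: "q \<in> cdom c" "q \<in> cdom d" "X t = cmap c q" "\<phi> (cmap c q) = 0" using X(5) by force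
    then have "\<gamma> t = q" using ch by (simp add: \<gamma>_def)
    then show "\<gamma> t \<in> H \<inter> cdom c" using q H_iff by simp
  qed
  moreover have "\<gamma> 0 = p" using X(2) ch p by (simp add: \<gamma>_def)
  ultimately show ?thesis
    unfolding tangent_space_in_def using X(1) c
    by (intro CollectI exI[of _ c] exI[of _ \<gamma>] exI[of _ \<epsilon>]) simp
qed

lemma tangent_in_H_imp_coord_vec:
  assumes p: "p \<in> H" "p \<in> cdom c" "p \<in> cdom d" and v: "v \<in> tangent_space_in A H p"
  shows "v \<in> tangent_space A p \<and> n (cmap c p) \<bullet> v c = 0"
proof -
  obtain c' \<gamma> \<epsilon> where v_eq: "v = coord_vec A c' p (vector_derivative (cmap c' \<circ> \<gamma>) (at 0))"
    and c': "c' \<in> A" and \<gamma>: "0 < \<epsilon>" "\<gamma> ` {-\<epsilon><..<\<epsilon>} \<subseteq> H \<inter> cdom c'" "\<gamma> 0 = p"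
      "(cmap c' \<circ> \<gamma>) C1_differentiable_on {-\<epsilon><..<\<epsilon>}"
    using v unfolding tangent_space_in_def by blast
  note ch = chart[OF c] chart[OF c'] d(1)
  define y where "y = cmap c' \<circ> \<gamma>"
  define w' where "w' = vector_derivative y (at 0)"
  have 0: "0 \<in> {-\<epsilon><..<\<epsilon>}" using \<gamma>(1) by simp
  have pc': "p \<in> cdom c'" using \<gamma>(2,3) 0 by blast
  have y': "(y has_vector_derivative w') (at 0)"
    using \<gamma>(4) 0 unfolding y_def[symmetric] w'_def C1_differentiable_on_def
    by (metis vector_derivative_at)
  have y0: "y 0 = cmap c' p" by (simp add: y_def \<gamma>(3))
  have v_c: "v c = dtrans c' c (cmap c' p) w'"
    unfolding v_eq y_def[symmetric] w'_def[symmetric] using c p by (simp add: coord_vec_def)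
  have "((\<lambda>s. (cmap c \<circ> cinv c') (y s)) has_vector_derivative v c) (at 0)"
    unfolding v_c by (rule has_vector_derivative_composed[OF y']) (simp only: y0 transition_deriv[OF c' c pc' p(2)])
  then have "((\<lambda>s. \<phi> ((cmap c \<circ> cinv c') (y s))) has_vector_derivative n (cmap c p) \<bullet> v c) (at 0)"
    by (rule has_vector_derivative_composed) (use lv.\<phi>_deriv[of "cmap c p"] y0 ch p pc' in simp)
  moreover have "\<forall>\<^sub>F s in at 0. \<phi> ((cmap c \<circ> cinv c') (y s)) = 0"
  proof -
    let ?O = "cmap c' ` ((cdom c \<inter> cdom d) \<inter> cdom c')"
    have "open ?O" by (intro open_chart_image open_Int open_cdom ch)
    moreover have "y 0 \<in> ?O" using y0 p pc' by simp
    moreover have "(y \<longlongrightarrow> y 0) (at 0)"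
      using has_vector_derivative_continuous[OF y'] by (simp add: isCont_def)
    ultimately have "\<forall>\<^sub>F s in at 0. y s \<in> ?O" by (rule topological_tendstoD[rotated 1])
    moreover have "\<forall>\<^sub>F s in at 0. s \<in> {-\<epsilon><..<\<epsilon>}" using \<gamma>(1) by (intro eventually_at_in_open') auto
    ultimately show ?thesis
    proof eventually_elim
      case (elim s)
      then obtain q where q: "q \<in> cdom c" "q \<in> cdom d" "q \<in> cdom c'" "y s = cmap c' q" by auto
      have \<gamma>s: "\<gamma> s \<in> H" "\<gamma> s \<in> cdom c'" using \<gamma>(2) elim(2) by auto
      have "cinv c' (y s) = \<gamma> s" using \<gamma>s ch by (simp add: y_def)
      moreover have "cinv c' (y s) = q" using q ch by simp
      ultimately show ?case using q H_iff[of q] \<gamma>s by simp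
    qed
  qed
  moreover have "\<phi> ((cmap c \<circ> cinv c') (y 0)) = 0" using y0 ch pc' p H_iff by simp
  ultimately have "n (cmap c p) \<bullet> v c = 0" by (rule vector_derivative_0_if_eventually_const)
  moreover have "v \<in> tangent_space A p" unfolding v_eq by (rule coord_vec_in[OF c' pc'])
  ultimately show ?thesis by simp
qed

text \<open>The degenerate direction \<open>v\<close> of \<open>T\<^sub>pH\<close> is orthogonal to the kernel of \<open>d\<phi>\<close>, so \<open>g v\<close> is a multiple of \<open>d\<phi>\<close> and \<open>v\<close> a
  multiple of the gradient; since \<open>v\<close> is tangent, so is the gradient.\<close>

lemma gradient_null:
  assumes x: "x \<in> dom" "\<phi> x = 0" and B: "B o\<^sub>L G x = id_blinfun"
  shows "n x \<bullet> B (n x) = 0"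
proof -
  obtain p where p: "p \<in> cdom c" "p \<in> cdom d" "x = cmap c p" using x by auto
  have pH: "p \<in> H" using H_iff p x by simp
  obtain v where v: "v \<in> tangent_space_in A H p" "v \<noteq> tzero" "\<forall>w\<in>tangent_space_in A H p. g p v w = 0"
    using null[OF pH] by blast
  have vT: "v \<in> tangent_space A p" "n x \<bullet> v c = 0"
    using tangent_in_H_imp_coord_vec[OF pH p(1,2) v(1)] p by auto
  have "G x (v c) \<bullet> w = 0" if "n x \<bullet> w = 0" for w
    using v(3) coord_vec_tangent_in_H[OF pH p(1,2), of w] that p
      g_eq[OF p(1) vT(1) coord_vec_in[OF c p(1)], of w] c by simp
  then obtain \<mu> where \<mu>: "G x (v c) = \<mu> *\<^sub>R n x"
    using parallel_if_orthogonal_complement[OF lv.n_nonzero[OF x(1)]] by blast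
  have BG: "B (G x u) = u" for u using B by (metis blinfun_apply_blinfun_compose blinfun_apply_id_blinfun)
  have "v c = \<mu> *\<^sub>R B (n x)" using BG[of "v c"] by (simp add: \<mu> blinfun.scaleR_right)
  moreover have "v c \<noteq> 0"
  proof
    assume "v c = 0"
    then have "v = tzero" using tangent_eq_coord_vec[OF vT(1) c p(1)] coord_vec_0[OF c p(1)] by simp
    then show False using v by simp
  qed
  ultimately show ?thesis using vT(2) by auto
qed

text \<open>The coordinate field \<open>l\<close> of the geodesics is transported to the manifold. Its sign is chosen at \<open>z\<close>, where the gradient
  is not orthogonal to the timelike \<open>T\<close>, and the field stays future-directed nearby. For any
  extension \<open>Y\<close>, the derivative in the direction of \<open>l\<close> is the acceleration of a geodesic that runs in \<open>H\<close>, where \<open>Y\<close> agrees with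
  \<open>l\<close>; so the Koszul formula and the geodesic equation give \<open>\<nabla>\<^sub>L L = 0\<close>.\<close>

theorem geodesic_null_field_exists:
  assumes T: "time_orientation A g T" and lc: "levi_civita A g nabla"
    and z: "z \<in> H" "z \<in> cdom c" "z \<in> cdom d"
  shows "\<exists>Z L. openin (top_of_set H) Z \<and> z \<in> Z \<and>
           Ck_field_along A 1 Z L \<and>
           (\<forall>p\<in>Z. L p \<in> normal_fibre A g H p \<and> L p \<noteq> tzero \<and> future_directed A g T p (L p)) \<and>
           (\<forall>p\<in>Z. has_covariant_derivative_along A nabla Z L L p tzero)"
proof -
  note ch = chart[OF c]
  define x0 where "x0 = cmap c z"
  have x0: "x0 \<in> dom" "\<phi> x0 = 0" using z H_iff by (auto simp: x0_def)
  have "\<forall>x\<in>dom. \<exists>B. G x o\<^sub>L B = id_blinfun \<and> B o\<^sub>L G x = id_blinfun"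
    using G_inverse_exists dom_subset by blast
  then obtain B where B: "\<And>x. x \<in> dom \<Longrightarrow> G x o\<^sub>L B x = id_blinfun" "\<And>x. x \<in> dom \<Longrightarrow> B x o\<^sub>L G x = id_blinfun"
    by metis
  have GB: "G x (B x u) = u" if "x \<in> dom" for x u
    using B(1)[OF that] by (metis blinfun_apply_blinfun_compose blinfun_apply_id_blinfun)
  define t where "t x = T (cinv c x) c" for x
  have T_in: "T p \<in> tangent_space A p" for p using T by (simp add: time_orientation_def Ck_field_def)
  have t_cont: "continuous_on (cmap c ` cdom c) t"
    using T c unfolding time_orientation_def Ck_field_def t_def by simp
  have t_p: "t (cmap c p) = T p c" if "p \<in> cdom c" for p using that ch by (simp add: t_def)
  define N where "N = B x0 (n x0)"
  have "g_coord c x0 N N = 0"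
    using G[of x0 N N] gradient_null[OF x0 B(2)[OF x0(1)]] x0 dom_subset by (auto simp: N_def GB)
  moreover have "N \<noteq> 0"
  proof
    assume "N = 0"
    then have "n x0 = 0" using GB[OF x0(1), of "n x0"] by (simp add: N_def)
    then show False using lv.n_nonzero[OF x0(1)] by simp
  qed
  moreover have "g_coord c x0 (t x0) (t x0) < 0"
    unfolding x0_def t_p[OF z(2)] g_eq_met[OF c z(2) T_in T_in, symmetric]
    using T by (simp add: time_orientation_def)
  ultimately have "g_coord c x0 N (t x0) \<noteq> 0" using x0 dom_subset by (intro g_coord_null_timelike[OF c]) auto
  then have nt: "n x0 \<bullet> t x0 \<noteq> 0" using G[of x0 N "t x0"] x0 dom_subset by (auto simp: N_def GB)
  define s where "s = - sgn (n x0 \<bullet> t x0)"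
  have s: "s \<noteq> 0" "s * (n x0 \<bullet> t x0) < 0" using nt by (auto simp: s_def sgn_if)
  interpret nl: null_level_set dom b \<phi> n \<psi> \<psi>i x0 G B DG s
  proof
    show "(G has_derivative blinfun_apply (DG x)) (at x)" if "x \<in> dom" for x
      using that dom_subset by (intro G_deriv) auto
    show "C1_on dom DG" by (rule C1_on_subset[OF DG dom_subset])
    show "G x u \<bullet> v = G x v \<bullet> u" if "x \<in> dom" for x u v using that dom_subset by (intro G_sym) auto
  qed (use B gradient_null x0 s in auto)
  obtain W l where W: "open W" "x0 \<in> W" "W \<subseteq> dom" "C1_on W l" "l x0 = s *\<^sub>R B x0 (n x0)"
    and lN: "\<And>x. x \<in> W \<Longrightarrow> \<phi> x = 0 \<Longrightarrow> \<exists>\<sigma>. l x = \<sigma> *\<^sub>R B x (n x)"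
    and geo: "\<And>x. x \<in> W \<Longrightarrow> \<phi> x = 0 \<Longrightarrow> \<exists>\<gamma> a. \<gamma> 0 = x \<and> (\<gamma> has_vector_derivative l x) (at 0) \<and>
        (\<forall>\<^sub>F h in at 0. \<gamma> h \<in> W \<and> \<phi> (\<gamma> h) = 0) \<and>
        ((\<lambda>h. l (\<gamma> h)) has_vector_derivative a) (at 0) \<and>
        (\<forall>w. G x a \<bullet> w + DG x (l x) (l x) \<bullet> w = (1/2) * (DG x w (l x) \<bullet> l x))"
    using nl.geodesic_conormal_field by blast
  have Wc: "W \<subseteq> cmap c ` cdom c" using W(3) dom_subset by blast
  define future where "future x \<longleftrightarrow> G x (l x) \<bullet> t x < 0" for x
  define W1 where "W1 = {x \<in> W. future x}"
  have "continuous_on W (\<lambda>x. G x (l x) \<bullet> t x)"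
    by (intro continuous_on_inner bounded_bilinear.continuous_on[OF bounded_bilinear_blinfun_apply]
        C1_on_imp_continuous_on[OF W(4)] continuous_on_subset[OF t_cont Wc]
        continuous_on_subset[OF C1_on_imp_continuous_on[OF nl.G_C1] W(3)])
  then have W1: "open W1"
    using continuous_open_preimage[OF _ W(1) open_lessThan[of 0]]
    by (force simp: W1_def future_def vimage_def Int_def)
  have "x0 \<in> W1" using W(2) s(2) x0 by (simp add: W1_def future_def W(5) blinfun.scaleR_right GB)
  define L where "L p = coord_vec A c p (l (cmap c p))" for p
  define U where "U = {p \<in> cdom c. cmap c p \<in> W1}"
  define Z where "Z = H \<inter> U"
  have U: "open U" unfolding U_def by (rule open_chart_preimage[OF ch W1])
  have L_field: "Ck_field A 1 U L"
    unfolding L_def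
    by (rule Ck_field_coord_vec[OF c U]) (auto simp: U_def W1_def intro: C1_on_subset[OF W(4)])
  have ext: "Ck_extension A 1 Z L p U L" if "p \<in> Z" for p
    using that U L_field by (simp add: Ck_extension_def Z_def)
  have Zp: "p \<in> H" "p \<in> cdom c" "p \<in> cdom d" "cmap c p \<in> W" "cmap c p \<in> dom" "\<phi> (cmap c p) = 0" "future (cmap c p)"
    if "p \<in> Z" for p
  proof -
    show *: "p \<in> H" "p \<in> cdom c" "cmap c p \<in> W" "future (cmap c p)" using that by (auto simp: Z_def U_def W1_def)
    then show "cmap c p \<in> dom" using W(3) by blast
    then obtain q where q: "q \<in> cdom c" "q \<in> cdom d" "cmap c p = cmap c q" by auto
    then have "p = q" using *(2) ch by (metis cinv_cmap)
    then show "p \<in> cdom d" using q by simp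
    then show "\<phi> (cmap c p) = 0" using * H_iff by simp
  qed
  have L_in: "L p \<in> tangent_space A p" "L p c = l (cmap c p)" if "p \<in> cdom c" for p
    using that c by (simp_all add: L_def coord_vec_in)
  have "openin (top_of_set H) Z" unfolding Z_def using U by (rule openin_open_Int)
  moreover have "z \<in> Z" using z \<open>x0 \<in> W1\<close> by (simp add: Z_def U_def x0_def)
  moreover have "Ck_field_along A 1 Z L" unfolding Ck_field_along_def using ext by blast
  moreover have "L p \<in> normal_fibre A g H p \<and> L p \<noteq> tzero \<and> future_directed A g T p (L p)" if "p \<in> Z" for p
  proof -
    note p = Zp[OF that]
    obtain \<sigma> where \<sigma>: "l (cmap c p) = \<sigma> *\<^sub>R B (cmap c p) (n (cmap c p))" using lN[OF p(4,6)] by blast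
    have gL: "g p (L p) w = \<sigma> * (n (cmap c p) \<bullet> w c)" if "w \<in> tangent_space A p" for w
      using g_eq[OF p(2) L_in(1)[OF p(2)] that] L_in(2)[OF p(2)] p(5) by (simp add: \<sigma> blinfun.scaleR_right GB)
    have "g p (L p) w = 0" if "w \<in> tangent_space_in A H p" for w
      using gL tangent_in_H_imp_coord_vec[OF p(1-3) that] by simp
    then have 1: "L p \<in> normal_fibre A g H p" using L_in p(2) by (simp add: normal_fibre_def)
    have 2: "g p (L p) (T p) < 0"
      using g_eq[OF p(2) L_in(1)[OF p(2)] T_in] L_in(2)[OF p(2)] p(7) t_p[OF p(2)] by (simp add: future_def)
    have 3: "g p (L p) (L p) = 0"
      using gL[OF L_in(1)[OF p(2)]] gradient_null[OF p(5,6) B(2)[OF p(5)]] L_in(2)[OF p(2)] by (simp add: \<sigma>)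
    have 4: "L p \<noteq> tzero"
    proof
      assume "L p = tzero"
      then have "L p c = 0" by (simp add: tzero_def)
      then have "g p (L p) (T p) = 0" using g_eq[OF p(2) L_in(1)[OF p(2)] T_in] by simp
      then show False using 2 by simp
    qed
    show ?thesis using 1 2 3 4 L_in p(2) by (simp add: future_directed_def)
  qed
  moreover have "has_covariant_derivative_along A nabla Z L L p tzero" if pZ: "p \<in> Z" for p
    unfolding has_covariant_derivative_along_def
  proof (intro conjI allI impI)
    show "\<exists>U X' Y'. Ck_extension A 1 Z L p U X' \<and> Ck_extension A 1 Z L p U Y'" using ext[OF pZ] by blast
    fix V X Y assume X: "Ck_extension A 1 Z L p V X" and Y: "Ck_extension A 1 Z L p V Y"
    note p = Zp[OF pZ]
    define x where "x = cmap c p"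
    have x: "x \<in> W" "\<phi> x = 0" "x \<in> cmap c ` cdom c" using p by (auto simp: x_def)
    have V: "open V" "p \<in> V" "Ck_field A 1 V X" "Ck_field A 1 V Y"
      and XY: "X p = L p" "\<And>q. q \<in> V \<Longrightarrow> q \<in> Z \<Longrightarrow> Y q = L q"
      using X Y pZ by (auto simp: Ck_extension_def)
    obtain \<gamma> a where \<gamma>: "\<gamma> 0 = x" "(\<gamma> has_vector_derivative l x) (at 0)"
      "\<forall>\<^sub>F h in at 0. \<gamma> h \<in> W \<and> \<phi> (\<gamma> h) = 0" "((\<lambda>h. l (\<gamma> h)) has_vector_derivative a) (at 0)"
      "\<And>w. G x a \<bullet> w + DG x (l x) (l x) \<bullet> w = (1/2) * (DG x w (l x) \<bullet> l x)"
      using geo[OF x(1,2)] by blast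
    have "field_deriv Y p (l x) = a"
    proof (rule vector_derivative_unique_at)
      let ?Y = "\<lambda>x. Y (cinv c x) c"
      show "((\<lambda>h. ?Y (\<gamma> h)) has_vector_derivative field_deriv Y p (l x)) (at 0)"
        by (rule has_vector_derivative_composed[OF \<gamma>(2)]) (use field_deriv[OF V(4,2) p(2)] \<gamma>(1) in \<open>simp add: x_def\<close>)
      let ?O = "W1 \<inter> cmap c ` (V \<inter> cdom c)"
      have "open ?O" by (intro open_Int W1 open_chart_image ch V)
      moreover have "x \<in> ?O" using V(2) p pZ by (auto simp: x_def Z_def U_def)
      moreover have "(\<gamma> \<longlongrightarrow> x) (at 0)"
        using has_vector_derivative_continuous[OF \<gamma>(2)] by (simp add: isCont_def \<gamma>(1))
      ultimately have "\<forall>\<^sub>F h in at 0. \<gamma> h \<in> ?O" by (rule topological_tendstoD[rotated 1])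
      have agree: "?Y y = l y" if y: "y \<in> ?O" "\<phi> y = 0" for y
      proof -
        obtain q where q: "q \<in> V" "q \<in> cdom c" "y = cmap c q" using y by auto
        have "y \<in> dom" using y W(3) by (auto simp: W1_def)
        then obtain q' where q': "q' \<in> cdom c" "q' \<in> cdom d" "y = cmap c q'" by auto
        then have "q = q'" using q ch by (metis cinv_cmap)
        then have "q \<in> H" using H_iff q' y(2) by simp
        then have "q \<in> Z" using q y by (simp add: Z_def U_def)
        then show ?thesis using XY(2)[OF q(1)] L_in(2)[OF q(2)] q ch by simp
      qed
      have "\<forall>\<^sub>F h in at 0. l (\<gamma> h) = ?Y (\<gamma> h)"
        using \<open>\<forall>\<^sub>F h in at 0. \<gamma> h \<in> ?O\<close> \<gamma>(3) by eventually_elim (use agree in simp)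
      moreover have "l (\<gamma> 0) = ?Y (\<gamma> 0)" using agree[OF \<open>x \<in> ?O\<close> x(2)] by (simp add: \<gamma>(1))
      ultimately show "((\<lambda>h. ?Y (\<gamma> h)) has_vector_derivative a) (at 0)"
        using \<gamma>(4) unfolding has_vector_derivative_def by (auto intro: has_derivative_transform_eventually)
    qed
    note D = this
    have Xp: "X p c = l x" "Y p c = l x" using XY(1) XY(2)[OF V(2) pZ] L_in(2)[OF p(2)] by (simp_all add: x_def)
    have "G x (nabla X Y p c) \<bullet> e = 0" for e
      using koszul(2)[OF lc V(1,2) p(2) V(3,4), of e, unfolded Xp D, folded x_def] \<gamma>(5)[of e] by linarith
    then have "G x (nabla X Y p c) = 0" using inner_eq_zero_iff by blast
    then have "nabla X Y p c = 0" using nl.B_G[of x "nabla X Y p c"] W(3) x(1) by auto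
    moreover have "nabla X Y p \<in> tangent_space A p" by (rule koszul(1)[OF lc V(1,2) p(2) V(3,4)])
    ultimately show "nabla X Y p = tzero"
      by (intro tangent_eqI[OF _ tzero_in c p(2)]) (simp_all add: tzero_def)
  qed
  ultimately show ?thesis by blast
qed

end

theorem proposition2p5:
  fixes A :: "('m::{t2_space, second_countable_topology}, 'e::euclidean_space) chart set"
    and g :: "('m, 'e) metric_tensor"
    and T :: "'m \<Rightarrow> ('m, 'e) tvec"
    and nabla :: "('m, 'e) connection"
    and H :: "'m set"
    and z :: 'm
  assumes "smooth_manifold A"
    and "lorentzian_metric A 2 g"
    and "time_orientation A g T"
    and "levi_civita A g nabla"
    and "null_hypersurface A g 2 H"
    and "z \<in> H"
  shows "\<exists>Z L. openin (top_of_set H) Z \<and> z \<in> Z \<and>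
           Ck_field_along A 1 Z L \<and>
           (\<forall>p\<in>Z. L p \<in> normal_fibre A g H p \<and> L p \<noteq> tzero \<and> future_directed A g T p (L p)) \<and>
           (\<forall>p\<in>Z. has_covariant_derivative_along A nabla Z L L p tzero)"
proof -
  interpret lorentzian_manifold A g by unfold_locales (rule assms)+
  have "z \<in> (\<Union>c\<in>A. cdom c)" using assms(1) by (simp add: smooth_manifold_def)
  then obtain c where cz: "c \<in> A" "z \<in> cdom c" by blast
  obtain d b where dz: "is_chart d" "\<forall>c\<in>A. Ck_compatible 2 d c" "z \<in> cdom d" "b \<in> Basis"
    "cmap d ` (cdom d \<inter> H) = cmap d ` cdom d \<inter> {x. x \<bullet> b = 0}"
    using assms(5,6) unfolding null_hypersurface_def Ck_hypersurface_def by blast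
  obtain G :: "'e \<Rightarrow> 'e \<Rightarrow>\<^sub>L 'e" and DG where
    GD: "\<forall>x\<in>cmap c ` cdom c. (\<forall>u v. blinfun_apply (G x) u \<bullet> v = g_coord c x u v) \<and> (G has_derivative blinfun_apply (DG x)) (at x)"
      "C1_on (cmap c ` cdom c) DG"
    using g_coord_blinfun[OF cz(1)] by blast
  interpret null_hypersurface_chart A g c G DG H d b
    by unfold_locales (use cz dz GD assms(5) in \<open>auto simp: null_hypersurface_def\<close>)
  show ?thesis by (rule geodesic_null_field_exists[OF assms(3,4,6) cz(2) dz(3)])
qed

end
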